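(* Let $\mathbb{K}$ be a field of characteristic zero and let $G$ be a simple graph on the vertex set $\{0,1,\dots,n\}$. Then the algebras $\mathcal{B}^T_G$, $\mathcal{C}^T_G$, $\mathcal{D}^T_G$ and $\mathcal{K}^T_G$ defined below are pairwise isomorphic as (non-filtered) algebras, and their dimension over $\mathbb{K}$ equals the number of spanning trees of $G$.
   Context: $\Phi^T_G$ is the commutative $\mathbb{K}$-algebra generated by $\phi_e$ ($e$ an edge of $G$) with defining relations $\phi_e^2=0$ for every edge $e$, and $\prod_{e\in H}\phi_e=0$ for every non-slim set of edges $H$, where $H$ is slim if the graph on all vertices $\{0,\dots,n\}$ with edge set $E(G)\setminus H$ is connected. For a vertex $i$ and edge $e$: $c_{i,e}=1$ if $e$ joins $i$ to $j$ with $i<j$, $c_{i,e}=-1$ if $e$ joins $i$ to $j$ with $i>j$, $c_{i,e}=0$ otherwise. $X^T_i=\sum_e c_{i,e}\phi_e\in\Phi^T_G$, and $\mathcal{C}^T_G$ is the subalgebra generated by $X^T_1,\dots,X^T_n$. $Y^T_i=\exp(X^T_i)=\prod_e(1+c_{i,e}\phi_e)$ for $i=0,\dots,n$, and $\mathcal{K}^T_G$ is the subalgebra of $\Phi^T_G$ generated by $1,Y^T_0,\dots,Y^T_n$. For a vertex set $I$, $D_I$ is the number of edges with exactly one endpoint in $I$. $\mathcal{B}^T_G=\mathbb{K}[x_1,\dots,x_n]/\mathcal{J}^T_G$ where $\mathcal{J}^T_G$ is generated by $\left(\sum_{i\in I}x_i\right)^{D_I}$ for all nonempty $I\subseteq\{1,\dots,n\}$.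 $\mathcal{D}^T_G=\mathbb{K}[y_0,\dots,y_n]/\mathcal{I}^T_G$ where $\mathcal{I}^T_G$ is generated by $\left(\prod_{i\in I}y_i-1\right)^{D_I}$ for all nonempty proper subsets $I\subsetneq\{0,\dots,n\}$ together with $\prod_{i=0}^n y_i-1$. *)

theory Defs
  imports
    "HOL-Algebra.QuotRing"
    "HOL-Algebra.Subrings"
    "HOL-Library.Poly_Mapping"
    "Jordan_Normal_Form.VS_Connect"
begin

section \<open>Graphs on the vertex set \<open>{0..n}\<close>\<close>

text \<open>
  A simple graph is given by its set of edges, an edge being a two-element set of vertices.
\<close>

definition simple_graph :: "nat \<Rightarrow> nat set set \<Rightarrow> bool" where
  "simple_graph n E \<longleftrightarrow> E \<subseteq> {{i, j} | i j. i \<le> n \<and> j \<le> n \<and> i \<noteq> j}"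

definition connected_graph :: "nat \<Rightarrow> nat set set \<Rightarrow> bool" where
  "connected_graph n H \<longleftrightarrow> (\<forall>u\<in>{0..n}. \<forall>v\<in>{0..n}. (u, v) \<in> {(a, b). {a, b} \<in> H}\<^sup>*)"

definition is_cycle :: "nat set set \<Rightarrow> nat list \<Rightarrow> bool" where
  "is_cycle H vs \<longleftrightarrow> 3 \<le> length vs \<and> distinct vs \<and>
     (\<forall>k<length vs. {vs ! k, vs ! (Suc k mod length vs)} \<in> H)"

definition spanning_trees :: "nat \<Rightarrow> nat set set \<Rightarrow> nat set set set" where
  "spanning_trees n E = {T. T \<subseteq> E \<and> connected_graph n T \<and> (\<nexists>vs. is_cycle T vs)}"

definition slim :: "nat \<Rightarrow> nat set set \<Rightarrow> nat set set \<Rightarrow> bool" where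
  "slim n E H \<longleftrightarrow> connected_graph n (E - H)"

definition boundary_card :: "nat set set \<Rightarrow> nat set \<Rightarrow> nat" where
  "boundary_card E I = card {e \<in> E. card (e \<inter> I) = 1}"

definition edge_sign :: "nat \<Rightarrow> nat set \<Rightarrow> 'k::field" where
  "edge_sign i e =
     (if \<exists>j. e = {i, j} \<and> i < j then 1
      else if \<exists>j. e = {i, j} \<and> j < i then - 1
      else 0)"


section \<open>Commutative algebras by generators and relations\<close>

text \<open>
  The ground field is a type \<open>'k\<close> of class field, seen as the ring \<^const>\<open>class_ring\<close> where a
  carrier-based notion needs it.  An algebra is a \<^typ>\<open>('k, 'a) module\<close> record, as in the locale
  \<^locale>\<open>algebra\<close>.  A polynomial maps exponent vectors to coefficients, both finitely supported;
  \<open>poly_algebra V\<close> consists of the polynomials in the variables \<open>V\<close> only.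
\<close>

type_synonym ('v, 'k) mpoly = "('v \<Rightarrow>\<^sub>0 nat) \<Rightarrow>\<^sub>0 'k"

definition Const :: "'k::field \<Rightarrow> ('v, 'k) mpoly" where
  "Const c = Poly_Mapping.single 0 c"

definition Var :: "'v \<Rightarrow> ('v, 'k::field) mpoly" where
  "Var v = Poly_Mapping.single (Poly_Mapping.single v 1) 1"

definition poly_algebra :: "'v set \<Rightarrow> ('k::field, ('v, 'k) mpoly) module" where
  "poly_algebra V =
     \<lparr>carrier = {p. \<forall>m\<in>Poly_Mapping.keys p. Poly_Mapping.keys m \<subseteq> V},
      mult = (*), one = 1, zero = 0, add = (+), smult = (\<lambda>c p. Const c * p)\<rparr>"

text \<open>
  Scalar multiplication on cosets is written as a union over representatives, in the style of
  \<^const>\<open>rcoset_mult\<close>; for an ideal \<open>I\<close> this is \<open>c \<odot> (I + x) = I + c \<odot> x\<close>, see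
  \<open>quot_algebra_smult\<close> below.
\<close>

definition quot_algebra :: "('k, 'a) module \<Rightarrow> 'a set \<Rightarrow> ('k, 'a set) module" where
  "quot_algebra A I =
     ring.extend (A Quot I) (module.fields (\<lambda>c X. \<Union>x\<in>X. I +>\<^bsub>A\<^esub> (c \<odot>\<^bsub>A\<^esub> x)))"

definition presented_algebra ::
    "'v set \<Rightarrow> ('v, 'k::field) mpoly set \<Rightarrow> ('k, ('v, 'k) mpoly set) module" where
  "presented_algebra V S = quot_algebra (poly_algebra V) (genideal (poly_algebra V) S)"

text \<open>Subalgebras are unital and closed under scalar multiplication.\<close>

definition subalgebra_generated :: "('k, 'a) module \<Rightarrow> 'a set \<Rightarrow> ('k, 'a) module" where
  "subalgebra_generated A S =
     A\<lparr>carrier := \<Inter>{B. S \<subseteq> B \<and> subring B A \<and> (\<forall>c. \<forall>x\<in>B. c \<odot>\<^bsub>A\<^esub> x \<in> B)}\<rparr>"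

definition algebra_isomorphic :: "('k, 'a) module \<Rightarrow> ('k, 'b) module \<Rightarrow> bool" where
  "algebra_isomorphic A B \<longleftrightarrow>
     (\<exists>h \<in> ring_iso A B. \<forall>c. \<forall>x\<in>carrier A. h (c \<odot>\<^bsub>A\<^esub> x) = c \<odot>\<^bsub>B\<^esub> h x)"

definition has_dimension :: "('k::field, 'a) module \<Rightarrow> nat \<Rightarrow> bool" where
  "has_dimension A d \<longleftrightarrow>
     vectorspace class_ring A \<and> vectorspace.fin_dim class_ring A \<and> vectorspace.dim class_ring A = d"


section \<open>The algebras attached to a graph\<close>

definition Phi_relations :: "nat \<Rightarrow> nat set set \<Rightarrow> (nat set, 'k::field) mpoly set" where
  "Phi_relations n E =
     {Var e ^ 2 | e. e \<in> E} \<union> {\<Prod>e\<in>H. Var e | H. H \<subseteq> E \<and> \<not> slim n E H}"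

definition Phi :: "nat \<Rightarrow> nat set set \<Rightarrow> ('k::field, (nat set, 'k) mpoly set) module" where
  "Phi n E = presented_algebra E (Phi_relations n E)"

definition phi :: "nat \<Rightarrow> nat set set \<Rightarrow> nat set \<Rightarrow> (nat set, 'k::field) mpoly set" where
  "phi n E e = genideal (poly_algebra E) (Phi_relations n E) +>\<^bsub>poly_algebra E\<^esub> Var e"

definition X_gen :: "nat \<Rightarrow> nat set set \<Rightarrow> nat \<Rightarrow> (nat set, 'k::field) mpoly set" where
  "X_gen n E i = (\<Oplus>\<^bsub>Phi n E\<^esub>e\<in>E. edge_sign i e \<odot>\<^bsub>Phi n E\<^esub> phi n E e)"

text \<open>
  \<open>Y_gen n E i\<close> is the exponential of the nilpotent element \<open>X_gen n E i\<close>, in its product form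
  (the exponential of a multiple of \<open>\<phi>\<^sub>e\<close> is linear because \<open>\<phi>\<^sub>e\<close> squares to zero).
\<close>

definition Y_gen :: "nat \<Rightarrow> nat set set \<Rightarrow> nat \<Rightarrow> (nat set, 'k::field) mpoly set" where
  "Y_gen n E i =
     (\<Otimes>\<^bsub>Phi n E\<^esub>e\<in>E. \<one>\<^bsub>Phi n E\<^esub> \<oplus>\<^bsub>Phi n E\<^esub> edge_sign i e \<odot>\<^bsub>Phi n E\<^esub> phi n E e)"

definition alg_C :: "nat \<Rightarrow> nat set set \<Rightarrow> ('k::field, (nat set, 'k) mpoly set) module" where
  "alg_C n E = subalgebra_generated (Phi n E) (X_gen n E ` {1..n})"

definition alg_K :: "nat \<Rightarrow> nat set set \<Rightarrow> ('k::field, (nat set, 'k) mpoly set) module" where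
  "alg_K n E = subalgebra_generated (Phi n E) ({\<one>\<^bsub>Phi n E\<^esub>} \<union> Y_gen n E ` {0..n})"

definition alg_B :: "nat \<Rightarrow> nat set set \<Rightarrow> ('k::field, (nat, 'k) mpoly set) module" where
  "alg_B n E = presented_algebra {1..n}
     {(\<Sum>i\<in>I. Var i) ^ boundary_card E I | I. I \<noteq> {} \<and> I \<subseteq> {1..n}}"

definition alg_D :: "nat \<Rightarrow> nat set set \<Rightarrow> ('k::field, (nat, 'k) mpoly set) module" where
  "alg_D n E = presented_algebra {0..n}
     ({((\<Prod>i\<in>I. Var i) - 1) ^ boundary_card E I | I. I \<noteq> {} \<and> I \<subset> {0..n}} \<union>
      {(\<Prod>i\<in>{0..n}. Var i) - 1})"


section \<open>The constructions yield algebras\<close>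

lemma vectorspace_if_algebra:
  assumes "algebra class_ring (A :: ('k::field, 'a) module)"
  shows "vectorspace class_ring A"
  using assms class_field.field_axioms by (simp add: algebra_def vectorspace_def)

lemma algebra_poly_algebra: "algebra class_ring (poly_algebra V :: ('k::field, ('v, 'k) mpoly) module)"
proof -
  let ?A = "poly_algebra V :: ('k, ('v, 'k) mpoly) module"
  have add: "p + q \<in> carrier ?A" if "p \<in> carrier ?A" "q \<in> carrier ?A" for p q
    using that Poly_Mapping.keys_add[of p q] by (auto simp: poly_algebra_def)
  have mult: "p * q \<in> carrier ?A" if "p \<in> carrier ?A" "q \<in> carrier ?A" for p q
  proof -
    have "Poly_Mapping.keys m \<subseteq> V" if m: "m \<in> Poly_Mapping.keys (p * q)" for m
    proof -
      obtain a b where "m = a + b" "a \<in> Poly_Mapping.keys p" "b \<in> Poly_Mapping.keys q"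
        using m Poly_Mapping.keys_mult[of p q] by blast
      then show ?thesis
        using \<open>p \<in> carrier ?A\<close> \<open>q \<in> carrier ?A\<close> Poly_Mapping.keys_add[of a b]
        by (fastforce simp: poly_algebra_def)
    qed
    then show ?thesis by (simp add: poly_algebra_def)
  qed
  have Const: "Const c \<in> carrier ?A" for c
    by (simp add: poly_algebra_def Const_def)
  have neg: "- p \<in> carrier ?A" if "p \<in> carrier ?A" for p
    using that by (simp add: poly_algebra_def)
  have one_zero: "1 \<in> carrier ?A" "0 \<in> carrier ?A"
    by (simp_all add: poly_algebra_def)
  have ops [simp]: "mult ?A = (*)" "one ?A = 1" "zero ?A = 0" "add ?A = (+)"
    "smult ?A = (\<lambda>c p. Const c * p)"
    by (simp_all add: poly_algebra_def)
  have "cring ?A"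
  proof (intro cringI abelian_groupI comm_monoidI)
    fix x assume "x \<in> carrier ?A"
    then show "\<exists>y\<in>carrier ?A. y \<oplus>\<^bsub>?A\<^esub> x = \<zero>\<^bsub>?A\<^esub>"
      by (intro bexI[of _ "- x"] neg) simp_all
  qed (simp_all add: add mult one_zero algebra_simps)
  moreover have "Const (a + b) = (Const a + Const b :: ('v, 'k) mpoly)"
    "Const (a * b) = (Const a * Const b :: ('v, 'k) mpoly)" "Const 1 = (1 :: ('v, 'k) mpoly)"
    for a b :: 'k
    by (simp_all add: Const_def single_add mult_single)
  ultimately show ?thesis
    by (intro algebraI class_cring.cring_axioms)
      (simp_all add: mult Const distrib_left distrib_right mult.assoc)
qed

lemma quot_algebra_simps [simp]:
  "carrier (quot_algebra A I) = carrier (A Quot I)"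
  "mult (quot_algebra A I) = mult (A Quot I)"
  "one (quot_algebra A I) = one (A Quot I)"
  "zero (quot_algebra A I) = zero (A Quot I)"
  "add (quot_algebra A I) = add (A Quot I)"
  by (simp_all add: quot_algebra_def ring.defs module.defs)

lemma quot_algebra_smult:
  assumes A: "algebra R A" and I: "ideal I A" and c: "c \<in> carrier R" and x: "x \<in> carrier A"
  shows "c \<odot>\<^bsub>quot_algebra A I\<^esub> (I +>\<^bsub>A\<^esub> x) = I +>\<^bsub>A\<^esub> (c \<odot>\<^bsub>A\<^esub> x)"
proof -
  interpret algebra R A by (fact A)
  interpret I: ideal I A by (fact I)
  have "I +>\<^bsub>A\<^esub> (c \<odot>\<^bsub>A\<^esub> y) = I +>\<^bsub>A\<^esub> (c \<odot>\<^bsub>A\<^esub> x)" if y: "y \<in> I +>\<^bsub>A\<^esub> x" for y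
  proof -
    obtain i where i: "i \<in> I" "y = i \<oplus>\<^bsub>A\<^esub> x"
      using y by (auto simp: a_r_coset_def')
    have iA: "i \<in> carrier A"
      using i I.Icarr by blast
    have "c \<odot>\<^bsub>A\<^esub> i = (c \<odot>\<^bsub>A\<^esub> \<one>\<^bsub>A\<^esub>) \<otimes>\<^bsub>A\<^esub> i"
      using c iA by (simp add: smult_assoc2)
    also have "\<dots> \<in> I"
      using c i by (simp add: I.I_l_closed)
    finally have "c \<odot>\<^bsub>A\<^esub> i \<in> I" .
    then have "c \<odot>\<^bsub>A\<^esub> y \<in> I +>\<^bsub>A\<^esub> (c \<odot>\<^bsub>A\<^esub> x)"
      using i c x iA by (auto simp: a_r_coset_def' smult_r_distr)
    then show ?thesis
      using I.a_repr_independence'[of "c \<odot>\<^bsub>A\<^esub> y" "c \<odot>\<^bsub>A\<^esub> x"] c x by simp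
  qed
  then have "(\<Union>y\<in>I +>\<^bsub>A\<^esub> x. I +>\<^bsub>A\<^esub> (c \<odot>\<^bsub>A\<^esub> y)) = (\<Union>y\<in>I +>\<^bsub>A\<^esub> x. I +>\<^bsub>A\<^esub> (c \<odot>\<^bsub>A\<^esub> x))"
    by (intro SUP_cong refl)
  also have "\<dots> = I +>\<^bsub>A\<^esub> (c \<odot>\<^bsub>A\<^esub> x)"
    using I.a_rcos_self[OF x] by blast
  finally show ?thesis
    by (simp add: quot_algebra_def ring.defs module.defs)
qed

lemma algebra_quot_algebra:
  assumes A: "algebra R A" and I: "ideal I A"
  shows "algebra R (quot_algebra A I)"
proof -
  interpret algebra R A by (fact A)
  interpret I: ideal I A by (fact I)
  let ?Q = "quot_algebra A I"
  interpret Q: cring "A Quot I"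
    by (rule I.quotient_is_cring) (rule algebra.axioms(2)[OF A])
  have cring: "cring ?Q"
    by (intro cringI abelian_groupI comm_monoidI)
      (simp_all add: Q.a_ac Q.m_ac Q.r_distr Q.add.l_inv_ex[simplified])
  have rep: thesis
    if "X \<in> carrier ?Q" "\<And>x. x \<in> carrier A \<Longrightarrow> X = I +>\<^bsub>A\<^esub> x \<Longrightarrow> thesis" for X thesis
    using that by (auto simp: FactRing_simps)
  have cl: "I +>\<^bsub>A\<^esub> x \<in> carrier ?Q" if "x \<in> carrier A" for x
    using that by (auto simp: FactRing_simps)
  have ad: "(I +>\<^bsub>A\<^esub> x) \<oplus>\<^bsub>?Q\<^esub> (I +>\<^bsub>A\<^esub> y) = I +>\<^bsub>A\<^esub> (x \<oplus>\<^bsub>A\<^esub> y)"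
    if "x \<in> carrier A" "y \<in> carrier A" for x y
    using that by (simp add: FactRing_def I.a_rcos_sum)
  have mu: "(I +>\<^bsub>A\<^esub> x) \<otimes>\<^bsub>?Q\<^esub> (I +>\<^bsub>A\<^esub> y) = I +>\<^bsub>A\<^esub> (x \<otimes>\<^bsub>A\<^esub> y)"
    if "x \<in> carrier A" "y \<in> carrier A" for x y
    using that by (simp add: FactRing_def I.rcoset_mult_add)
  note sm = quot_algebra_smult[OF A I]
  show ?thesis
  proof (rule algebraI)
    show "cring R" by (rule R.cring_axioms)
  next
    fix a X assume "a \<in> carrier R" "X \<in> carrier ?Q"
    then show "a \<odot>\<^bsub>?Q\<^esub> X \<in> carrier ?Q"
      by - (erule rep, simp del: quot_algebra_simps add: sm cl)
  next
    fix a b X assume "a \<in> carrier R" "b \<in> carrier R" "X \<in> carrier ?Q"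
    then show "(a \<oplus>\<^bsub>R\<^esub> b) \<odot>\<^bsub>?Q\<^esub> X = a \<odot>\<^bsub>?Q\<^esub> X \<oplus>\<^bsub>?Q\<^esub> b \<odot>\<^bsub>?Q\<^esub> X"
      "(a \<otimes>\<^bsub>R\<^esub> b) \<odot>\<^bsub>?Q\<^esub> X = a \<odot>\<^bsub>?Q\<^esub> (b \<odot>\<^bsub>?Q\<^esub> X)"
      by - (erule rep, simp del: quot_algebra_simps add: sm ad smult_l_distr smult_assoc1)+
  next
    fix a X Y assume "a \<in> carrier R" "X \<in> carrier ?Q" "Y \<in> carrier ?Q"
    then show "a \<odot>\<^bsub>?Q\<^esub> (X \<oplus>\<^bsub>?Q\<^esub> Y) = a \<odot>\<^bsub>?Q\<^esub> X \<oplus>\<^bsub>?Q\<^esub> a \<odot>\<^bsub>?Q\<^esub> Y"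
      "a \<odot>\<^bsub>?Q\<^esub> X \<otimes>\<^bsub>?Q\<^esub> Y = a \<odot>\<^bsub>?Q\<^esub> (X \<otimes>\<^bsub>?Q\<^esub> Y)"
      by - (erule rep, erule rep, simp del: quot_algebra_simps add: sm ad mu smult_r_distr smult_assoc2)+
  next
    fix X assume "X \<in> carrier ?Q"
    then show "\<one>\<^bsub>R\<^esub> \<odot>\<^bsub>?Q\<^esub> X = X"
      by - (erule rep, simp del: quot_algebra_simps add: sm)
  qed (rule cring)
qed

lemma algebra_presented_algebra:
  fixes S :: "('v, 'k::field) mpoly set"
  assumes "S \<subseteq> carrier (poly_algebra V)"
  shows "algebra class_ring (presented_algebra V S)"
proof -
  interpret cring "poly_algebra V :: ('k, ('v, 'k) mpoly) module"
    by (rule algebra.axioms(2)[OF algebra_poly_algebra])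
  show ?thesis
    unfolding presented_algebra_def
    by (intro algebra_quot_algebra algebra_poly_algebra genideal_ideal assms)
qed

lemma subring_subalgebra_generated:
  fixes A :: "('k::field, 'a) module"
  assumes A: "algebra class_ring A" and S: "S \<subseteq> carrier A"
  shows "subring (carrier (subalgebra_generated A S)) A"
proof -
  interpret A: cring A by (rule algebra.axioms(2)[OF A])
  interpret algebra class_ring A by (fact A)
  let ?F = "{B. S \<subseteq> B \<and> subring B A \<and> (\<forall>c. \<forall>x\<in>B. c \<odot>\<^bsub>A\<^esub> x \<in> B)}"
  have "carrier A \<in> ?F"
    using S A.carrier_is_subring by (auto intro: smult_closed)
  then have "subring (\<Inter>?F) A"
    by (intro A.subring_Inter) auto
  then show ?thesis by (simp add: subalgebra_generated_def)
qed

lemma algebra_subalgebra_generated: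
  fixes A :: "('k::field, 'a) module"
  assumes A: "algebra class_ring A" and S: "S \<subseteq> carrier A"
  shows "algebra class_ring (subalgebra_generated A S)"
proof -
  interpret A: cring A by (rule algebra.axioms(2)[OF A])
  interpret algebra class_ring A by (fact A)
  let ?B = "subalgebra_generated A S"
  have sub: "subring (carrier ?B) A"
    by (rule subring_subalgebra_generated[OF assms])
  then have le: "x \<in> carrier A" if "x \<in> carrier ?B" for x
    using that subringE(1) by blast
  have cl: "c \<odot>\<^bsub>A\<^esub> x \<in> carrier ?B" if "x \<in> carrier ?B" for c x
    using that by (auto simp: subalgebra_generated_def)
  have ops [simp]: "mult ?B = mult A" "one ?B = one A" "zero ?B = zero A" "add ?B = add A"
    "smult ?B = smult A"
    by (simp_all add: subalgebra_generated_def)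
  have "cring (A\<lparr>carrier := carrier ?B\<rparr>)"
    by (rule A.subcring_iff[THEN iffD1]) (use le sub in \<open>auto intro: A.subcringI'\<close>)
  then have B: "cring ?B"
    by (simp add: subalgebra_generated_def)
  show ?thesis
  proof (rule algebraI)
    show "cring ?B" by (fact B)
    show "cring (class_ring :: 'k ring)" by (fact class_cring.cring_axioms)
  next
    fix a b :: 'k and x y assume "x \<in> carrier ?B" "y \<in> carrier ?B"
    then have x: "x \<in> carrier A" and y: "y \<in> carrier A"
      by (simp_all add: le)
    show "(a \<oplus>\<^bsub>class_ring\<^esub> b) \<odot>\<^bsub>?B\<^esub> x = a \<odot>\<^bsub>?B\<^esub> x \<oplus>\<^bsub>?B\<^esub> b \<odot>\<^bsub>?B\<^esub> x"
      using smult_l_distr[of a b x] x by simp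
    show "(a \<otimes>\<^bsub>class_ring\<^esub> b) \<odot>\<^bsub>?B\<^esub> x = a \<odot>\<^bsub>?B\<^esub> (b \<odot>\<^bsub>?B\<^esub> x)"
      using smult_assoc1[of a b x] x by simp
    show "\<one>\<^bsub>class_ring\<^esub> \<odot>\<^bsub>?B\<^esub> x = x"
      using smult_one[of x] x by simp
    show "a \<odot>\<^bsub>?B\<^esub> (x \<oplus>\<^bsub>?B\<^esub> y) = a \<odot>\<^bsub>?B\<^esub> x \<oplus>\<^bsub>?B\<^esub> a \<odot>\<^bsub>?B\<^esub> y"
      using smult_r_distr[of a x y] x y by simp
    show "a \<odot>\<^bsub>?B\<^esub> x \<otimes>\<^bsub>?B\<^esub> y = a \<odot>\<^bsub>?B\<^esub> (x \<otimes>\<^bsub>?B\<^esub> y)"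
      using smult_assoc2[of a x y] x y by simp
  qed (simp add: cl)
qed

context
  fixes V :: "'v set"
begin

interpretation P: cring "poly_algebra V :: ('k::field, ('v, 'k) mpoly) module"
  by (rule algebra.axioms(2)[OF algebra_poly_algebra])

lemma Var_in_carrier: "v \<in> V \<Longrightarrow> Var v \<in> carrier (poly_algebra V)"
  by (simp add: poly_algebra_def Var_def)

lemma one_in_carrier: "1 \<in> carrier (poly_algebra V)"
  by (simp add: poly_algebra_def)

lemma mult_in_carrier:
  "p \<in> carrier (poly_algebra V) \<Longrightarrow> q \<in> carrier (poly_algebra V) \<Longrightarrow> p * q \<in> carrier (poly_algebra V)"
  using P.m_closed[of p q] by (simp add: poly_algebra_def)

lemma add_in_carrier:
  "p \<in> carrier (poly_algebra V) \<Longrightarrow> q \<in> carrier (poly_algebra V) \<Longrightarrow> p + q \<in> carrier (poly_algebra V)"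
  using P.a_closed[of p q] by (simp add: poly_algebra_def)

lemma power_in_carrier: "p \<in> carrier (poly_algebra V) \<Longrightarrow> p ^ k \<in> carrier (poly_algebra V)"
  by (induction k) (simp_all add: one_in_carrier mult_in_carrier)

lemma diff_one_in_carrier:
  fixes p :: "('v, 'k::field) mpoly"
  assumes "p \<in> carrier (poly_algebra V)"
  shows "p - 1 \<in> carrier (poly_algebra V)"
proof -
  have "- 1 \<in> carrier (poly_algebra V :: ('k, ('v, 'k) mpoly) module)"
    by (simp add: poly_algebra_def)
  from add_in_carrier[OF assms this] show ?thesis
    by simp
qed

lemma sum_in_carrier:
  "(\<And>i. i \<in> I \<Longrightarrow> f i \<in> carrier (poly_algebra V)) \<Longrightarrow> sum f I \<in> carrier (poly_algebra V)"
proof (induction I rule: infinite_finite_induct)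
  case (insert i I)
  then show ?case by (simp add: add_in_carrier)
qed (simp_all add: poly_algebra_def)

lemma prod_in_carrier:
  "(\<And>i. i \<in> I \<Longrightarrow> f i \<in> carrier (poly_algebra V)) \<Longrightarrow> prod f I \<in> carrier (poly_algebra V)"
  by (induction I rule: infinite_finite_induct) (simp_all add: one_in_carrier mult_in_carrier)

lemmas in_carrier = Var_in_carrier power_in_carrier diff_one_in_carrier sum_in_carrier prod_in_carrier

end

lemma Phi_relations_in_carrier: "Phi_relations n E \<subseteq> carrier (poly_algebra E)"
  unfolding Phi_relations_def by (auto intro!: in_carrier)

lemma algebra_Phi: "algebra class_ring (Phi n E :: ('k::field, _) module)"
  unfolding Phi_def by (intro algebra_presented_algebra Phi_relations_in_carrier)

lemma algebra_alg_B: "algebra class_ring (alg_B n E :: ('k::field, _) module)"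
  unfolding alg_B_def by (rule algebra_presented_algebra) (auto intro!: in_carrier)

lemma algebra_alg_D: "algebra class_ring (alg_D n E :: ('k::field, _) module)"
  unfolding alg_D_def by (rule algebra_presented_algebra) (auto intro!: in_carrier)

context
  fixes n :: nat and E :: "nat set set"
begin

interpretation Phi: cring "Phi n E :: ('k::field, _) module"
  by (rule algebra.axioms(2)[OF algebra_Phi])

lemma phi_in_carrier:
  assumes "e \<in> E"
  shows "phi n E e \<in> carrier (Phi n E :: ('k::field, _) module)"
  using Var_in_carrier[OF assms]
  by (auto simp: phi_def Phi_def presented_algebra_def FactRing_simps)

lemma scaled_phi_in_carrier:
  assumes "e \<in> E"
  shows "c \<odot>\<^bsub>Phi n E\<^esub> phi n E e \<in> carrier (Phi n E :: ('k::field, _) module)"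
  using module.smult_closed[OF algebra.axioms(1)[OF algebra_Phi] _ phi_in_carrier[OF assms]] by simp

lemma X_gen_in_carrier: "X_gen n E i \<in> carrier (Phi n E :: ('k::field, _) module)"
  unfolding X_gen_def by (intro Phi.finsum_closed) (auto intro: scaled_phi_in_carrier)

lemma Y_gen_in_carrier: "Y_gen n E i \<in> carrier (Phi n E :: ('k::field, _) module)"
  unfolding Y_gen_def by (intro Phi.finprod_closed) (auto intro: scaled_phi_in_carrier)

lemma algebra_alg_C: "algebra class_ring (alg_C n E :: ('k::field, _) module)"
  unfolding alg_C_def
  by (intro algebra_subalgebra_generated algebra_Phi) (auto intro: X_gen_in_carrier)

lemma algebra_alg_K: "algebra class_ring (alg_K n E :: ('k::field, _) module)"
  unfolding alg_K_def
  by (intro algebra_subalgebra_generated algebra_Phi) (auto intro: Y_gen_in_carrier)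

end

end

theory Submission
  imports Defs "HOL-Computational_Algebra.Formal_Power_Series"
begin

text \<open>
  Write \<open>\<partial>\<^sub>e = \<partial>\<^sub>i - \<partial>\<^sub>j\<close> for an edge \<open>e = {i, j}\<close> with \<open>i < j\<close>, where \<open>\<partial>\<^sub>0 = 0\<close>.  By Taylor's formula the
  coefficient of \<open>\<Prod>\<^sub>e\<^sub>\<in>\<^sub>H \<phi>\<^sub>e\<close> in \<open>p(X\<^sub>1, \<dots>, X\<^sub>n)\<close> is the constant term of \<open>\<Prod>\<^sub>e\<^sub>\<in>\<^sub>H \<partial>\<^sub>e p\<close>, so the kernel
  of \<open>x\<^sub>i \<mapsto> X\<^sub>i\<close> consists of the polynomials all of whose slim derivatives vanish at the origin.
  This kernel contains the ideal defining \<open>\<B>\<close>.  Equality, and a basis of the quotient indexed by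
  the spanning trees, follow by deletion-contraction: \<open>\<partial>\<^sub>e\<close> maps both ideals of the graph to those
  of the graph without \<open>e\<close>, integration along \<open>e\<close> inverts it on the cut ideals, and the polynomials
  killed by \<open>\<partial>\<^sub>e\<close> form the polynomial ring of the graph with \<open>e\<close> contracted.

  Since the \<open>X\<^sub>i\<close> are nilpotent, \<open>Y\<^sub>i = exp X\<^sub>i\<close> and \<open>X\<^sub>i = log Y\<^sub>i\<close> generate the same subalgebra, whence
  \<open>\<K> = \<C>\<close>.  In \<open>\<D>\<close> the \<open>y\<^sub>i - 1\<close> are nilpotent, and \<open>x\<^sub>i \<mapsto> log y\<^sub>i\<close> defines a surjection \<open>\<B> \<rightarrow> \<D>\<close>
  whose composition with \<open>\<D> \<rightarrow> \<K> = \<C>\<close> is the isomorphism \<open>x\<^sub>i \<mapsto> X\<^sub>i\<close>.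
\<close>


section \<open>Polynomials\<close>

text \<open>No basis of \<Phi> is computed. The implications from \<open>p \<in> IB\<close> to
  \<open>subst L p \<in> ID\<close>, to \<open>subst X p \<in> IPhi\<close>, to
  \<open>null_poly n E {} p\<close> and back to \<open>p \<in> IB\<close> form a cycle, so one
  inclusion per link is enough, and the ideal of \<D> never has to be determined by itself. Only the
  last link is hard. The obstacle there is contraction: it turns a simple graph into one with loops
  and parallel edges, whereas an edge here is a two-element set of vertices. The contracted edges
  are therefore kept in place, and the polynomial ring is cut down instead. Parallel edges then need
  no treatment of their own, and a loop is an edge whose endpoints the contracted edges already
  connect. Characteristic zero enters in three places: integration divides by exponents, a
  polynomial with vanishing partial derivatives must be constant, and exp and log have rational
  coefficients.\<close>

lemma Const_simps [simp]:
  "Const 0 = 0" "Const 1 = 1" "Const (a + b) = Const a + Const b"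
  "Const (a * b) = Const a * Const b" "Const (- a) = - Const a" "Const (a - b) = Const a - Const b"
  by (simp_all add: Const_def single_add mult_single single_uminus single_diff)

lemma Const_of_nat: "Const (of_nat k) = of_nat k"
  by (simp add: Const_def)

lemma poly_mapping_sum_single:
  fixes p :: "'a \<Rightarrow>\<^sub>0 'b::comm_monoid_add"
  assumes "finite K" "Poly_Mapping.keys p \<subseteq> K"
  shows "(\<Sum>m\<in>K. Poly_Mapping.single m (Poly_Mapping.lookup p m)) = p"
proof (rule poly_mapping_eqI)
  fix k
  show "Poly_Mapping.lookup (\<Sum>m\<in>K. Poly_Mapping.single m (Poly_Mapping.lookup p m)) k =
      Poly_Mapping.lookup p k"
    using assms by (auto simp: lookup_sum lookup_single when_def in_keys_iff)
qed

lemma single_eq_Const_mult: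
  fixes a :: "'k::field"
  shows "Poly_Mapping.single m a = Const a * Poly_Mapping.single m 1"
  by (simp add: Const_def mult_single)

lemma monomial_eq_prod_Var:
  "Poly_Mapping.single m (1::'k::field) =
     (\<Prod>v\<in>Poly_Mapping.keys m. Var v ^ Poly_Mapping.lookup m v)"
proof -
  have pow: "Var v ^ k = Poly_Mapping.single (Poly_Mapping.single v k) (1::'k)" for v :: 'a and k
    by (induction k) (simp_all add: Var_def mult_single flip: single_add)
  have prod: "(\<Prod>v\<in>S. Poly_Mapping.single (f v) (1::'k)) = Poly_Mapping.single (sum f S) 1"
    for S :: "'a set" and f :: "'a \<Rightarrow> 'a \<Rightarrow>\<^sub>0 nat"
    by (induction S rule: infinite_finite_induct) (simp_all add: mult_single)
  show ?thesis
    by (simp add: pow prod poly_mapping_sum_single)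
qed

lemma poly_algebra_ops [simp]:
  "(\<otimes>\<^bsub>poly_algebra V\<^esub>) = (*)" "\<one>\<^bsub>poly_algebra V\<^esub> = 1" "\<zero>\<^bsub>poly_algebra V\<^esub> = 0"
  "(\<oplus>\<^bsub>poly_algebra V\<^esub>) = (+)" "(\<odot>\<^bsub>poly_algebra V\<^esub>) = (\<lambda>c p. Const c * p)"
  by (simp_all add: poly_algebra_def)

abbreviation polys :: "'v set \<Rightarrow> ('v, 'k::field) mpoly set" where
  "polys V \<equiv> carrier (poly_algebra V)"

lemma polys_UNIV [simp]: "polys UNIV = UNIV"
  by (simp add: poly_algebra_def)

lemma Const_in_polys [simp]: "Const c \<in> polys V"
  by (simp add: poly_algebra_def Const_def)

lemma uminus_in_polys: "p \<in> polys V \<Longrightarrow> - p \<in> polys V"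
  by (simp add: poly_algebra_def)

lemma zero_in_polys [simp]: "0 \<in> polys V"
  by (simp add: poly_algebra_def)

lemma diff_in_polys: "p \<in> polys V \<Longrightarrow> q \<in> polys V \<Longrightarrow> p - q \<in> polys V"
  using add_in_carrier[OF _ uminus_in_polys, of p V q] by simp

lemmas polys_closed = in_carrier add_in_carrier mult_in_carrier one_in_carrier uminus_in_polys
  zero_in_polys diff_in_polys Const_in_polys

lemma polys_induct [consumes 1, case_names Const Var add mult]:
  fixes p :: "('v, 'k::field) mpoly"
  assumes "p \<in> polys V"
    and C: "\<And>c. P (Const c)" and X: "\<And>v. v \<in> V \<Longrightarrow> P (Var v)"
    and A: "\<And>p q. p \<in> polys V \<Longrightarrow> q \<in> polys V \<Longrightarrow> P p \<Longrightarrow> P q \<Longrightarrow> P (p + q)"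
    and M: "\<And>p q. p \<in> polys V \<Longrightarrow> q \<in> polys V \<Longrightarrow> P p \<Longrightarrow> P q \<Longrightarrow> P (p * q)"
  shows "P p"
proof -
  \<comment> \<open>The premises for sums and products apply only to members of
    \<open>polys V\<close>, so membership is carried along.\<close>
  let ?Q = "\<lambda>p. p \<in> polys V \<and> P p"
  have one: "?Q 1" and zero: "?Q 0"
    using C[of 1] C[of 0] by (simp_all add: polys_closed)
  have mult: "?Q (p * q)" if "?Q p" "?Q q" for p q
    using that M by (simp add: polys_closed)
  have pow: "?Q (Var v ^ k)" if "v \<in> V" for v k
  proof (induction k)
    case (Suc k)
    have "?Q (Var v)" using that X by (simp add: Var_in_carrier)
    with Suc show ?case by (simp only: power_Suc mult)
  qed (use one in simp)
  have prod: "?Q (\<Prod>v\<in>S. Var v ^ f v)" if "S \<subseteq> V" for S and f :: "'v \<Rightarrow> nat"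
    using that
  proof (induction S rule: infinite_finite_induct)
    case (insert v S)
    have "?Q (Var v ^ f v)" using insert.prems pow by blast
    from mult[OF this, of "\<Prod>v\<in>S. Var v ^ f v"] insert show ?case by simp
  qed (use one in simp_all)
  have sum: "?Q (\<Sum>m\<in>S. Const (a m) * (\<Prod>v\<in>Poly_Mapping.keys m. Var v ^ Poly_Mapping.lookup m v))"
    if "\<And>m. m \<in> S \<Longrightarrow> Poly_Mapping.keys m \<subseteq> V" for S :: "('v \<Rightarrow>\<^sub>0 nat) set" and a
    using that
  proof (induction S rule: infinite_finite_induct)
    case (insert m S)
    have "?Q (Const (a m) * (\<Prod>v\<in>Poly_Mapping.keys m. Var v ^ Poly_Mapping.lookup m v))"
      by (intro mult prod insert.prems conjI Const_in_polys C) simp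
    with insert A show ?case by (auto simp: polys_closed)
  qed (use zero in simp_all)
  have "p = (\<Sum>m\<in>Poly_Mapping.keys p. Poly_Mapping.single m (Poly_Mapping.lookup p m))"
    by (simp add: poly_mapping_sum_single)
  also have "\<dots> = (\<Sum>m\<in>Poly_Mapping.keys p. Const (Poly_Mapping.lookup p m) *
      (\<Prod>v\<in>Poly_Mapping.keys m. Var v ^ Poly_Mapping.lookup m v))"
    by (rule sum.cong[OF refl], subst single_eq_Const_mult) (simp add: monomial_eq_prod_Var)
  also have "?Q \<dots>"
    by (rule sum) (use assms(1) in \<open>auto simp: poly_algebra_def\<close>)
  finally show ?thesis by simp
qed

lemma mpoly_induct [case_names Const Var add mult]:
  fixes p :: "('v, 'k::field) mpoly"
  assumes "\<And>c. P (Const c)" "\<And>v. P (Var v)" "\<And>p q. P p \<Longrightarrow> P q \<Longrightarrow> P (p + q)"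
    "\<And>p q. P p \<Longrightarrow> P q \<Longrightarrow> P (p * q)"
  shows "P p"
  by (rule polys_induct[of p UNIV]) (use assms in auto)

lemma additive_eq:
  fixes f g :: "('a \<Rightarrow>\<^sub>0 'b::comm_monoid_add) \<Rightarrow> 'c::comm_monoid_add"
  assumes "f 0 = 0" "g 0 = 0" "\<And>p q. f (p + q) = f p + f q" "\<And>p q. g (p + q) = g p + g q"
    and "\<And>m a. f (Poly_Mapping.single m a) = g (Poly_Mapping.single m a)"
  shows "f p = g p"
proof -
  have *: "h (\<Sum>m\<in>K. Poly_Mapping.single m (a m)) = (\<Sum>m\<in>K. h (Poly_Mapping.single m (a m)))"
    if "h 0 = 0" "\<And>p q. h (p + q) = h p + h q" for h :: "('a \<Rightarrow>\<^sub>0 'b) \<Rightarrow> 'c" and K a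
    by (induction K rule: infinite_finite_induct) (simp_all add: that)
  have "f (\<Sum>m\<in>Poly_Mapping.keys p. Poly_Mapping.single m (Poly_Mapping.lookup p m)) =
      g (\<Sum>m\<in>Poly_Mapping.keys p. Poly_Mapping.single m (Poly_Mapping.lookup p m))"
    using *[of f] *[of g] assms by simp
  then show ?thesis
    by (simp add: poly_mapping_sum_single)
qed

text \<open>Reduces a bilinear identity to pairs of monomials, where it is a computation with
  exponents. Multiplicativity of \<open>constant_term\<close> and \<open>subst\<close> and the
  Leibniz rule are obtained this way.\<close>

lemma biadditive_eq:
  fixes f g :: "('a \<Rightarrow>\<^sub>0 'b::comm_monoid_add) \<Rightarrow> ('a \<Rightarrow>\<^sub>0 'b) \<Rightarrow> 'c::comm_monoid_add"
  assumes "\<And>q. f 0 q = 0" "\<And>q. g 0 q = 0" "\<And>p. f p 0 = 0" "\<And>p. g p 0 = 0"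
    and "\<And>p q r. f (p + q) r = f p r + f q r" "\<And>p q r. g (p + q) r = g p r + g q r"
    and "\<And>p q r. f r (p + q) = f r p + f r q" "\<And>p q r. g r (p + q) = g r p + g r q"
    and "\<And>m a m' b. f (Poly_Mapping.single m a) (Poly_Mapping.single m' b) =
        g (Poly_Mapping.single m a) (Poly_Mapping.single m' b)"
  shows "f p q = g p q"
  by (rule additive_eq[of "\<lambda>p. f p q" "\<lambda>p. g p q"], (rule assms)+,
      rule additive_eq[of "f _" "g _"], (rule assms)+)

section \<open>Constant terms and substitution\<close>

definition constant_term :: "('v, 'k::field) mpoly \<Rightarrow> 'k" where
  "constant_term p = Poly_Mapping.lookup p 0"

lemma constant_term_simps [simp]:
  "constant_term 0 = 0" "constant_term 1 = 1" "constant_term (Const c) = c"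
  "constant_term (Var v) = 0" "constant_term (p + q) = constant_term p + constant_term q"
  "constant_term (p - q) = constant_term p - constant_term q"
  "constant_term (- p) = - constant_term p"
  by (simp_all add: constant_term_def Const_def Var_def lookup_add lookup_minus lookup_single when_def)
    (simp flip: Poly_Mapping.keys_eq_empty)

lemma constant_term_mult [simp]:
  fixes p q :: "('v, 'k::field) mpoly"
  shows "constant_term (p * q) = constant_term p * constant_term q"
proof -
  have 0: "m + m' = 0 \<longleftrightarrow> m = 0 \<and> m' = 0" for m m' :: "'v \<Rightarrow>\<^sub>0 nat"
    by (metis add_eq_0_iff_both_eq_0 lookup_add lookup_zero poly_mapping_eqI)
  show ?thesis
    by (rule biadditive_eq[of "\<lambda>p q. constant_term (p * q)" "\<lambda>p q. constant_term p * constant_term q"])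
      (simp_all add: distrib_left distrib_right, simp add: mult_single constant_term_def lookup_single when_def 0)
qed

lemma constant_term_sum: "constant_term (sum f S) = (\<Sum>x\<in>S. constant_term (f x))"
  by (induction S rule: infinite_finite_induct) simp_all

lemma constant_term_power [simp]: "constant_term (p ^ k) = constant_term p ^ k"
  by (induction k) simp_all


definition subst :: "('v \<Rightarrow> ('w, 'k) mpoly) \<Rightarrow> ('v, 'k::field) mpoly \<Rightarrow> ('w, 'k) mpoly" where
  "subst f p = (\<Sum>m\<in>Poly_Mapping.keys p.
     Const (Poly_Mapping.lookup p m) * (\<Prod>v\<in>Poly_Mapping.keys m. f v ^ Poly_Mapping.lookup m v))"

lemma subst_superset:
  assumes "finite K" "Poly_Mapping.keys p \<subseteq> K"
  shows "subst f p = (\<Sum>m\<in>K.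
     Const (Poly_Mapping.lookup p m) * (\<Prod>v\<in>Poly_Mapping.keys m. f v ^ Poly_Mapping.lookup m v))"
  unfolding subst_def using assms
  by (intro sum.mono_neutral_left) (auto simp: in_keys_iff)

lemma subst_add [simp]: "subst f (p + q) = subst f p + subst f q"
proof -
  let ?K = "Poly_Mapping.keys p \<union> Poly_Mapping.keys q"
  have "Poly_Mapping.keys (p + q) \<subseteq> ?K" by (rule Poly_Mapping.keys_add)
  then show ?thesis
    by (simp add: subst_superset[of ?K] lookup_add sum.distrib distrib_right)
qed

lemma subst_Const [simp]: "subst f (Const c) = Const c"
  by (simp add: subst_def Const_def)

lemma subst_Var [simp]: "subst f (Var v) = f v"
  by (simp add: subst_def Var_def Const_def)

lemma subst_0 [simp]: "subst f 0 = 0"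
  by (simp add: subst_def)

lemma subst_1 [simp]: "subst f 1 = 1"
  using subst_Const[of f 1] by simp

lemma subst_mult [simp]: "subst f (p * q) = subst f p * subst f q"
proof -
  let ?mon = "\<lambda>m. \<Prod>v\<in>Poly_Mapping.keys m. f v ^ Poly_Mapping.lookup m v"
  have sup: "?mon m = (\<Prod>v\<in>K. f v ^ Poly_Mapping.lookup m v)"
    if "finite K" "Poly_Mapping.keys m \<subseteq> K" for K m
    using that by (intro prod.mono_neutral_left) (auto simp: in_keys_iff)
  have mon: "?mon (m + m') = ?mon m * ?mon m'" for m m'
  proof -
    let ?K = "Poly_Mapping.keys m \<union> Poly_Mapping.keys m'"
    have "Poly_Mapping.keys (m + m') \<subseteq> ?K" by (rule Poly_Mapping.keys_add)
    then show ?thesis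
      by (subst (1 2 3) sup[of ?K]) (simp_all add: lookup_add power_add prod.distrib)
  qed
  have single: "subst f (Poly_Mapping.single m a) = Const a * ?mon m" for m a
    by (simp add: subst_def)
  show ?thesis
    by (rule biadditive_eq[of "\<lambda>p q. subst f (p * q)" "\<lambda>p q. subst f p * subst f q"])
      (simp_all add: distrib_left distrib_right, simp add: mult_single single mon mult_ac)
qed

lemma subst_uminus [simp]: "subst f (- p) = - subst f p"
  using subst_add[of f p "- p"] by (simp add: eq_neg_iff_add_eq_0 add.commute del: subst_add)

lemma subst_diff [simp]: "subst f (p - q) = subst f p - subst f q"
  using subst_add[of f p "- q"] by simp

lemma subst_sum: "subst f (sum g S) = (\<Sum>x\<in>S. subst f (g x))"
  by (induction S rule: infinite_finite_induct) simp_all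

lemma subst_prod: "subst f (prod g S) = (\<Prod>x\<in>S. subst f (g x))"
  by (induction S rule: infinite_finite_induct) simp_all

lemma subst_power [simp]: "subst f (p ^ k) = subst f p ^ k"
  by (induction k) simp_all

lemma subst_subst: "subst g (subst f p) = subst (\<lambda>v. subst g (f v)) p"
  by (induction p rule: mpoly_induct) simp_all

lemma subst_in_polys:
  assumes "p \<in> polys V" "\<And>v. v \<in> V \<Longrightarrow> f v \<in> polys W"
  shows "subst f p \<in> polys W"
  using assms(1) by (induction rule: polys_induct) (simp_all add: polys_closed assms(2))

lemma constant_term_subst:
  assumes "\<And>v. constant_term (f v) = 0"
  shows "constant_term (subst f p) = constant_term p"
  by (induction p rule: mpoly_induct) (simp_all add: assms)


section \<open>Derivatives\<close>

text \<open>Given by coefficients rather than term by term, which makes additivity immediate. The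
  finite support that \<open>Abs_poly_mapping\<close> requires is checked in
  \<open>lookup_pderivative\<close>.\<close>

definition pderivative :: "'v \<Rightarrow> ('v, 'k::field) mpoly \<Rightarrow> ('v, 'k) mpoly" where
  "pderivative v p = Abs_poly_mapping
     (\<lambda>m. of_nat (Suc (Poly_Mapping.lookup m v)) * Poly_Mapping.lookup p (m + Poly_Mapping.single v 1))"

lemma lookup_pderivative:
  "Poly_Mapping.lookup (pderivative v p) m =
     of_nat (Suc (Poly_Mapping.lookup m v)) * Poly_Mapping.lookup p (m + Poly_Mapping.single v 1)"
proof -
  let ?h = "\<lambda>m. m + Poly_Mapping.single v (1::nat)"
  have "finite (?h -` Poly_Mapping.keys p)"
    by (rule finite_vimageI) (auto intro: injI)
  then have "finite {m. of_nat (Suc (Poly_Mapping.lookup m v)) * Poly_Mapping.lookup p (?h m) \<noteq> 0}"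
    by (rule finite_subset[rotated]) (auto simp: in_keys_iff)
  then show ?thesis
    unfolding pderivative_def by (subst lookup_Abs_poly_mapping) simp_all
qed

lemma pderivative_add: "pderivative v (p + q) = pderivative v p + pderivative v q"
  by (rule poly_mapping_eqI) (simp add: lookup_pderivative lookup_add algebra_simps)

lemma pderivative_0 [simp]: "pderivative v 0 = 0"
  by (rule poly_mapping_eqI) (simp add: lookup_pderivative)

lemma pderivative_single:
  "pderivative v (Poly_Mapping.single m (a::'k::field)) =
     Poly_Mapping.single (m - Poly_Mapping.single v 1) (of_nat (Poly_Mapping.lookup m v) * a)"
proof (rule poly_mapping_eqI)
  fix k
  \<comment> \<open>Subtraction of exponents truncates, so it can be undone only if the variable
    occurs in \<open>m\<close>. If it does not, the coefficient is zero anyway.\<close>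
  have *: "m = k + Poly_Mapping.single v 1"
    if "m - Poly_Mapping.single v 1 = k" "Poly_Mapping.lookup m v \<noteq> 0"
  proof (rule poly_mapping_eqI)
    fix w
    show "Poly_Mapping.lookup m w = Poly_Mapping.lookup (k + Poly_Mapping.single v 1) w"
      using that by (auto simp: lookup_add lookup_minus lookup_single when_def)
  qed
  show "Poly_Mapping.lookup (pderivative v (Poly_Mapping.single m a)) k =
    Poly_Mapping.lookup (Poly_Mapping.single (m - Poly_Mapping.single v 1)
      (of_nat (Poly_Mapping.lookup m v) * a)) k"
  proof (cases "m = k + Poly_Mapping.single v 1")
    case True
    then show ?thesis by (simp add: lookup_pderivative lookup_add)
  next
    case False
    then have "Poly_Mapping.lookup m v = 0 \<or> m - Poly_Mapping.single v 1 \<noteq> k"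
      using * by blast
    then show ?thesis
      using False by (auto simp: lookup_pderivative lookup_single_not_eq)
  qed
qed

lemma pderivative_Const [simp]: "pderivative v (Const c) = 0"
  by (simp add: Const_def pderivative_single)

lemma pderivative_Var: "pderivative v (Var w) = (if v = w then 1 else 0)"
  by (simp add: Var_def pderivative_single lookup_single when_def)

lemma pderivative_mult:
  fixes p q :: "('v, 'k::field) mpoly"
  shows "pderivative v (p * q) = pderivative v p * q + p * pderivative v q"
proof -
  have mon: "pderivative v (Poly_Mapping.single m a * Poly_Mapping.single m' b) =
      pderivative v (Poly_Mapping.single m a) * Poly_Mapping.single m' b +
      Poly_Mapping.single m a * pderivative v (Poly_Mapping.single m' (b::'k))" for m m' a b
  proof -
    let ?v = "Poly_Mapping.single v (1::nat)"
    have shift: "(x - ?v) + y = x + y - ?v" if "Poly_Mapping.lookup x v \<noteq> 0" for x y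
      using that by (intro poly_mapping_eqI) (auto simp: lookup_add lookup_minus lookup_single when_def)
    have 1: "Poly_Mapping.single ((m - ?v) + m') (of_nat (Poly_Mapping.lookup m v) * (a * b)) =
        Poly_Mapping.single (m + m' - ?v) (of_nat (Poly_Mapping.lookup m v) * (a * b))"
      by (cases "Poly_Mapping.lookup m v = 0") (simp_all only: shift of_nat_0 mult_zero_left single_zero if_True not_False_eq_True)
    have 2: "Poly_Mapping.single (m + (m' - ?v)) (of_nat (Poly_Mapping.lookup m' v) * (a * b)) =
        Poly_Mapping.single (m + m' - ?v) (of_nat (Poly_Mapping.lookup m' v) * (a * b))"
      using shift[of m' m] by (cases "Poly_Mapping.lookup m' v = 0") (simp_all add: add.commute)
    show ?thesis
      using 1 2 by (simp add: mult_single pderivative_single lookup_add algebra_simps flip: single_add)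
  qed
  show ?thesis
    by (rule biadditive_eq[of "\<lambda>p q. pderivative v (p * q)"
          "\<lambda>p q. pderivative v p * q + p * pderivative v q"])
      (simp_all only: mult_zero_left mult_zero_right pderivative_0 add_0_left distrib_left distrib_right
        pderivative_add mon add_ac)
qed

section \<open>Directional derivatives and abstract derivations\<close>

definition dir_derivative :: "'v set \<Rightarrow> ('v \<Rightarrow> 'k) \<Rightarrow> ('v, 'k::field) mpoly \<Rightarrow> ('v, 'k) mpoly" where
  "dir_derivative W c p = (\<Sum>v\<in>W. Const (c v) * pderivative v p)"

text \<open>Linearity over constants is not an axiom: it follows from the product rule and the
  vanishing on constants.\<close>

locale derivation =
  fixes D :: "('v, 'k::field) mpoly \<Rightarrow> ('v, 'k) mpoly"
  assumes add: "D (p + q) = D p + D q"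
    and mult: "D (p * q) = D p * q + p * D q"
    and Const [simp]: "D (Const c) = 0"
begin

lemma zero [simp]: "D 0 = 0"
  using Const[of 0] by simp

lemma one [simp]: "D 1 = 0"
  using Const[of 1] by simp

lemma Const_mult: "D (Const c * p) = Const c * D p"
  by (simp add: mult)

lemma uminus: "D (- p) = - D p"
  using Const_mult[of "-1" p] by simp

lemma diff: "D (p - q) = D p - D q"
  using add[of p "- q"] by (simp add: uminus)

lemma sum: "D (sum f S) = (\<Sum>x\<in>S. D (f x))"
  by (induction S rule: infinite_finite_induct) (simp_all add: add)

lemma power: "D (p ^ k) = of_nat k * p ^ (k - 1) * D p"
proof (induction k)
  case (Suc k)
  then show ?case by (cases k) (simp_all add: mult algebra_simps)
qed simp

lemma funpow_0 [simp]: "(D ^^ k) 0 = 0"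
  by (induction k) simp_all

lemma funpow_add: "(D ^^ k) (p + q) = (D ^^ k) p + (D ^^ k) q"
  by (induction k) (simp_all add: add)

lemma in_polysI:
  assumes "p \<in> polys V" "\<And>v. v \<in> V \<Longrightarrow> D (Var v) \<in> polys V"
  shows "D p \<in> polys V"
  using assms(1) by (induction rule: polys_induct) (simp_all add: add mult assms(2) polys_closed)

text \<open>In the Leibniz expansion of k + l derivatives of a product, either p receives at least k
  of them or q at least l. The induction distributes one derivative at a time, which avoids binomial
  coefficients.\<close>

lemma nilpotent_mult:
  assumes "(D ^^ k) p = 0" "(D ^^ l) q = 0"
  shows "(D ^^ (k + l)) (p * q) = 0"
  using assms
proof (induction "k + l" arbitrary: k l p q)
  case (Suc j)
  have "(D ^^ j) (D p * q) = 0"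
  proof (cases k)
    case 0
    then show ?thesis using Suc.prems by simp
  next
    case (Suc i)
    then show ?thesis
      using Suc.hyps(1)[of i l "D p" q] Suc.hyps(2) Suc.prems by (simp add: funpow_swap1)
  qed
  moreover have "(D ^^ j) (p * D q) = 0"
  proof (cases l)
    case 0
    then show ?thesis using Suc.prems by simp
  next
    case (Suc i)
    then show ?thesis
      using Suc.hyps(1)[of k i p "D q"] Suc.hyps(2) Suc.prems by (simp add: funpow_swap1)
  qed
  ultimately show ?case
    by (simp add: mult funpow_add funpow_swap1 flip: Suc.hyps(2))
qed simp

text \<open>Such a derivation lowers the degree; arguing on generators replaces the degree. This is
  what makes the repeated integration by parts in \<open>integrate_power\<close> stop.\<close>

lemma locally_nilpotent:
  assumes "\<And>v. \<exists>c. D (Var v) = Const c"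
  shows "\<exists>k. (D ^^ k) p = 0"
proof (induction p rule: mpoly_induct)
  case (Const c)
  show ?case by (rule exI[of _ 1]) simp
next
  case (Var v)
  obtain c where "D (Var v) = Const c" using assms by blast
  then show ?case by (intro exI[of _ 2]) (simp add: numeral_2_eq_2)
next
  case (add p q)
  then obtain k l where "(D ^^ k) p = 0" "(D ^^ l) q = 0" by blast
  then have "(D ^^ (l + k)) p = 0" "(D ^^ (k + l)) q = 0"
    by (simp_all only: funpow_add comp_def funpow_0 Nat.funpow_add)
  then show ?case by (intro exI[of _ "k + l"]) (simp add: funpow_add add.commute)
next
  case (mult p q)
  then show ?case using nilpotent_mult by blast
qed

end

lemma derivation_pderivative: "derivation (pderivative v)"
  by standard (simp_all add: pderivative_add pderivative_mult)

lemma derivation_dir_derivative: "derivation (dir_derivative W c)"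
  by standard (simp_all add: dir_derivative_def pderivative_add pderivative_mult algebra_simps
      sum.distrib sum_distrib_left sum_distrib_right)

lemma dir_derivative_Var:
  "finite W \<Longrightarrow> dir_derivative W c (Var v) = (if v \<in> W then Const (c v) else 0)"
  by (simp add: dir_derivative_def pderivative_Var if_distrib cong: if_cong)

text \<open>The commutator of two derivations is again a derivation, and this one vanishes on
  variables because both send variables to constants.\<close>

lemma derivations_commute:
  assumes "derivation D" "derivation D'"
    and "\<And>v. \<exists>c. D (Var v) = Const c" "\<And>v. \<exists>c. D' (Var v) = Const c"
  shows "D (D' p) = D' (D p)"
proof -
  interpret D: derivation D by fact
  interpret D': derivation D' by fact
  show ?thesis
  proof (induction p rule: mpoly_induct)
    case (Var v)
    show ?case using assms(3,4)[of v] by (metis D.Const D'.Const)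
  next
    case (mult p q)
    then show ?case by (simp add: D.mult D'.mult D.add D'.add algebra_simps)
  qed (simp_all add: D.add D'.add)
qed

text \<open>If v occurs in a monomial m, then the coefficient of m divided by v in the derivative is
  a positive integer times the coefficient of m, and characteristic zero allows cancelling that
  integer.\<close>

lemma polys_constI:
  fixes p :: "('v, 'k::field_char_0) mpoly"
  assumes "p \<in> polys V" "\<And>v. v \<in> V \<Longrightarrow> pderivative v p = 0"
  shows "p = Const (constant_term p)"
proof (rule poly_mapping_eqI)
  fix m
  show "Poly_Mapping.lookup p m = Poly_Mapping.lookup (Const (constant_term p)) m"
  proof (cases "m = 0 \<or> m \<notin> Poly_Mapping.keys p")
    case True
    then show ?thesis
      by (auto simp: constant_term_def Const_def lookup_single when_def in_keys_iff)
  next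
    case False
    then obtain v where v: "v \<in> Poly_Mapping.keys m" by (metis all_not_in_conv keys_eq_empty)
    then have "v \<in> V" using False assms(1) by (auto simp: poly_algebra_def)
    let ?m = "m - Poly_Mapping.single v 1"
    have "?m + Poly_Mapping.single v 1 = m"
      using v by (intro poly_mapping_eqI)
        (auto simp: lookup_add lookup_minus lookup_single when_def in_keys_iff)
    then have "of_nat (Suc (Poly_Mapping.lookup ?m v)) * Poly_Mapping.lookup p m = 0"
      using assms(2)[OF \<open>v \<in> V\<close>] by (metis lookup_pderivative lookup_zero)
    then show ?thesis using False by (simp add: in_keys_iff del: of_nat_Suc)
  qed
qed


section \<open>Cuts, bridges and spanning trees\<close>

abbreviation adj :: "nat set set \<Rightarrow> (nat \<times> nat) set" where
  "adj H \<equiv> {(a, b). {a, b} \<in> H}"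

lemma adj_rtrancl_mono: "H \<subseteq> H' \<Longrightarrow> (adj H)\<^sup>* \<subseteq> (adj H')\<^sup>*"
  by (intro rtrancl_mono) auto

lemma adj_rtrancl_sym: "(a, b) \<in> (adj H)\<^sup>* \<Longrightarrow> (b, a) \<in> (adj H)\<^sup>*"
proof -
  have "(adj H)\<inverse> = adj H"
    by (auto simp: insert_commute)
  then show "(a, b) \<in> (adj H)\<^sup>* \<Longrightarrow> (b, a) \<in> (adj H)\<^sup>*"
    by (metis rtrancl_converseI)
qed

lemma connected_graph_iff:
  "connected_graph n H \<longleftrightarrow> (\<forall>u\<in>{0..n}. \<forall>v\<in>{0..n}. (u, v) \<in> (adj H)\<^sup>*)"
  by (simp add: connected_graph_def)

lemma connected_graph_mono: "connected_graph n H \<Longrightarrow> H \<subseteq> H' \<Longrightarrow> connected_graph n H'"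
  using adj_rtrancl_mono[of H H'] by (auto simp: connected_graph_def)

lemma simple_graph_mono: "simple_graph n H' \<Longrightarrow> H \<subseteq> H' \<Longrightarrow> simple_graph n H"
  by (auto simp: simple_graph_def)

lemma simple_graph_edgeE:
  assumes "simple_graph n H" "e \<in> H"
  obtains u v where "e = {u, v}" "u < v" "v \<le> n"
proof -
  obtain i j where "e = {i, j}" "i \<le> n" "j \<le> n" "i \<noteq> j"
    using assms by (auto simp: simple_graph_def)
  then show thesis
    by (cases "i < j") (auto intro: that simp: insert_commute)
qed

lemma simple_graph_finite: "simple_graph n H \<Longrightarrow> finite H"
proof -
  assume "simple_graph n H"
  then have "H \<subseteq> Pow {0..n}"
    by (auto elim!: simple_graph_edgeE)
  then show ?thesis by (rule finite_subset) simp
qed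

lemma card_pair_Int:
  "u \<noteq> v \<Longrightarrow> card ({u, v} \<inter> I) = 1 \<longleftrightarrow> (u \<in> I) \<noteq> (v \<in> I)"
  by (cases "u \<in> I"; cases "v \<in> I") (simp_all add: Int_insert_left)

text \<open>A path can be shortened until it uses the new edge at most once, in one of its two
  directions.\<close>

lemma rtrancl_adj_insert:
  assumes "(a, b) \<in> (adj (insert {u, v} H))\<^sup>*"
  shows "(a, b) \<in> (adj H)\<^sup>* \<or> (a, u) \<in> (adj H)\<^sup>* \<and> (v, b) \<in> (adj H)\<^sup>* \<or>
    (a, v) \<in> (adj H)\<^sup>* \<and> (u, b) \<in> (adj H)\<^sup>*"
  using assms
proof (induction rule: rtrancl_induct)
  case (step y z)
  show ?case
  proof (cases "{y, z} \<in> H")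
    case True
    then have "(y, z) \<in> adj H" by simp
    with step.IH show ?thesis by (meson rtrancl.rtrancl_into_rtrancl)
  next
    case False
    then have "y = u \<and> z = v \<or> y = v \<and> z = u"
      using step.hyps by (auto simp: doubleton_eq_iff)
    with step.IH show ?thesis by auto
  qed
qed simp

text \<open>Acyclicity in the form that every edge is a bridge. Inserting an edge can be treated
  directly in this form, without cycles as lists; \<open>acyclic_iff_forest\<close> compares the
  two.\<close>

definition forest :: "nat set set \<Rightarrow> bool" where
  "forest H \<longleftrightarrow> (\<forall>u v. {u, v} \<in> H \<longrightarrow> u \<noteq> v \<longrightarrow> (u, v) \<notin> (adj (H - {{u, v}}))\<^sup>*)"

lemma forest_insertD:
  assumes "forest (insert {u, v} F)" "{u, v} \<notin> F" "u \<noteq> v"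
  shows "(u, v) \<notin> (adj F)\<^sup>*"
proof -
  have "insert {u, v} F - {{u, v}} = F" using assms by auto
  then show ?thesis using assms(1,3) unfolding forest_def by (metis insertI1)
qed

text \<open>If an old edge were no longer a bridge, a path around it would have to use the new edge;
  together with the old edge, the rest of that path would connect u and v inside F.\<close>

lemma forest_insertI:
  assumes F: "forest F" and uv: "(u, v) \<notin> (adj F)\<^sup>*"
  shows "forest (insert {u, v} F)"
  unfolding forest_def
proof (intro allI impI)
  fix a b assume ab: "{a, b} \<in> insert {u, v} F" "a \<noteq> b"
  have uvF: "{u, v} \<notin> F"
    using uv by auto
  show "(a, b) \<notin> (adj (insert {u, v} F - {{a, b}}))\<^sup>*"
  proof (cases "{a, b} = {u, v}")
    case True
    then have "insert {u, v} F - {{a, b}} = F" using uvF by auto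
    then show ?thesis
      using True uv adj_rtrancl_sym[of v u F] unfolding doubleton_eq_iff by metis
  next
    case False
    let ?F = "F - {{a, b}}"
    have ab_F: "{a, b} \<in> F" using ab False by auto
    have eq: "insert {u, v} F - {{a, b}} = insert {u, v} ?F" using False by auto
    have sub: "(adj ?F)\<^sup>* \<subseteq> (adj F)\<^sup>*" by (rule adj_rtrancl_mono) auto
    have ba: "(a, b) \<in> (adj F)\<^sup>*" "(b, a) \<in> (adj F)\<^sup>*" using ab_F by (auto simp: insert_commute)
    show ?thesis
    proof
      assume "(a, b) \<in> (adj (insert {u, v} F - {{a, b}}))\<^sup>*"
      from rtrancl_adj_insert[OF this[unfolded eq]]
      consider "(a, b) \<in> (adj ?F)\<^sup>*" | "(a, u) \<in> (adj F)\<^sup>*" "(v, b) \<in> (adj F)\<^sup>*"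
        | "(a, v) \<in> (adj F)\<^sup>*" "(u, b) \<in> (adj F)\<^sup>*"
        using sub by blast
      then show False
      proof cases
        case 1
        then show False using F ab_F ab(2) unfolding forest_def by blast
      next
        case 2
        have "(u, v) \<in> (adj F)\<^sup>*"
          by (rule rtrancl_trans[OF adj_rtrancl_sym[OF 2(1)] rtrancl_trans[OF ba(1) adj_rtrancl_sym[OF 2(2)]]])
        then show False using uv by blast
      next
        case 3
        have "(u, v) \<in> (adj F)\<^sup>*"
          by (rule rtrancl_trans[OF 3(2) rtrancl_trans[OF ba(2) 3(1)]])
        then show False using uv by blast
      qed
    qed
  qed
qed

lemma rtrancl_simple_path:
  assumes "(u, v) \<in> r\<^sup>*"
  shows "\<exists>vs. vs \<noteq> [] \<and> hd vs = u \<and> last vs = v \<and> distinct vs \<and>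
    (\<forall>k. Suc k < length vs \<longrightarrow> (vs ! k, vs ! Suc k) \<in> r)"
  using assms
proof (induction rule: converse_rtrancl_induct)
  case base
  show ?case by (rule exI[of _ "[v]"]) simp
next
  case (step u w)
  then obtain vs where vs: "vs \<noteq> []" "hd vs = w" "last vs = v" "distinct vs"
    "\<And>k. Suc k < length vs \<Longrightarrow> (vs ! k, vs ! Suc k) \<in> r" by blast
  show ?case
  proof (cases "u \<in> set vs")
    \<comment> \<open>The path comes back to u, so everything before that visit is dropped.\<close>
    case True
    then obtain as bs where "vs = as @ u # bs" by (meson split_list)
    moreover have "(vs ! (length as + k), vs ! Suc (length as + k)) \<in> r"
      if "Suc k < length (u # bs)" for k
      using vs(5)[of "length as + k"] that \<open>vs = as @ u # bs\<close> by simp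
    ultimately show ?thesis
      using vs by (intro exI[of _ "u # bs"]) (auto simp: nth_append)
  next
    case False
    have "((u # vs) ! k, (u # vs) ! Suc k) \<in> r" if "Suc k < length (u # vs)" for k
      using that vs step.hyps(1) by (cases k) (auto simp: hd_conv_nth)
    then show ?thesis using vs False by (intro exI[of _ "u # vs"]) simp
  qed
qed

text \<open>A simple path around an edge closes up with it to a cycle; conversely, a cycle without
  its closing edge is a path around that edge.\<close>

lemma acyclic_iff_forest:
  assumes H: "simple_graph n H"
  shows "(\<nexists>vs. is_cycle H vs) \<longleftrightarrow> forest H"
proof
  assume acyc: "\<nexists>vs. is_cycle H vs"
  show "forest H"
    unfolding forest_def
  proof (intro allI impI notI)
    fix u v assume uv: "{u, v} \<in> H" "u \<noteq> v" "(u, v) \<in> (adj (H - {{u, v}}))\<^sup>*"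
    from rtrancl_simple_path[OF uv(3)] obtain vs where vs: "vs \<noteq> []" "hd vs = u" "last vs = v"
      "distinct vs" "\<And>k. Suc k < length vs \<Longrightarrow> {vs ! k, vs ! Suc k} \<in> H - {{u, v}}"
      by auto
    have first: "vs ! 0 = u" and final: "vs ! (length vs - 1) = v"
      using vs(1-3) by (simp_all add: hd_conv_nth last_conv_nth)
    \<comment> \<open>Length one would mean u = v, and length two would make the path use the
      removed edge.\<close>
    have "length vs \<noteq> 1" using first final uv(2) by auto
    moreover have "length vs \<noteq> 2"
      using first final vs(5)[of 0] by auto
    moreover have "length vs \<noteq> 0" using vs(1) by simp
    ultimately have len: "3 \<le> length vs" by linarith
    have "{vs ! k, vs ! (Suc k mod length vs)} \<in> H" if k: "k < length vs" for k
    proof (cases "Suc k < length vs")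
      case True
      then show ?thesis using vs(5)[OF True] by simp
    next
      case False
      then have "Suc k = length vs" using k by simp
      then have "k = length vs - 1" by simp
      then show ?thesis using \<open>Suc k = length vs\<close> first final uv(1) by (simp add: insert_commute)
    qed
    then have "is_cycle H vs" using len vs(4) by (simp add: is_cycle_def)
    then show False using acyc by blast
  qed
next
  assume forest: "forest H"
  show "\<nexists>vs. is_cycle H vs"
  proof (rule notI, elim exE)
    fix vs assume "is_cycle H vs"
    then have len: "3 \<le> length vs" and dist: "distinct vs"
      and edges: "\<And>k. k < length vs \<Longrightarrow> {vs ! k, vs ! (Suc k mod length vs)} \<in> H"
      by (auto simp: is_cycle_def)
    let ?l = "length vs - 1"
    have inj: "vs ! i = vs ! j \<longleftrightarrow> i = j" if "i \<le> ?l" "j \<le> ?l" for i j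
      using that dist len by (simp add: nth_eq_iff_index_eq)
    have e: "{vs ! 0, vs ! ?l} \<in> H"
    proof -
      have "Suc ?l = length vs" using len by linarith
      then have "Suc ?l mod length vs = 0" by simp
      moreover have "?l < length vs" using len by linarith
      ultimately show ?thesis using edges[of ?l] by (simp only: insert_commute)
    qed
    have path: "(vs ! 0, vs ! k) \<in> (adj (H - {{vs ! 0, vs ! ?l}}))\<^sup>*" if "k \<le> ?l" for k
      using that
    proof (induction k)
      case (Suc k)
      have "{vs ! k, vs ! Suc k} \<in> H"
        using edges[of k] Suc.prems len by simp
      moreover have "{vs ! k, vs ! Suc k} \<noteq> {vs ! 0, vs ! ?l}"
      proof -
        \<comment> \<open>This fails only for k = 0 and \<open>Suc k = ?l\<close>, that is, in a
          cycle with two vertices.\<close>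
        have "vs ! k \<noteq> vs ! 0 \<or> vs ! Suc k \<noteq> vs ! ?l"
        proof (rule ccontr)
          assume neg: "\<not> ?thesis"
          then have "k = 0" using Suc.prems inj[of k 0] by simp
          moreover have "Suc k = ?l" using neg Suc.prems inj[of "Suc k" ?l] by blast
          ultimately show False using len by linarith
        qed
        moreover have "vs ! k \<noteq> vs ! ?l"
          using Suc.prems inj[of k ?l] by fastforce
        ultimately show ?thesis by (simp only: doubleton_eq_iff) blast
      qed
      ultimately have "(vs ! k, vs ! Suc k) \<in> adj (H - {{vs ! 0, vs ! ?l}})"
        by simp
      with Suc show ?case by (meson Suc_leD rtrancl.rtrancl_into_rtrancl)
    qed simp
    have "vs ! 0 \<noteq> vs ! ?l" using inj[of 0 ?l] len by simp
    then show False
      using forest e path[of ?l] unfolding forest_def by blast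
  qed
qed

text \<open>If no edge crossed the cut, a path starting in I could never leave it.\<close>

lemma cut_meets_connected:
  assumes "simple_graph n H" "connected_graph n H" "I \<subseteq> {0..n}" "I \<noteq> {}" "I \<noteq> {0..n}"
  shows "\<exists>e\<in>H. card (e \<inter> I) = 1"
proof (rule ccontr)
  assume no: "\<not> ?thesis"
  obtain u w where u: "u \<in> I" and w: "w \<in> {0..n}" "w \<notin> I" using assms by blast
  have "(u, w) \<in> (adj H)\<^sup>*"
    using assms(2) w u assms(3) by (auto simp: connected_graph_iff)
  then have "w \<in> I"
  proof (induction rule: rtrancl_induct)
    case (step a b)
    then have "{a, b} \<in> H" by simp
    moreover have "a \<noteq> b"
      using simple_graph_edgeE[OF assms(1) \<open>{a, b} \<in> H\<close>] by (metis doubleton_eq_iff less_irrefl)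
    ultimately show ?case using no card_pair_Int[of a b I] step.IH by blast
  qed (rule u)
  with w show False by blast
qed

text \<open>Excluding the vertex 0 selects one side of each cut, as in the relations of
  \<B>.\<close>

definition closed_cut :: "nat \<Rightarrow> nat set set \<Rightarrow> nat set \<Rightarrow> bool" where
  "closed_cut n F I \<longleftrightarrow> I \<noteq> {} \<and> I \<subseteq> {1..n} \<and> (\<forall>f\<in>F. card (f \<inter> I) \<noteq> 1)"

text \<open>The components of u and v in F are different, so at least one of them avoids 0; that
  component is the cut.\<close>

lemma closed_cut_exists:
  assumes F: "simple_graph n F" and uv: "(u, v) \<notin> (adj F)\<^sup>*" "u \<le> n" "v \<le> n"
  shows "\<exists>I. closed_cut n F I \<and> (u \<in> I) \<noteq> (v \<in> I)"
proof -
  have comp: "closed_cut n F I \<and> w \<in> I"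
    if "I = {x. (w, x) \<in> (adj F)\<^sup>*}" "w \<le> n" "0 \<notin> I" for w I
  proof -
    have "x \<le> n" if "(w, x) \<in> (adj F)\<^sup>*" for x
      using that
    proof (induction rule: rtrancl_induct)
      case (step y z)
      then have "{y, z} \<in> F" by simp
      from simple_graph_edgeE[OF F this] show ?case
        by (metis doubleton_eq_iff order_less_imp_le order_trans)
    qed (rule \<open>w \<le> n\<close>)
    then have "I \<subseteq> {1..n}" using that by (auto simp: Suc_le_eq intro!: gr0I)
    moreover have "card (f \<inter> I) \<noteq> 1" if "f \<in> F" for f
    proof -
      obtain a b where f: "f = {a, b}" "a \<noteq> b" using simple_graph_edgeE[OF F \<open>f \<in> F\<close>] by (metis less_irrefl)
      then have "(a, b) \<in> adj F" "(b, a) \<in> adj F" using \<open>f \<in> F\<close> by (auto simp: insert_commute)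
      then have "a \<in> I \<longleftrightarrow> b \<in> I"
        unfolding \<open>I = _\<close> by (auto intro: rtrancl.rtrancl_into_rtrancl)
      then show ?thesis using card_pair_Int[OF f(2), of I] f(1) by simp
    qed
    ultimately show ?thesis using that by (auto simp: closed_cut_def)
  qed
  show ?thesis
  proof (cases "(u, 0) \<in> (adj F)\<^sup>*")
    case True
    then have "(v, 0) \<notin> (adj F)\<^sup>*" "(v, u) \<notin> (adj F)\<^sup>*"
      using uv(1) adj_rtrancl_sym[of v 0 F] adj_rtrancl_sym[of v u F]
        rtrancl_trans[of u 0 "adj F" v] by blast+
    then show ?thesis using comp[OF refl, of v] uv by blast
  next
    case False
    then show ?thesis using comp[OF refl, of u] uv by blast
  qed
qed

text \<open>For F a forest disjoint from A, these are the spanning trees of the graph with F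
  contracted, each given by its edges in A.\<close>

definition completions :: "nat \<Rightarrow> nat set set \<Rightarrow> nat set set \<Rightarrow> nat set set set" where
  "completions n A F = {T. T \<subseteq> A \<and> connected_graph n (T \<union> F) \<and> forest (T \<union> F)}"

lemma completions_empty:
  "forest F \<Longrightarrow> completions n {} F = (if connected_graph n F then {{}} else {})"
  by (auto simp: completions_def)

text \<open>The deletion-contraction recursion for spanning trees: a tree either avoids e or
  contains it.\<close>

lemma completions_insert:
  assumes "e \<notin> A"
  shows "completions n (insert e A) F = completions n A F \<union> insert e ` completions n A (insert e F)"
proof -
  have "T \<in> completions n A F \<union> insert e ` completions n A (insert e F)"
    if "T \<in> completions n (insert e A) F" for T
  proof (cases "e \<in> T")
    case True
    then have "T = insert e (T - {e})" "(T - {e}) \<union> insert e F = T \<union> F" by auto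
    then have "T - {e} \<in> completions n A (insert e F)"
      using that by (auto simp: completions_def)
    with \<open>T = insert e (T - {e})\<close> show ?thesis by blast
  qed (use that in \<open>auto simp: completions_def\<close>)
  moreover have "insert e T \<in> completions n (insert e A) F" if "T \<in> completions n A (insert e F)" for T
    using that by (auto simp: completions_def)
  ultimately show ?thesis by (auto simp: completions_def)
qed

text \<open>The edge becomes a loop when F is contracted, so adding it to F closes a cycle.\<close>

lemma completions_loop:
  assumes "(u, v) \<in> (adj F)\<^sup>*" "u \<noteq> v" "{u, v} \<notin> A" "{u, v} \<notin> F"
  shows "completions n A (insert {u, v} F) = {}"
proof -
  have "\<not> forest (T \<union> insert {u, v} F)" if "T \<subseteq> A" for T
  proof
    assume "forest (T \<union> insert {u, v} F)"
    moreover have "(u, v) \<in> (adj (T \<union> F))\<^sup>*" using assms(1) adj_rtrancl_mono[of F "T \<union> F"] by blast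
    ultimately show False
      using forest_insertD[of u v "T \<union> F"] assms that by auto
  qed
  then show ?thesis by (auto simp: completions_def)
qed

lemma completions_subset: "T \<in> completions n A F \<Longrightarrow> T \<subseteq> A"
  by (simp add: completions_def)

lemma finite_completions: "finite A \<Longrightarrow> finite (completions n A F)"
  by (rule finite_subset[of _ "Pow A"]) (auto simp: completions_def)

lemma spanning_trees_eq_completions:
  "simple_graph n E \<Longrightarrow> spanning_trees n E = completions n E {}"
  unfolding spanning_trees_def completions_def Un_empty_right
  by (rule Collect_cong) (metis acyclic_iff_forest simple_graph_mono)


section \<open>Integration along an edge\<close>

text \<open>Integration by parts: a suitable multiple of \<open>u ^ Suc m * s\<close> has derivative
  \<open>s * u ^ m\<close> up to a term in which s is replaced by \<open>D s\<close> and the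
  exponent grows by one. That term is integrated recursively, until the iterated derivative of s
  vanishes. The set \<open>S\<close> will be the ring of flat polynomials, in which the
  antiderivative has to stay.\<close>

lemma (in derivation) integrate_power:
  fixes u :: "('v, 'k) mpoly" and S :: "('v, 'k) mpoly set"
  assumes char: "CHAR('k) = 0"
    and S: "\<And>p q. p \<in> S \<Longrightarrow> q \<in> S \<Longrightarrow> p - q \<in> S" "\<And>p q. p \<in> S \<Longrightarrow> q \<in> S \<Longrightarrow> p * q \<in> S"
      "\<And>p. p \<in> S \<Longrightarrow> D p \<in> S" "\<And>a. Const a \<in> S"
    and u: "u \<in> S" "D u = Const c" "c \<noteq> 0"
    and s: "s \<in> S" "(D ^^ k) s = 0"
  shows "\<exists>r\<in>S. D (u ^ Suc m * r) = s * u ^ m"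
  using s
proof (induction k arbitrary: s m)
  case 0
  then show ?case using S(4)[of 0] by (intro bexI[of _ 0]) simp_all
next
  case (Suc k)
  then obtain r where r: "r \<in> S" "D (u ^ Suc (Suc m) * r) = D s * u ^ Suc m"
    using Suc.IH[of "D s" "Suc m"] S(3) by (auto simp: funpow_swap1)
  \<comment> \<open>Differentiating \<open>u ^ Suc m\<close> brings out the factor (m + 1) c, which
    \<open>a\<close> inverts; subtracting \<open>u * r\<close> below cancels the term with
    \<open>D s\<close>.\<close>
  define a where "a = 1 / (of_nat (Suc m) * c)"
  have "(of_nat (Suc m) :: 'k) \<noteq> 0"
    using char by (simp only: of_nat_eq_0_iff_char_dvd) simp
  then have "of_nat (Suc m) * c * a = 1"
    using u(3) unfolding a_def by simp
  then have a: "Const (of_nat (Suc m)) * Const c * Const a = (1 :: ('v, 'k) mpoly)"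
    by (simp flip: Const_simps del: of_nat_Suc)
  have "D (u ^ Suc m * (Const a * (s - u * r))) = Const a * (D (u ^ Suc m * s) - D (u ^ Suc (Suc m) * r))"
  proof -
    have "u ^ Suc m * (Const a * (s - u * r)) = Const a * (u ^ Suc m * s - u ^ Suc (Suc m) * r)"
      by (simp add: algebra_simps)
    then show ?thesis by (simp only: Const_mult diff)
  qed
  also have "\<dots> = Const a * D (u ^ Suc m) * s"
    unfolding r(2) mult[of "u ^ Suc m" s] by (simp add: algebra_simps)
  also have "\<dots> = Const (of_nat (Suc m)) * Const c * Const a * (s * u ^ m)"
    by (simp only: power u(2) Const_of_nat) (simp add: algebra_simps)
  finally have "D (u ^ Suc m * (Const a * (s - u * r))) = s * u ^ m"
    by (simp only: a mult_1_left)
  moreover have "Const a * (s - u * r) \<in> S"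
    by (intro S u r Suc.prems)
  ultimately show ?case by blast
qed

section \<open>Signs, derivatives and linear forms of cuts\<close>

lemma edge_sign_pair:
  assumes "u < v"
  shows "(edge_sign i {u, v} :: 'k::field) = (if i = u then 1 else 0) - (if i = v then 1 else 0)"
  using assms by (auto simp: edge_sign_def doubleton_eq_iff)

text \<open>Nonzero exactly on the edges that cross the cut. It occurs twice: as the derivative of
  \<open>cut_form I\<close> along e, and as the coefficient of \<open>Var e\<close> in the sum of
  the \<open>X i\<close> over I.\<close>

definition cut_sign :: "nat set \<Rightarrow> nat set \<Rightarrow> 'k::field" where
  "cut_sign I e = (\<Sum>i\<in>I. edge_sign i e)"

lemma cut_sign_pair:
  assumes "u < v" "finite I"
  shows "(cut_sign I {u, v} :: 'k::field) = (if u \<in> I then 1 else 0) - (if v \<in> I then 1 else 0)"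
  using assms by (simp add: cut_sign_def edge_sign_pair sum_subtractf)

lemma cut_sign_eq_0_iff:
  assumes "u < v" "finite I"
  shows "(cut_sign I {u, v} :: 'k::field) = 0 \<longleftrightarrow> card ({u, v} \<inter> I) \<noteq> 1"
  using assms card_pair_Int[of u v I] by (auto simp: cut_sign_pair)

definition edge_derivative :: "nat \<Rightarrow> nat set \<Rightarrow> (nat, 'k::field) mpoly \<Rightarrow> (nat, 'k) mpoly" where
  "edge_derivative n e = dir_derivative {1..n} (\<lambda>i. edge_sign i e)"

lemma derivation_edge_derivative: "derivation (edge_derivative n e)"
  unfolding edge_derivative_def by (rule derivation_dir_derivative)

lemma edge_derivative_Var:
  "edge_derivative n e (Var i) = (if i \<in> {1..n} then Const (edge_sign i e) else 0)"
  by (simp add: edge_derivative_def dir_derivative_Var)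

lemma edge_derivative_Var_const: "\<exists>c. edge_derivative n e (Var i) = Const c"
  using Const_simps(1) unfolding edge_derivative_Var by metis

lemma edge_derivative_commute:
  "edge_derivative n e (edge_derivative n f p) = edge_derivative n f (edge_derivative n e p)"
  by (intro derivations_commute derivation_edge_derivative edge_derivative_Var_const)

lemma edge_derivative_in_polys: "p \<in> polys {1..n} \<Longrightarrow> edge_derivative n e p \<in> polys {1..n}"
  by (rule derivation.in_polysI[OF derivation_edge_derivative]) (simp_all add: edge_derivative_Var)

lemma edge_derivative_pair:
  assumes "u < v" "v \<le> n"
  shows "edge_derivative n {u, v} p =
    (if u = 0 then 0 else pderivative u p) - pderivative v p"
proof -
  have "edge_derivative n {u, v} p = (\<Sum>i\<in>{1..n}. (if i = u then pderivative i p else 0)) -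
      (\<Sum>i\<in>{1..n}. (if i = v then pderivative i p else 0))"
    unfolding edge_derivative_def dir_derivative_def sum_subtractf[symmetric] using assms
    by (intro sum.cong refl) (auto simp: edge_sign_pair)
  then show ?thesis using assms by simp
qed

definition cut_form :: "nat set \<Rightarrow> (nat, 'k::field) mpoly" where
  "cut_form I = (\<Sum>i\<in>I. Var i)"

lemma cut_form_in_polys: "I \<subseteq> V \<Longrightarrow> cut_form I \<in> polys V"
  unfolding cut_form_def by (intro polys_closed) auto

lemma constant_term_cut_form [simp]: "constant_term (cut_form I) = 0"
  by (simp add: cut_form_def constant_term_sum)

lemma edge_derivative_cut_form:
  assumes I: "I \<subseteq> {1..n}"
  shows "edge_derivative n e (cut_form I) = (Const (cut_sign I e) :: (nat, 'k::field) mpoly)"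
proof -
  interpret derivation "edge_derivative n e" by (rule derivation_edge_derivative)
  have "(\<Sum>i\<in>I. Const (edge_sign i e)) = (Const (\<Sum>i\<in>I. edge_sign i e) :: (nat, 'k) mpoly)"
    by (induction I rule: infinite_finite_induct) simp_all
  moreover have "edge_derivative n e (cut_form I) = (\<Sum>i\<in>I. Const (edge_sign i e) :: (nat, 'k) mpoly)"
    using I unfolding cut_form_def sum by (intro sum.cong) (auto simp: edge_derivative_Var)
  ultimately show ?thesis by (simp add: cut_sign_def)
qed

lemma boundary_card_insert:
  assumes "finite A" "e \<notin> A"
  shows "boundary_card (insert e A) I =
    (if card (e \<inter> I) = 1 then Suc (boundary_card A I) else boundary_card A I)"
proof -
  have "{f \<in> insert e A. card (f \<inter> I) = 1} =
      (if card (e \<inter> I) = 1 then insert e {f \<in> A. card (f \<inter> I) = 1} else {f \<in> A. card (f \<inter> I) = 1})"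
    by auto
  then show ?thesis using assms by (simp add: boundary_card_def)
qed


section \<open>Deletion and contraction\<close>

text \<open>
  In the induction \<open>A\<close> is the set of edges not yet treated and \<open>F\<close> a set of contracted edges.  The
  polynomial ring of the contracted graph is realised as the common kernel of the derivatives along
  the edges in \<open>F\<close>, and a cut of the contracted graph is a vertex set that no edge of \<open>F\<close> leaves.
\<close>

definition flat_polys :: "nat \<Rightarrow> nat set set \<Rightarrow> (nat, 'k::field) mpoly set" where
  "flat_polys n F = {p \<in> polys {1..n}. \<forall>f\<in>F. edge_derivative n f p = 0}"

text \<open>Finite sums of flat multiples of cut powers, built term by term so that one summand can
  be differentiated or integrated at a time. Counting only edges of A in the exponent is right
  because no edge of F crosses a closed cut.\<close>

inductive_set cut_ideal :: "nat \<Rightarrow> nat set set \<Rightarrow> nat set set \<Rightarrow> (nat, 'k::field) mpoly set"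
  for n A F where
  zero: "0 \<in> cut_ideal n A F"
| add: "p \<in> cut_ideal n A F \<Longrightarrow> s \<in> flat_polys n F \<Longrightarrow> closed_cut n F I \<Longrightarrow>
    p + s * cut_form I ^ boundary_card A I \<in> cut_ideal n A F"

text \<open>Lists stand for slim sets so that derivatives can be iterated by \<open>fold\<close>.
  All orderings are demanded, hence any edge may be taken first.\<close>

definition null_poly :: "nat \<Rightarrow> nat set set \<Rightarrow> nat set set \<Rightarrow> (nat, 'k::field) mpoly \<Rightarrow> bool" where
  "null_poly n A F p \<longleftrightarrow> (\<forall>es. distinct es \<longrightarrow> set es \<subseteq> A \<longrightarrow> connected_graph n (A \<union> F - set es) \<longrightarrow>
     constant_term (fold (edge_derivative n) es p) = 0)"

lemma flat_polys_closed:
  "p \<in> flat_polys n F \<Longrightarrow> q \<in> flat_polys n F \<Longrightarrow> p + q \<in> flat_polys n F"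
  "p \<in> flat_polys n F \<Longrightarrow> q \<in> flat_polys n F \<Longrightarrow> p - q \<in> flat_polys n F"
  "p \<in> flat_polys n F \<Longrightarrow> q \<in> flat_polys n F \<Longrightarrow> p * q \<in> flat_polys n F"
  "Const a \<in> flat_polys n F"
  "p \<in> flat_polys n F \<Longrightarrow> edge_derivative n e p \<in> flat_polys n F"
  by (auto simp: flat_polys_def polys_closed edge_derivative_in_polys edge_derivative_commute[of n _ e]
      derivation.add[OF derivation_edge_derivative] derivation.mult[OF derivation_edge_derivative]
      derivation.diff[OF derivation_edge_derivative] derivation.Const[OF derivation_edge_derivative]
      derivation.zero[OF derivation_edge_derivative] simp del: One_nat_def)

lemma flat_polys_0: "0 \<in> flat_polys n F"
  using flat_polys_closed(4)[of 0] by simp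

lemma flat_polys_power: "p \<in> flat_polys n F \<Longrightarrow> p ^ k \<in> flat_polys n F"
  using flat_polys_closed(4)[of 1] by (induction k) (auto intro: flat_polys_closed)

lemma flat_polys_sum: "(\<And>x. x \<in> S \<Longrightarrow> f x \<in> flat_polys n F) \<Longrightarrow> sum f S \<in> flat_polys n F"
  using flat_polys_0 by (induction S rule: infinite_finite_induct) (auto intro: flat_polys_closed)

lemma flat_polys_insert:
  "p \<in> flat_polys n (insert e F) \<longleftrightarrow> p \<in> flat_polys n F \<and> edge_derivative n e p = 0"
  by (auto simp: flat_polys_def)

lemma cut_form_flat:
  assumes "simple_graph n F" "closed_cut n F I"
  shows "(cut_form I :: (nat, 'k::field) mpoly) \<in> flat_polys n F"
proof -
  have "edge_derivative n f (cut_form I :: (nat, 'k) mpoly) = 0" if f: "f \<in> F" for f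
  proof -
    obtain u v where uv: "f = {u, v}" "u < v" using simple_graph_edgeE[OF assms(1) f] by metis
    have I: "I \<subseteq> {1..n}" "card (f \<inter> I) \<noteq> 1" using assms(2) f by (auto simp: closed_cut_def)
    have "cut_sign I f = (0::'k)"
      using cut_sign_eq_0_iff[OF uv(2), of I, where 'k = 'k] I finite_subset[OF I(1)] by (simp add: uv(1))
    then show ?thesis using I(1) by (simp add: edge_derivative_cut_form)
  qed
  moreover have "I \<subseteq> {1..n}" using assms(2) by (simp add: closed_cut_def)
  ultimately show ?thesis by (simp add: flat_polys_def cut_form_in_polys)
qed

lemma cut_ideal_term:
  "s \<in> flat_polys n F \<Longrightarrow> closed_cut n F I \<Longrightarrow> s * cut_form I ^ boundary_card A I \<in> cut_ideal n A F"
  using cut_ideal.add[OF cut_ideal.zero, of s n F I A] by simp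

lemma cut_ideal_add:
  assumes "p \<in> cut_ideal n A F" "q \<in> cut_ideal n A F"
  shows "p + q \<in> cut_ideal n A F"
  using assms(2)
proof (induction rule: cut_ideal.induct)
  case (add q s I)
  then show ?case
    using cut_ideal.add[of "p + q" n A F s I] by (simp add: add.assoc)
qed (simp add: assms)

lemma cut_ideal_flat:
  "p \<in> cut_ideal n A F \<Longrightarrow> simple_graph n F \<Longrightarrow> p \<in> flat_polys n F"
  by (induction rule: cut_ideal.induct)
    (simp_all add: flat_polys_0 flat_polys_closed flat_polys_power cut_form_flat)

lemma closed_cut_rtrancl:
  assumes F: "simple_graph n F" and I: "closed_cut n F I" and ab: "(a, b) \<in> (adj F)\<^sup>*"
  shows "a \<in> I \<longleftrightarrow> b \<in> I"
  using ab
proof (induction rule: rtrancl_induct)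
  case (step y z)
  then have yz: "{y, z} \<in> F" by simp
  have "y \<noteq> z" using simple_graph_edgeE[OF F yz] by (metis doubleton_eq_iff less_irrefl)
  with yz I step.IH show ?case
    unfolding closed_cut_def using card_pair_Int[of y z I] by blast
qed simp

text \<open>Used for both kinds of induction step: with \<open>F' = F\<close> if e is a loop of the
  contraction, and with \<open>F' = insert e F\<close> if e is contracted. In either case e crosses
  none of the cuts, so the exponents do not change.\<close>

lemma cut_ideal_insertI:
  assumes A: "finite A" "e \<notin> A" and F: "F \<subseteq> F'"
    and e: "\<And>I. closed_cut n F' I \<Longrightarrow> card (e \<inter> I) \<noteq> 1"
    and p: "p \<in> cut_ideal n A F'"
  shows "p \<in> cut_ideal n (insert e A) F"
  using p
proof (induction rule: cut_ideal.induct)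
  case (add p s I)
  have "closed_cut n F I" "s \<in> flat_polys n F"
    using add F by (auto simp: closed_cut_def flat_polys_def)
  moreover have "boundary_card (insert e A) I = boundary_card A I"
    using boundary_card_insert[OF A, of I] e[OF add.hyps(3)] by simp
  ultimately show ?case
    using cut_ideal.add[OF add.IH, of s I] by simp
qed (rule cut_ideal.zero)

text \<open>A set that is slim after deleting e becomes slim in the original graph when e is added
  to it.\<close>

lemma null_poly_derivative:
  assumes "null_poly n (insert e A) F p" "e \<notin> A" "e \<notin> F"
  shows "null_poly n A F (edge_derivative n e p)"
  unfolding null_poly_def
proof (intro allI impI)
  fix es assume es: "distinct es" "set es \<subseteq> A" "connected_graph n (A \<union> F - set es)"
  have "insert e A \<union> F - set (e # es) = A \<union> F - set es" using assms(2,3) by auto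
  then have "constant_term (fold (edge_derivative n) (e # es) p) = 0"
    using assms es unfolding null_poly_def
    by (intro assms(1)[unfolded null_poly_def, rule_format]) auto
  then show "constant_term (fold (edge_derivative n) es (edge_derivative n e p)) = 0" by simp
qed

text \<open>Contracting e leaves only the slim sets that avoid e.\<close>

lemma null_poly_contract:
  assumes "null_poly n (insert e A) F p"
  shows "null_poly n A (insert e F) p"
  using assms unfolding null_poly_def by (auto simp: subset_insertI2)

text \<open>With fewer edges there are fewer slim sets to test.\<close>

lemma null_poly_delete:
  assumes "null_poly n (insert e A) F p" "e \<notin> A"
  shows "null_poly n A F p"
  unfolding null_poly_def
proof (intro allI impI)
  fix es assume es: "distinct es" "set es \<subseteq> A" "connected_graph n (A \<union> F - set es)"
  then have "connected_graph n (insert e A \<union> F - set es)"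
    by (elim connected_graph_mono) auto
  then show "constant_term (fold (edge_derivative n) es p) = 0"
    using assms(1) es unfolding null_poly_def by blast
qed

lemma fold_edge_derivative_add:
  "fold (edge_derivative n) es (p + q) = fold (edge_derivative n) es p + fold (edge_derivative n) es q"
  by (induction es arbitrary: p q) (simp_all add: derivation.add[OF derivation_edge_derivative])

lemma fold_edge_derivative_diff:
  "fold (edge_derivative n) es (p - q) = fold (edge_derivative n) es p - fold (edge_derivative n) es q"
  by (induction es arbitrary: p q) (simp_all add: derivation.diff[OF derivation_edge_derivative])

lemma fold_edge_derivative_0 [simp]: "fold (edge_derivative n) es 0 = 0"
  by (induction es) (simp_all add: derivation.zero[OF derivation_edge_derivative])

lemma null_poly_diff: "null_poly n A F p \<Longrightarrow> null_poly n A F q \<Longrightarrow> null_poly n A F (p - q)"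
  by (simp add: null_poly_def fold_edge_derivative_diff)

lemma null_poly_0: "null_poly n A F 0"
  by (simp add: null_poly_def)

text \<open>A derivative lowers the exponent of the cut form by at most one, and only if its edge
  crosses the cut. With fewer than m such edges a positive power survives, and it vanishes at the
  origin.\<close>

lemma constant_term_fold_cut_form:
  fixes s :: "(nat, 'k::field) mpoly"
  assumes "distinct es" "card {e \<in> set es. card (e \<inter> I) = 1} < m" "I \<subseteq> {1..n}"
    and "\<forall>e\<in>set es. \<exists>u v. e = {u, v} \<and> u < v"
  shows "constant_term (fold (edge_derivative n) es (s * cut_form I ^ m)) = 0"
  using assms
proof (induction es arbitrary: s m)
  case (Cons e es)
  interpret derivation "edge_derivative n e" by (rule derivation_edge_derivative)
  let ?B = "{e \<in> set es. card (e \<inter> I) = 1}"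
  have I: "finite I" using Cons.prems(3) by (rule finite_subset) simp
  obtain u v where uv: "e = {u, v}" "u < v" using Cons.prems(4) by auto
  have D: "edge_derivative n e (s * cut_form I ^ m) = edge_derivative n e s * cut_form I ^ m +
      (of_nat m * Const (cut_sign I e) * s) * cut_form I ^ (m - 1)"
    by (simp add: mult power edge_derivative_cut_form[OF Cons.prems(3)] algebra_simps)
  have IH: "constant_term (fold (edge_derivative n) es (t * cut_form I ^ k)) = 0"
    if "card ?B < k" for t :: "(nat, 'k) mpoly" and k
    using Cons that by simp
  show ?case
  proof (cases "card (e \<inter> I) = 1")
    case True
    then have "{f \<in> set (e # es). card (f \<inter> I) = 1} = insert e ?B" by auto
    then have "Suc (card ?B) < m" using Cons.prems(1,2) by simp
    then show ?thesis by (simp add: D fold_edge_derivative_add IH)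
  next
    case False
    then have "{f \<in> set (e # es). card (f \<inter> I) = 1} = ?B" by auto
    moreover have "cut_sign I e = (0::'k)"
      using cut_sign_eq_0_iff[OF uv(2) I] False uv(1) by simp
    ultimately show ?thesis using Cons.prems(2) by (simp add: D IH)
  qed
qed simp

text \<open>A slim set leaves out at least one edge of every cut, so it has too few crossing edges
  to remove the cut power.\<close>

lemma cut_ideal_null:
  assumes AF: "simple_graph n (A \<union> F)" and p: "p \<in> cut_ideal n A F"
  shows "null_poly n A F p"
  using p
proof (induction rule: cut_ideal.induct)
  case (add p s I)
  have I: "I \<subseteq> {1..n}" "I \<noteq> {}" using add.hyps by (auto simp: closed_cut_def)
  then have "I \<noteq> {0..n}" "I \<subseteq> {0..n}" by (auto dest: subsetD)
  have "constant_term (fold (edge_derivative n) es (s * cut_form I ^ boundary_card A I)) = 0"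
    if es: "distinct es" "set es \<subseteq> A" "connected_graph n (A \<union> F - set es)" for es
  proof (rule constant_term_fold_cut_form)
    have "simple_graph n (A \<union> F - set es)" by (rule simple_graph_mono[OF AF]) auto
    from cut_meets_connected[OF this es(3) \<open>I \<subseteq> {0..n}\<close> I(2) \<open>I \<noteq> {0..n}\<close>]
    obtain f where "f \<in> A \<union> F - set es" "card (f \<inter> I) = 1" by blast
    \<comment> \<open>No edge of \<open>F\<close> crosses a closed cut, so the crossing edge that
      remains belongs to \<open>A\<close>.\<close>
    then have f: "f \<in> A - set es" "card (f \<inter> I) = 1"
      using add.hyps by (auto simp: closed_cut_def)
    have "finite A" using simple_graph_finite[OF AF] by simp
    moreover have "{e \<in> set es. card (e \<inter> I) = 1} \<subset> {e \<in> A. card (e \<inter> I) = 1}"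
      using f es(2) by auto
    ultimately show "card {e \<in> set es. card (e \<inter> I) = 1} < boundary_card A I"
      unfolding boundary_card_def by (intro psubset_card_mono) auto
    show "\<forall>e\<in>set es. \<exists>u v. e = {u, v} \<and> u < v"
      using es(2) simple_graph_edgeE[OF AF] by (metis UnCI subsetD)
  qed (use es I in auto)
  with add.IH show ?case
    by (simp add: null_poly_def fold_edge_derivative_add)
qed (rule null_poly_0)

lemma edge_derivative_integrable:
  fixes s :: "(nat, 'k::field_char_0) mpoly"
  assumes F: "simple_graph n F" and e: "e = {u, v}" "u < v"
    and I: "closed_cut n F I" "card (e \<inter> I) = 1" and s: "s \<in> flat_polys n F"
  shows "\<exists>r\<in>flat_polys n F. edge_derivative n e (cut_form I ^ Suc m * r) = s * cut_form I ^ m"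
proof -
  have I': "I \<subseteq> {1..n}" using I by (simp add: closed_cut_def)
  obtain k where k: "(edge_derivative n e ^^ k) s = 0"
    using derivation.locally_nilpotent[OF derivation_edge_derivative edge_derivative_Var_const] by blast
  show ?thesis
  proof (rule derivation.integrate_power[OF derivation_edge_derivative])
    show "edge_derivative n e (cut_form I) = Const (cut_sign I e)"
      by (rule edge_derivative_cut_form[OF I'])
    show "cut_sign I e \<noteq> (0::'k)"
      using cut_sign_eq_0_iff[OF e(2), of I] finite_subset[OF I'] I(2) e(1) by simp
  qed (use F I s k in \<open>simp_all add: flat_polys_closed cut_form_flat\<close>)
qed

text \<open>Each summand is integrated separately. If e crosses I, integrating the power of the cut
  form raises its exponent by one, exactly as inserting e raises the boundary count. Otherwise that
  power is constant along e with unchanged exponent, and its coefficient is integrated by means of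
  another cut K that separates the ends of e.\<close>

lemma cut_ideal_integrable:
  fixes q :: "(nat, 'k::field_char_0) mpoly"
  assumes F: "simple_graph n F" and A: "finite A" "e \<notin> A"
    and e: "e = {u, v}" "u < v" "v \<le> n" "(u, v) \<notin> (adj F)\<^sup>*"
    and q: "q \<in> cut_ideal n A F"
  shows "\<exists>j\<in>cut_ideal n (insert e A) F. edge_derivative n e j = q"
proof -
  interpret derivation "edge_derivative n e" by (rule derivation_edge_derivative)
  obtain K where K: "closed_cut n F K" "card (e \<inter> K) = 1"
    using closed_cut_exists[OF F e(4)] e card_pair_Int[of u v] by auto
  have summand: "\<exists>j\<in>cut_ideal n (insert e A) F. edge_derivative n e j = s * cut_form I ^ boundary_card A I"
    if s: "s \<in> flat_polys n F" and I: "closed_cut n F I" for s :: "(nat, 'k) mpoly" and I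
  proof (cases "card (e \<inter> I) = 1")
    case True
    obtain r where r: "r \<in> flat_polys n F"
      "edge_derivative n e (cut_form I ^ Suc (boundary_card A I) * r) = s * cut_form I ^ boundary_card A I"
      using edge_derivative_integrable[OF F e(1,2) I True s] by blast
    then show ?thesis
      using cut_ideal_term[OF r(1) I, of "insert e A"] True boundary_card_insert[OF A, of I]
      by (intro bexI[of _ "cut_form I ^ Suc (boundary_card A I) * r"]) (simp_all add: mult_ac)
  next
    case False
    have I': "I \<subseteq> {1..n}" "finite I" using I finite_subset by (auto simp: closed_cut_def)
    obtain r where r: "r \<in> flat_polys n F" "edge_derivative n e (cut_form K * r) = s"
      using edge_derivative_integrable[OF F e(1,2) K s, of 0] by auto
    have "edge_derivative n e (cut_form I :: (nat, 'k) mpoly) = 0"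
      using cut_sign_eq_0_iff[OF e(2) I'(2), where 'k = 'k] False e(1)
      by (simp add: edge_derivative_cut_form[OF I'(1)])
    then have "edge_derivative n e (cut_form K * r * cut_form I ^ boundary_card A I) =
        s * cut_form I ^ boundary_card A I"
      by (simp add: mult[of "cut_form K * r"] power r(2))
    moreover have "cut_form K * r * cut_form I ^ boundary_card (insert e A) I \<in> cut_ideal n (insert e A) F"
      by (rule cut_ideal_term[OF _ I]) (simp add: flat_polys_closed r(1) cut_form_flat[OF F K(1)])
    ultimately show ?thesis
      using False boundary_card_insert[OF A, of I] by auto
  qed
  show ?thesis
    using q
  proof (induction rule: cut_ideal.induct)
    case zero
    then show ?case using cut_ideal.zero by (intro bexI[of _ 0]) simp_all
  next
    case (add p s I)
    then obtain j j' where "j \<in> cut_ideal n (insert e A) F" "edge_derivative n e j = p"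
      "j' \<in> cut_ideal n (insert e A) F" "edge_derivative n e j' = s * cut_form I ^ boundary_card A I"
      using summand by blast
    then show ?case by (intro bexI[of _ "j + j'"]) (simp_all add: derivation.add[OF derivation_edge_derivative] cut_ideal_add)
  qed
qed

text \<open>Flatness along an edge equates the partial derivatives at its two ends, with value 0 at
  the vertex 0; connectedness spreads this value to all vertices.\<close>

lemma flat_polys_const:
  fixes p :: "(nat, 'k::field_char_0) mpoly"
  assumes F: "simple_graph n F" "connected_graph n F" and p: "p \<in> flat_polys n F"
  shows "p = Const (constant_term p)"
proof (rule polys_constI)
  show "p \<in> polys {1..n}" using p by (simp add: flat_polys_def)
  let ?d = "\<lambda>i. if i = 0 then 0 else pderivative i p"
  have edge: "?d a = ?d b" if ab: "{a, b} \<in> F" for a b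
  proof -
    obtain u v where uv: "{a, b} = {u, v}" "u < v" "v \<le> n"
      using simple_graph_edgeE[OF F(1) ab] by metis
    then have "?d u - ?d v = 0"
      using p ab edge_derivative_pair[OF uv(2,3), of p] by (simp add: flat_polys_def)
    then show ?thesis using uv(1) by (auto simp: doubleton_eq_iff)
  qed
  fix i assume i: "i \<in> {1..n}"
  then have "(0, i) \<in> (adj F)\<^sup>*" using F(2) by (simp add: connected_graph_iff)
  then have "?d i = ?d 0"
  proof (induction rule: rtrancl_induct)
    case (step y z)
    then show ?case using edge[of y z] by simp
  qed simp
  then show "pderivative i p = 0" using i by simp
qed

text \<open>Matching \<open>completions_insert\<close>, the new basis consists of the basis of the
  contraction and of antiderivatives of the basis of the deletion. Both claims share one induction
  because the proof of spanning corrects by elements of the cut ideal, which the membership claim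
  provides.\<close>

lemma null_poly_basis:
  assumes "finite A" "simple_graph n (A \<union> F)" "A \<inter> F = {}" "forest F"
  shows "(\<forall>p\<in>flat_polys n F. null_poly n A F p \<longrightarrow> (p :: (nat, 'k::field_char_0) mpoly) \<in> cut_ideal n A F) \<and>
    (\<exists>b. (\<forall>T\<in>completions n A F. (b T :: (nat, 'k) mpoly) \<in> flat_polys n F) \<and>
      (\<forall>p\<in>flat_polys n F. \<exists>c. null_poly n A F (p - (\<Sum>T\<in>completions n A F. Const (c T) * b T))) \<and>
      (\<forall>c. null_poly n A F (\<Sum>T\<in>completions n A F. Const (c T) * b T) \<longrightarrow>
        (\<forall>T\<in>completions n A F. c T = 0)))"
  using assms
proof (induction A arbitrary: F rule: finite_induct)
  case empty
  then have F: "simple_graph n F" "forest F" by simp_all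
  show ?case
  \<comment> \<open>If F is connected, flat polynomials are constants and 1 is the basis. If not,
    some closed cut has empty boundary, its zeroth power 1 puts everything into the ideal, and there
    are no completions.\<close>
  proof (cases "connected_graph n F")
    case True
    have const: "null_poly n {} F p \<longleftrightarrow> constant_term p = 0" for p :: "(nat, 'k) mpoly"
      using True by (simp add: null_poly_def)
    have "p \<in> cut_ideal n {} F" if "p \<in> flat_polys n F" "null_poly n {} F p" for p :: "(nat, 'k) mpoly"
      using flat_polys_const[OF F(1) True that(1)] that(2) cut_ideal.zero by (simp add: const)
    moreover have "completions n {} F = {{}}"
      using F(2) True by (simp add: completions_empty)
    ultimately show ?thesis
      using flat_polys_closed(4)[of 1 n F]
      by (intro conjI exI[of _ "\<lambda>_. 1"]) (auto simp: const intro: exI[of _ "\<lambda>_. constant_term _"])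
  next
    case False
    then obtain u v where "u \<le> n" "v \<le> n" "(u, v) \<notin> (adj F)\<^sup>*"
      by (auto simp: connected_graph_iff)
    from closed_cut_exists[OF F(1) this(3,1,2)] obtain I where "closed_cut n F I" by blast
    then have "p \<in> cut_ideal n {} F" if "p \<in> flat_polys n F" for p :: "(nat, 'k) mpoly"
      using cut_ideal_term[OF that, of I "{}"] by (simp add: boundary_card_def)
    moreover have "null_poly n {} F p" for p :: "(nat, 'k) mpoly"
      using False by (simp add: null_poly_def)
    ultimately show ?thesis
      using F(2) False by (simp add: completions_empty)
  qed
next
  case (insert e A)
  have F: "simple_graph n F" and AF: "simple_graph n (A \<union> F)"
    by (rule simple_graph_mono[OF insert.prems(1)]; auto)+
  have e: "e \<notin> A" "e \<notin> F" using insert by auto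
  obtain u v where uv: "e = {u, v}" "u < v" "v \<le> n"
    using simple_graph_edgeE[OF insert.prems(1), of e] by auto
  interpret derivation "edge_derivative n e :: (nat, 'k) mpoly \<Rightarrow> _" by (rule derivation_edge_derivative)
  have IH1: "null_poly n A F p \<Longrightarrow> p \<in> cut_ideal n A F"
    if "p \<in> flat_polys n F" for p :: "(nat, 'k) mpoly"
    using insert.IH[OF AF] insert.prems that by simp
  have disj: "A \<inter> F = {}" using insert.prems by auto
  obtain b1 :: "nat set set \<Rightarrow> (nat, 'k) mpoly" where
    "\<forall>T\<in>completions n A F. b1 T \<in> flat_polys n F"
    "\<forall>p\<in>flat_polys n F. \<exists>c. null_poly n A F (p - (\<Sum>T\<in>completions n A F. Const (c T) * b1 T))"
    "\<forall>c. null_poly n A F (\<Sum>T\<in>completions n A F. Const (c T) * b1 T) \<longrightarrow>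
      (\<forall>T\<in>completions n A F. c T = 0)"
    using conjunct2[OF insert.IH[OF AF disj insert.prems(3)]]
    by (elim exE conjE) (rule that, assumption+)
  note b1 = this(1)[rule_format] and span1 = this(2)[rule_format] and indep1 = this(3)[THEN spec, THEN mp]
  have null: "null_poly n (insert e A) F p" if "p \<in> cut_ideal n (insert e A) F" for p :: "(nat, 'k) mpoly"
    by (rule cut_ideal_null[OF insert.prems(1) that])
  show ?case
  proof (cases "(u, v) \<in> (adj F)\<^sup>*")
    \<comment> \<open>Here e is a loop of the contraction: no closed cut crosses it and no
      completion contains it, so the ideal and the basis for A serve again.\<close>
    case True
    have "card (e \<inter> I) \<noteq> 1" if "closed_cut n F I" for I
      using closed_cut_rtrancl[OF F that True] card_pair_Int[of u v I] uv by auto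
    then have J: "p \<in> cut_ideal n (insert e A) F" if "p \<in> cut_ideal n A F" for p :: "(nat, 'k) mpoly"
      by (rule cut_ideal_insertI[OF insert.hyps order_refl _ that])
    have "completions n A (insert e F) = {}"
      using completions_loop[OF True, of A n] uv e by auto
    then have comp: "completions n (insert e A) F = completions n A F"
      by (simp add: completions_insert[OF e(1)])
    have del: "null_poly n (insert e A) F p \<Longrightarrow> null_poly n A F p" for p :: "(nat, 'k) mpoly"
      by (rule null_poly_delete[OF _ e(1)])
    have "\<exists>c. null_poly n (insert e A) F (p - (\<Sum>T\<in>completions n A F. Const (c T) * b1 T))"
      if p: "p \<in> flat_polys n F" for p
    proof -
      obtain c where "null_poly n A F (p - (\<Sum>T\<in>completions n A F. Const (c T) * b1 T))"
        using span1[OF p] by blast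
      moreover have "p - (\<Sum>T\<in>completions n A F. Const (c T) * b1 T) \<in> flat_polys n F"
        using p b1 by (simp add: flat_polys_closed flat_polys_sum)
      ultimately show ?thesis using IH1 J null by blast
    qed
    then show ?thesis
      unfolding comp using b1 indep1 IH1 J del by (intro conjI exI[of _ b1]) blast+
  next
    case False
    have IH2: "null_poly n A (insert e F) p \<Longrightarrow> p \<in> cut_ideal n A (insert e F)"
      if "p \<in> flat_polys n (insert e F)" for p :: "(nat, 'k) mpoly"
      using insert.IH[of "insert e F"] insert.prems e that forest_insertI[OF insert.prems(3) False] uv(1)
      by auto
    have AeF: "simple_graph n (A \<union> insert e F)" "A \<inter> insert e F = {}" "forest (insert e F)"
      using insert.prems e forest_insertI[OF insert.prems(3) False] uv(1) by auto
    obtain b2 :: "nat set set \<Rightarrow> (nat, 'k) mpoly" where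
      "\<forall>T\<in>completions n A (insert e F). b2 T \<in> flat_polys n (insert e F)"
      "\<forall>p\<in>flat_polys n (insert e F). \<exists>c.
        null_poly n A (insert e F) (p - (\<Sum>T\<in>completions n A (insert e F). Const (c T) * b2 T))"
      "\<forall>c. null_poly n A (insert e F) (\<Sum>T\<in>completions n A (insert e F). Const (c T) * b2 T) \<longrightarrow>
        (\<forall>T\<in>completions n A (insert e F). c T = 0)"
      using conjunct2[OF insert.IH[OF AeF]]
      by (elim exE conjE) (rule that, assumption+)
    note b2 = this(1)[rule_format] and span2 = this(2)[rule_format] and indep2 = this(3)[THEN spec, THEN mp]
    have J: "p \<in> cut_ideal n (insert e A) F" if "p \<in> cut_ideal n A (insert e F)" for p :: "(nat, 'k) mpoly"
      by (rule cut_ideal_insertI[OF insert.hyps subset_insertI _ that]) (simp add: closed_cut_def)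
    have integrable: "\<exists>j\<in>cut_ideal n (insert e A) F. edge_derivative n e j = q"
      if "q \<in> cut_ideal n A F" for q :: "(nat, 'k) mpoly"
      by (rule cut_ideal_integrable[OF F insert.hyps uv False that])
    \<comment> \<open>The form of a cut that separates the ends of e is flat and not constant along
      e, which gives each \<open>b1 T\<close> a flat antiderivative.\<close>
    have "\<exists>r\<in>flat_polys n F. edge_derivative n e r = b1 T" if T: "T \<in> completions n A F" for T
    proof -
      obtain K where K: "closed_cut n F K" "card (e \<inter> K) = 1"
        using closed_cut_exists[OF F False] uv card_pair_Int[of u v] by auto
      obtain r where "r \<in> flat_polys n F" "edge_derivative n e (cut_form K ^ Suc 0 * r) = b1 T * cut_form K ^ 0"
        using edge_derivative_integrable[OF F uv(1,2) K b1[OF T]] by blast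
      then show ?thesis
        using K by (intro bexI[of _ "cut_form K * r"]) (simp_all add: flat_polys_closed cut_form_flat[OF F])
    qed
    then obtain B where B: "\<And>T. T \<in> completions n A F \<Longrightarrow> B T \<in> flat_polys n F"
      "\<And>T. T \<in> completions n A F \<Longrightarrow> edge_derivative n e (B T) = b1 T"
      by metis
    define b where "b T = (if e \<in> T then b2 (T - {e}) else B T)" for T
    have notin: "e \<notin> T" if "T \<in> completions n A F \<or> T \<in> completions n A (insert e F)" for T
      using that completions_subset e by blast
    have split: "(\<Sum>T\<in>completions n (insert e A) F. Const (c T) * b T) =
        (\<Sum>T\<in>completions n A F. Const (c T) * B T) +
        (\<Sum>T\<in>completions n A (insert e F). Const (c (insert e T)) * b2 T)" for c
    proof -
      have "(\<Sum>T\<in>completions n (insert e A) F. Const (c T) * b T) =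
        (\<Sum>T\<in>completions n A F. Const (c T) * b T) +
        (\<Sum>T\<in>insert e ` completions n A (insert e F). Const (c T) * b T)"
        unfolding completions_insert[OF e(1)] using notin
        by (intro sum.union_disjoint) (auto simp: finite_completions insert.hyps)
      also have "(\<Sum>T\<in>completions n A F. Const (c T) * b T) = (\<Sum>T\<in>completions n A F. Const (c T) * B T)"
        using notin by (intro sum.cong) (auto simp: b_def)
      also have "(\<Sum>T\<in>insert e ` completions n A (insert e F). Const (c T) * b T) =
          (\<Sum>T\<in>completions n A (insert e F). Const (c (insert e T)) * b (insert e T))"
        using notin by (intro sum.reindex_cong[of "insert e"]) (auto simp: inj_on_def insert_ident)
      also have "\<dots> = (\<Sum>T\<in>completions n A (insert e F). Const (c (insert e T)) * b2 T)"
        using notin by (intro sum.cong) (auto simp: b_def)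
      finally show ?thesis .
    qed
    show ?thesis
    proof (intro conjI ballI impI exI[of _ b] allI)
      fix p :: "(nat, 'k) mpoly" assume p: "p \<in> flat_polys n F" "null_poly n (insert e A) F p"
      \<comment> \<open>Since j lies in the ideal and has the same derivative as p, the difference
        is killed along e and belongs to the contraction.\<close>
      obtain j where j: "j \<in> cut_ideal n (insert e A) F" "edge_derivative n e j = edge_derivative n e p"
        using integrable IH1 null_poly_derivative[OF p(2) e] p(1) flat_polys_closed(5) by blast
      have "p - j \<in> flat_polys n (insert e F)"
        using p(1) j cut_ideal_flat[OF j(1) F] by (simp add: flat_polys_insert flat_polys_closed diff)
      moreover have "null_poly n A (insert e F) (p - j)"
        by (rule null_poly_contract[OF null_poly_diff[OF p(2) null[OF j(1)]]])
      ultimately have "p - j \<in> cut_ideal n (insert e A) F" using IH2 J by blast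
      from cut_ideal_add[OF this j(1)] show "p \<in> cut_ideal n (insert e A) F" by simp
    next
      fix T assume "T \<in> completions n (insert e A) F"
      then show "b T \<in> flat_polys n F"
        using B b2 notin by (auto simp: completions_insert[OF e(1)] b_def flat_polys_insert)
    next
      fix p :: "(nat, 'k) mpoly" assume p: "p \<in> flat_polys n F"
      let ?S1 = "\<lambda>c g. \<Sum>T\<in>completions n A F. Const (c T) * g T"
      let ?S2 = "\<lambda>c. \<Sum>T\<in>completions n A (insert e F). Const (c T) * b2 T"
      \<comment> \<open>The derivative of p is expanded in the basis of the deletion up to an error
        in the ideal. Lifting both expansion and error leaves a remainder that is flat along e, to
        be expanded in the basis of the contraction.\<close>
      obtain c1 where c1: "null_poly n A F (edge_derivative n e p - ?S1 c1 b1)"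
        using span1 flat_polys_closed(5)[OF p] by blast
      have "edge_derivative n e p - ?S1 c1 b1 \<in> flat_polys n F"
        using p b1 by (simp add: flat_polys_closed flat_polys_sum)
      then obtain j where j: "j \<in> cut_ideal n (insert e A) F"
        "edge_derivative n e j = edge_derivative n e p - ?S1 c1 b1"
        using integrable IH1 c1 by blast
      have "edge_derivative n e (?S1 c1 B) = ?S1 c1 b1"
        using B by (auto simp: sum Const_mult intro!: sum.cong)
      then have "edge_derivative n e (p - ?S1 c1 B - j) = 0"
        using j(2) by (simp add: diff)
      then have q: "p - ?S1 c1 B - j \<in> flat_polys n (insert e F)"
        using p B cut_ideal_flat[OF j(1) F] by (simp add: flat_polys_insert flat_polys_closed flat_polys_sum)
      then obtain c2 where "null_poly n A (insert e F) (p - ?S1 c1 B - j - ?S2 c2)"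
        using span2 by blast
      moreover have "p - ?S1 c1 B - j - ?S2 c2 \<in> flat_polys n (insert e F)"
        using q b2 by (simp add: flat_polys_closed flat_polys_sum)
      ultimately have "p - ?S1 c1 B - j - ?S2 c2 \<in> cut_ideal n (insert e A) F"
        using IH2 J by blast
      from null[OF cut_ideal_add[OF this j(1)]]
      have "null_poly n (insert e A) F (p - (?S1 c1 B + ?S2 c2))"
        by (simp add: algebra_simps)
      moreover define c where "c T = (if e \<in> T then c2 (T - {e}) else c1 T)" for T
      have "?S1 c1 B = ?S1 c B" "?S2 c2 = ?S2 (\<lambda>T. c (insert e T))"
        using notin by (auto intro!: sum.cong simp: c_def)
      ultimately have "null_poly n (insert e A) F (p - (\<Sum>T\<in>completions n (insert e A) F. Const (c T) * b T))"
        unfolding split by simp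
      then show "\<exists>c. null_poly n (insert e A) F (p - (\<Sum>T\<in>completions n (insert e A) F. Const (c T) * b T))"
        by (rule exI[where x = c])
    next
      fix c T assume null_c: "null_poly n (insert e A) F (\<Sum>T\<in>completions n (insert e A) F. Const (c T) * b T)"
        and T: "T \<in> completions n (insert e A) F"
      let ?S2 = "\<Sum>T\<in>completions n A (insert e F). Const (c (insert e T)) * b2 T"
      \<comment> \<open>Differentiation kills the part from the contraction and turns
        \<open>B\<close> into \<open>b1\<close>, so the coefficients of the deletion vanish
        first.\<close>
      have "edge_derivative n e (\<Sum>T\<in>completions n (insert e A) F. Const (c T) * b T) =
          (\<Sum>T\<in>completions n A F. Const (c T) * b1 T)"
        unfolding split using B b2
        by (simp add: derivation.add[OF derivation_edge_derivative] sum Const_mult flat_polys_insert)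
      then have c1: "\<forall>T\<in>completions n A F. c T = 0"
        using indep1 null_poly_derivative[OF null_c e] by simp
      then have "(\<Sum>T\<in>completions n (insert e A) F. Const (c T) * b T) = ?S2"
        unfolding split by simp
      then have "null_poly n A (insert e F) ?S2"
        using null_poly_contract[OF null_c] by simp
      from indep2[OF this] have "\<forall>T\<in>completions n A (insert e F). c (insert e T) = 0" .
      with c1 T show "c T = 0"
        by (auto simp: completions_insert[OF e(1)])
    qed
  qed
qed


section \<open>Ideals and quotients of polynomial algebras\<close>

lemma cring_poly_algebra: "cring (poly_algebra V :: ('k::field, ('v, 'k) mpoly) module)"
  by (rule algebra.axioms(2)[OF algebra_poly_algebra])

lemma poly_idealI:
  fixes I :: "('v, 'k::field) mpoly set"
  assumes "I \<subseteq> polys V" "0 \<in> I" "\<And>p q. p \<in> I \<Longrightarrow> q \<in> I \<Longrightarrow> p + q \<in> I"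
    and mult: "\<And>p q. p \<in> polys V \<Longrightarrow> q \<in> I \<Longrightarrow> p * q \<in> I"
  shows "ideal I (poly_algebra V)"
proof -
  interpret cring "poly_algebra V :: ('k, ('v, 'k) mpoly) module" by (rule cring_poly_algebra)
  have "\<ominus>\<^bsub>poly_algebra V\<^esub> x = - x" if "x \<in> I" for x
    using that assms(1) uminus_in_polys by (intro minus_equality) auto
  moreover have "- x \<in> I" if "x \<in> I" for x
    using mult[OF Const_in_polys that, of "- 1"] by simp
  moreover have "p * q \<in> I" if "p \<in> I" "q \<in> polys V" for p q
    using mult[OF that(2,1)] by (simp add: mult.commute)
  ultimately show ?thesis
    using assms by (intro idealI ring_axioms add.subgroupI) (auto simp: a_inv_def[symmetric])
qed

locale poly_ideal =
  fixes V :: "'v set" and I :: "('v, 'k::field) mpoly set"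
  assumes ideal: "ideal I (poly_algebra V)"
begin

lemma carr: "p \<in> I \<Longrightarrow> p \<in> polys V"
  using ideal.Icarr[OF ideal] by simp

lemma zero: "0 \<in> I"
  using additive_subgroup.zero_closed[OF ideal.axioms(1)[OF ideal]] by simp

lemma add: "p \<in> I \<Longrightarrow> q \<in> I \<Longrightarrow> p + q \<in> I"
  using additive_subgroup.a_closed[OF ideal.axioms(1)[OF ideal], of p q] by simp

lemma mult_left: "p \<in> polys V \<Longrightarrow> q \<in> I \<Longrightarrow> p * q \<in> I"
  using ideal.I_l_closed[OF ideal, of q p] by simp

lemma mult_right: "p \<in> I \<Longrightarrow> q \<in> polys V \<Longrightarrow> p * q \<in> I"
  using mult_left[of q p] by (simp add: mult.commute)

lemma uminus: "p \<in> I \<Longrightarrow> - p \<in> I"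
  using mult_left[OF Const_in_polys, of p "- 1"] by simp

lemma diff: "p \<in> I \<Longrightarrow> q \<in> I \<Longrightarrow> p - q \<in> I"
  using add[OF _ uminus, of p q] by simp

lemma sum: "(\<And>x. x \<in> S \<Longrightarrow> f x \<in> I) \<Longrightarrow> sum f S \<in> I"
  by (induction S rule: infinite_finite_induct) (auto intro: zero add)

text \<open>Congruence modulo \<open>I\<close>, with membership of both sides built in so that
  chains of congruences carry it along.\<close>

definition eqv :: "('v, 'k) mpoly \<Rightarrow> ('v, 'k) mpoly \<Rightarrow> bool" (infix \<open>\<approx>\<close> 50) where
  "p \<approx> q \<longleftrightarrow> p \<in> polys V \<and> q \<in> polys V \<and> p - q \<in> I"

lemma eqv_refl: "p \<in> polys V \<Longrightarrow> p \<approx> p"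
  by (simp add: eqv_def zero)

lemma eqv_sym: "p \<approx> q \<Longrightarrow> q \<approx> p"
  using uminus[of "p - q"] by (simp add: eqv_def)

lemma eqv_trans [trans]: "p \<approx> q \<Longrightarrow> q \<approx> r \<Longrightarrow> p \<approx> r"
  using add[of "p - q" "q - r"] by (simp add: eqv_def)

lemma eqv_add: "p \<approx> q \<Longrightarrow> p' \<approx> q' \<Longrightarrow> p + p' \<approx> q + q'"
  using add[of "p - q" "p' - q'"] by (simp add: eqv_def polys_closed add_diff_add)

lemma eqv_diff: "p \<approx> q \<Longrightarrow> p' \<approx> q' \<Longrightarrow> p - p' \<approx> q - q'"
  using diff[of "p - q" "p' - q'"] by (simp add: eqv_def polys_closed algebra_simps)

lemma eqv_mult: "p \<approx> q \<Longrightarrow> p' \<approx> q' \<Longrightarrow> p * p' \<approx> q * q'"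
  using add[OF mult_right[of "p - q" p'] mult_left[of q "p' - q'"]]
  by (simp add: eqv_def polys_closed algebra_simps)

lemma eqv_power: "p \<approx> q \<Longrightarrow> p ^ k \<approx> q ^ k"
  by (induction k) (auto intro: eqv_refl eqv_mult one_in_carrier)

lemma eqv_sum: "(\<And>x. x \<in> S \<Longrightarrow> f x \<approx> g x) \<Longrightarrow> sum f S \<approx> sum g S"
  by (induction S rule: infinite_finite_induct) (auto intro: eqv_refl eqv_add)

lemma eqv_prod: "(\<And>x. x \<in> S \<Longrightarrow> f x \<approx> g x) \<Longrightarrow> prod f S \<approx> prod g S"
  by (induction S rule: infinite_finite_induct) (auto intro: eqv_refl eqv_mult one_in_carrier)

lemma eqv_ideal: "p \<approx> q \<Longrightarrow> p \<in> I \<longleftrightarrow> q \<in> I"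
  using add[of "p - q" q] diff[of p "p - q"] by (auto simp: eqv_def)

lemma eqv_subst:
  assumes "p \<in> polys W" "\<And>w. w \<in> W \<Longrightarrow> f w \<approx> g w"
  shows "subst f p \<approx> subst g p"
  using assms(1) by (induction rule: polys_induct) (auto intro: eqv_refl eqv_add eqv_mult assms(2))

text \<open>Together with \<open>genideal_least\<close>, this reduces the compatibility of a
  substitution with two ideals to a check on the defining relations.\<close>

lemma ideal_vimage_subst:
  assumes "\<And>w. w \<in> W \<Longrightarrow> f w \<in> polys V"
  shows "ideal {p \<in> polys W. subst f p \<in> I} (poly_algebra W)"
  by (rule poly_idealI) (auto simp: polys_closed zero add mult_left subst_in_polys assms)

text \<open>The multinomial expansion: every monomial but \<open>\<Prod>a\<^sub>x\<close> contains a square.\<close>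

lemma sum_power_card_in:
  assumes S: "finite S" and a: "\<And>x. x \<in> S \<Longrightarrow> a x \<in> polys V" "\<And>x. x \<in> S \<Longrightarrow> a x ^ 2 \<in> I"
    and top: "prod a S \<in> I"
  shows "sum a S ^ card S \<in> I"
proof -
  have a_prod: "prod a U \<in> polys V" if "U \<subseteq> S" for U
    using that a by (intro prod_in_carrier) auto
  have "prod a U * sum a S ^ k \<in> I" if "U \<subseteq> S" "card (S - U) = k" for U k
    using that
  proof (induction k arbitrary: U)
    case 0
    then have "U = S" using S by auto
    then show ?case using top by simp
  next
    case (Suc k)
    have "a x * (prod a U * sum a S ^ k) \<in> I" if x: "x \<in> S" for x
    proof (cases "x \<in> U")
      case True
      have "finite U" using Suc.prems S finite_subset by blast
      then have "prod a U = a x * prod a (U - {x})" using True by (simp add: prod.remove)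
      then have "a x * (prod a U * sum a S ^ k) = a x ^ 2 * (prod a (U - {x}) * sum a S ^ k)"
        by (simp add: power2_eq_square mult_ac)
      moreover have "prod a (U - {x}) * sum a S ^ k \<in> polys V"
        using Suc.prems a by (intro mult_in_carrier a_prod power_in_carrier sum_in_carrier) auto
      ultimately show ?thesis using a(2)[OF x] mult_right by simp
    next
      case False
      have "finite U" using Suc.prems S finite_subset by blast
      moreover have "S - insert x U = S - U - {x}" by blast
      ultimately have "prod a (insert x U) * sum a S ^ k \<in> I"
        using Suc x False S by (intro Suc.IH) auto
      then show ?thesis using False \<open>finite U\<close> by (simp add: mult_ac)
    qed
    then have "(\<Sum>x\<in>S. a x * (prod a U * sum a S ^ k)) \<in> I" by (rule sum)
    moreover have "(\<Sum>x\<in>S. a x * (prod a U * sum a S ^ k)) = prod a U * sum a S ^ Suc k"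
      by (simp add: sum_distrib_right[symmetric] mult_ac)
    ultimately show ?case by simp
  qed
  from this[of "{}" "card S"] show ?thesis by simp
qed

end

lemma poly_ideal_genideal:
  "S \<subseteq> polys V \<Longrightarrow> poly_ideal V (genideal (poly_algebra V) S)"
  using cring.axioms(1)[OF cring_poly_algebra] by (intro poly_ideal.intro ring.genideal_ideal)

lemma genideal_incl:
  fixes S :: "('v, 'k::field) mpoly set"
  shows "S \<subseteq> polys V \<Longrightarrow> p \<in> S \<Longrightarrow> p \<in> genideal (poly_algebra V) S"
  using ring.genideal_self[OF cring.axioms(1)[OF cring_poly_algebra]] by blast

lemma genideal_least:
  fixes S :: "('v, 'k::field) mpoly set"
  shows "ideal J (poly_algebra V) \<Longrightarrow> S \<subseteq> J \<Longrightarrow> genideal (poly_algebra V) S \<subseteq> J"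
  by (rule ring.genideal_minimal[OF cring.axioms(1)[OF cring_poly_algebra]])


section \<open>Algebra homomorphisms defined on polynomial rings\<close>

locale poly_hom =
  fixes V :: "'v set" and A :: "('k::field, 'a) module" and f :: "('v, 'k) mpoly \<Rightarrow> 'a"
  assumes algebra: "algebra class_ring A"
    and closed: "p \<in> polys V \<Longrightarrow> f p \<in> carrier A"
    and add: "p \<in> polys V \<Longrightarrow> q \<in> polys V \<Longrightarrow> f (p + q) = f p \<oplus>\<^bsub>A\<^esub> f q"
    and mult: "p \<in> polys V \<Longrightarrow> q \<in> polys V \<Longrightarrow> f (p * q) = f p \<otimes>\<^bsub>A\<^esub> f q"
    and one: "f 1 = \<one>\<^bsub>A\<^esub>"
    and scale: "p \<in> polys V \<Longrightarrow> f (Const c * p) = c \<odot>\<^bsub>A\<^esub> f p"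
begin

sublocale A: cring A
  by (rule algebra.axioms(2)[OF algebra])

lemma zero: "f 0 = \<zero>\<^bsub>A\<^esub>"
  using add[of 0 0] closed[of 0] A.add.r_cancel_one' by (metis add_0 zero_in_polys)

lemma eq_iff: "p \<in> polys V \<Longrightarrow> q \<in> polys V \<Longrightarrow> f p = f q \<longleftrightarrow> f (p - q) = \<zero>\<^bsub>A\<^esub>"
  using add[of "p - q" q] closed A.add.l_cancel_one[of "f q" "f (p - q)"]
  by (auto simp: diff_in_polys A.add.m_comm)

lemma sum: "finite S \<Longrightarrow> (\<And>x. x \<in> S \<Longrightarrow> g x \<in> polys V) \<Longrightarrow> f (sum g S) = (\<Oplus>\<^bsub>A\<^esub>x\<in>S. f (g x))"
proof (induction S rule: finite_induct)
  case (insert x S)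
  then show ?case by (subst A.finsum_insert) (auto simp: add sum_in_carrier closed)
qed (simp add: zero)

lemma prod: "finite S \<Longrightarrow> (\<And>x. x \<in> S \<Longrightarrow> g x \<in> polys V) \<Longrightarrow> f (prod g S) = (\<Otimes>\<^bsub>A\<^esub>x\<in>S. f (g x))"
proof (induction S rule: finite_induct)
  case (insert x S)
  then show ?case by (subst A.finprod_insert) (auto simp: mult prod_in_carrier closed)
qed (simp add: one)

lemma const: "f (Const c) = c \<odot>\<^bsub>A\<^esub> \<one>\<^bsub>A\<^esub>"
  using scale[OF one_in_carrier, of c] by (simp add: one)

end

text \<open>The isomorphism sends \<open>f p\<close> to \<open>g p\<close>. Equality of the kernels
  makes it well defined and injective, whichever preimage is chosen.\<close>

lemma algebra_isomorphic_if_same_kernel: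
  assumes f: "poly_hom V A f" "f ` polys V = carrier A"
    and g: "poly_hom V B g" "g ` polys V = carrier B"
    and ker: "\<And>p. p \<in> polys V \<Longrightarrow> f p = \<zero>\<^bsub>A\<^esub> \<longleftrightarrow> g p = \<zero>\<^bsub>B\<^esub>"
  shows "algebra_isomorphic A B"
proof -
  interpret f: poly_hom V A f by (rule f)
  interpret g: poly_hom V B g by (rule g)
  have eq: "f p = f q \<longleftrightarrow> g p = g q" if "p \<in> polys V" "q \<in> polys V" for p q
    using that ker f.eq_iff g.eq_iff by (simp add: diff_in_polys)
  define h where "h x = g (inv_into (polys V) f x)" for x
  have h: "h (f p) = g p" if "p \<in> polys V" for p
    unfolding h_def using that eq[of "inv_into (polys V) f (f p)" p]
    by (simp add: f_inv_into_f inv_into_into)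
  have rep: "\<exists>p\<in>polys V. x = f p" if "x \<in> carrier A" for x
    using that f(2) by blast
  have "h \<in> Ring.ring_hom A B"
  proof (rule ring_hom_memI)
    show "h x \<in> carrier B" if "x \<in> carrier A" for x
      using rep[OF that] h g.closed by auto
    show "h (x \<otimes>\<^bsub>A\<^esub> y) = h x \<otimes>\<^bsub>B\<^esub> h y" if xy: "x \<in> carrier A" "y \<in> carrier A" for x y
    proof -
      obtain p q where "p \<in> polys V" "q \<in> polys V" "x = f p" "y = f q" using rep xy by meson
      then show ?thesis using h[of "p * q"] by (simp add: f.mult g.mult h mult_in_carrier)
    qed
    show "h (x \<oplus>\<^bsub>A\<^esub> y) = h x \<oplus>\<^bsub>B\<^esub> h y" if xy: "x \<in> carrier A" "y \<in> carrier A" for x y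
    proof -
      obtain p q where "p \<in> polys V" "q \<in> polys V" "x = f p" "y = f q" using rep xy by meson
      then show ?thesis using h[of "p + q"] by (simp add: f.add g.add h add_in_carrier)
    qed
    show "h \<one>\<^bsub>A\<^esub> = \<one>\<^bsub>B\<^esub>"
      using h[of 1] by (simp add: f.one g.one one_in_carrier)
  qed
  moreover have "bij_betw h (carrier A) (carrier B)"
  proof (rule bij_betwI')
    fix x y assume "x \<in> carrier A" "y \<in> carrier A"
    then show "h x = h y \<longleftrightarrow> x = y" using rep h eq by metis
  next
    fix x assume "x \<in> carrier A"
    then show "h x \<in> carrier B" using rep h g.closed by metis
  next
    fix y assume "y \<in> carrier B"
    then show "\<exists>x\<in>carrier A. y = h x" using g(2) h f.closed by force
  qed
  moreover have "h (c \<odot>\<^bsub>A\<^esub> x) = c \<odot>\<^bsub>B\<^esub> h x" if x: "x \<in> carrier A" for c x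
  proof -
    obtain p where "p \<in> polys V" "x = f p" using rep[OF x] by blast
    then show ?thesis using h[of "Const c * p"] by (simp add: f.scale g.scale h mult_in_carrier)
  qed
  ultimately show ?thesis
    by (auto simp: algebra_isomorphic_def ring_iso_def)
qed

text \<open>The family \<open>b\<close> is indexed, whereas a basis is a set of vectors.
  Independence makes the family of images injective, so the cardinality of the index set is the
  dimension.\<close>

lemma has_dimension_if_basis:
  fixes A :: "('k::field, 'a) module" and b :: "'x \<Rightarrow> ('v, 'k) mpoly"
  assumes f: "poly_hom V A f" "f ` polys V = carrier A"
    and X: "finite X" and b: "\<And>x. x \<in> X \<Longrightarrow> b x \<in> polys V"
    and span: "\<And>p. p \<in> polys V \<Longrightarrow> \<exists>c. f (p - (\<Sum>x\<in>X. Const (c x) * b x)) = \<zero>\<^bsub>A\<^esub>"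
    and indep: "\<And>c. f (\<Sum>x\<in>X. Const (c x) * b x) = \<zero>\<^bsub>A\<^esub> \<Longrightarrow> \<forall>x\<in>X. c x = 0"
  shows "has_dimension A (card X)"
proof -
  interpret f: poly_hom V A f by (rule f)
  interpret VS: vectorspace class_ring A by (rule vectorspace_if_algebra[OF f.algebra])
  let ?S = "(\<lambda>x. f (b x)) ` X"
  have inj: "inj_on (\<lambda>x. f (b x)) X"
  proof (rule inj_onI, rule ccontr)
    fix x y assume xy: "x \<in> X" "y \<in> X" "f (b x) = f (b y)" "x \<noteq> y"
    define c where "c z = (if z = x then 1 else if z = y then - 1 else (0 :: 'k))" for z
    have "(\<Sum>z\<in>X. Const (c z) * b z) = (\<Sum>z\<in>X. if z = x then b z else 0) - (\<Sum>z\<in>X. if z = y then b z else 0)"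
      unfolding sum_subtractf[symmetric] using xy(4) by (intro sum.cong) (auto simp: c_def)
    then have "(\<Sum>z\<in>X. Const (c z) * b z) = b x - b y" using xy X by simp
    moreover have "f (b x - b y) = \<zero>\<^bsub>A\<^esub>"
      using f.eq_iff[OF b[OF xy(1)] b[OF xy(2)]] xy(3) by blast
    ultimately have "\<forall>z\<in>X. c z = 0" by (intro indep) simp
    then have "c x = 0" using xy(1) by blast
    then show False by (simp add: c_def)
  qed
  have comb: "f (\<Sum>x\<in>X. Const (c (f (b x))) * b x) = VS.lincomb c ?S" for c
  proof -
    have cl: "c (f (b x)) \<odot>\<^bsub>A\<^esub> f (b x) \<in> carrier A" if "x \<in> X" for x
      using f.closed[OF b[OF that]] by simp
    have "f (\<Sum>x\<in>X. Const (c (f (b x))) * b x) = (\<Oplus>\<^bsub>A\<^esub>x\<in>X. c (f (b x)) \<odot>\<^bsub>A\<^esub> f (b x))"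
      using X b cl by (subst f.sum) (auto simp: f.scale mult_in_carrier intro!: f.A.finsum_cong')
    also have "\<dots> = VS.lincomb c ?S"
      unfolding VS.lincomb_def using inj cl by (subst f.A.finsum_reindex) auto
    finally show ?thesis .
  qed
  have S: "?S \<subseteq> carrier A" "finite ?S" using b f.closed X by auto
  have "VS.lin_indpt ?S"
  proof (rule VS.finite_lin_indpt2[OF S(2,1)])
    fix c assume "VS.lincomb c ?S = \<zero>\<^bsub>A\<^esub>"
    then show "\<forall>v\<in>?S. c v = \<zero>\<^bsub>class_ring\<^esub>"
      using indep[of "\<lambda>x. c (f (b x))"] comb by auto
  qed
  moreover have "VS.gen_set ?S"
  proof (rule subset_antisym)
    show "VS.span ?S \<subseteq> carrier A"
      using S VS.span_is_subset2 by blast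
    show "carrier A \<subseteq> VS.span ?S"
    proof
      fix y assume "y \<in> carrier A"
      then obtain p where p: "p \<in> polys V" "y = f p" using f(2) by blast
      obtain c where "f (p - (\<Sum>x\<in>X. Const (c x) * b x)) = \<zero>\<^bsub>A\<^esub>" using span[OF p(1)] by blast
      then have "y = f (\<Sum>x\<in>X. Const (c x) * b x)"
        using p b by (subst (asm) f.eq_iff[symmetric])
          (auto intro!: sum_in_carrier mult_in_carrier Const_in_polys)
      \<comment> \<open>Coefficients indexed by X become coefficients of vectors by inverting the
        injective family.\<close>
      also have "\<dots> = f (\<Sum>x\<in>X. Const ((\<lambda>v. c (inv_into X (\<lambda>x. f (b x)) v)) (f (b x))) * b x)"
        using inj by (intro arg_cong[where f = f] sum.cong) (simp_all add: inv_into_f_f[of "\<lambda>x. f (b x)" X])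
      also have "\<dots> = VS.lincomb (\<lambda>v. c (inv_into X (\<lambda>x. f (b x)) v)) ?S" by (rule comb)
      also have "\<dots> \<in> VS.span ?S"
        unfolding VS.span_def using S(2) by (intro CollectI exI conjI refl) auto
      finally show "y \<in> VS.span ?S" .
    qed
  qed
  ultimately have "VS.basis ?S" using S by (simp add: VS.basis_def)
  moreover have "card ?S = card X" by (rule card_image[OF inj])
  moreover have "VS.fin_dim"
    unfolding VS.fin_dim_def using S \<open>VS.gen_set ?S\<close> by blast
  ultimately show ?thesis
    using VS.dim_basis[OF S(2)] VS.vectorspace_axioms by (simp add: has_dimension_def)
qed

section \<open>Quotient maps, substitutions and generated subalgebras\<close>

definition quot_map :: "'v set \<Rightarrow> ('v, 'k::field) mpoly set \<Rightarrow> ('v, 'k) mpoly \<Rightarrow> ('v, 'k) mpoly set" where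
  "quot_map V S p = genideal (poly_algebra V) S +>\<^bsub>poly_algebra V\<^esub> p"

lemma poly_hom_quot_map:
  fixes S :: "('v, 'k::field) mpoly set"
  assumes S: "S \<subseteq> polys V"
  shows "poly_hom V (presented_algebra V S) (quot_map V S)"
proof -
  interpret P: algebra class_ring "poly_algebra V :: ('k, ('v, 'k) mpoly) module"
    by (rule algebra_poly_algebra)
  interpret ideal "genideal (poly_algebra V) S" "poly_algebra V"
    by (rule poly_ideal.ideal[OF poly_ideal_genideal[OF S]])
  have hom: "quot_map V S \<in> Ring.ring_hom (poly_algebra V) (poly_algebra V Quot genideal (poly_algebra V) S)"
    unfolding quot_map_def[abs_def] by (rule rcos_ring_hom)
  show ?thesis
  proof (rule poly_hom.intro)
    show "algebra class_ring (presented_algebra V S)" by (rule algebra_presented_algebra[OF S])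
    fix c :: 'k and p :: "('v, 'k) mpoly" assume "p \<in> polys V"
    then show "quot_map V S (Const c * p) = c \<odot>\<^bsub>presented_algebra V S\<^esub> quot_map V S p"
      using quot_algebra_smult[OF algebra_poly_algebra is_ideal, of c p]
      by (simp add: quot_map_def presented_algebra_def)
  qed (use ring_hom_closed[OF hom] ring_hom_add[OF hom] ring_hom_mult[OF hom]
      ring_hom_one[OF hom] in \<open>simp_all add: presented_algebra_def\<close>)
qed

lemma quot_map_image: "quot_map V S ` polys V = carrier (presented_algebra V S)"
  by (auto simp: presented_algebra_def FactRing_def A_RCOSETS_def' quot_map_def)

lemma quot_map_eq_zero_iff:
  fixes S :: "('v, 'k::field) mpoly set"
  assumes S: "S \<subseteq> polys V" and p: "p \<in> polys V"
  shows "quot_map V S p = \<zero>\<^bsub>presented_algebra V S\<^esub> \<longleftrightarrow> p \<in> genideal (poly_algebra V) S"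
proof -
  interpret ideal "genideal (poly_algebra V) S" "poly_algebra V"
    by (rule poly_ideal.ideal[OF poly_ideal_genideal[OF S]])
  have "\<zero>\<^bsub>presented_algebra V S\<^esub> = genideal (poly_algebra V) S"
    by (simp add: presented_algebra_def FactRing_def)
  then show ?thesis
    unfolding quot_map_def using p a_rcos_const a_rcos_self by metis
qed

lemma poly_hom_subst:
  assumes "poly_hom W A f" "\<And>v. v \<in> V \<Longrightarrow> g v \<in> polys W"
  shows "poly_hom V A (\<lambda>p. f (subst g p))"
proof -
  interpret f: poly_hom W A f by (rule assms)
  show ?thesis
    by (intro poly_hom.intro f.algebra)
      (simp_all add: f.closed f.add f.mult f.one f.scale[symmetric] subst_in_polys assms(2))
qed

text \<open>The image of the polynomial ring is one of the subalgebras being intersected, and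
  induction on polynomials places it inside each of the others.\<close>

lemma poly_hom_subalgebra:
  assumes f: "poly_hom V A f"
  defines "B \<equiv> subalgebra_generated A ((\<lambda>v. f (Var v)) ` V)"
  shows "poly_hom V B f" and "f ` polys V = carrier B" and "\<zero>\<^bsub>B\<^esub> = \<zero>\<^bsub>A\<^esub>"
proof -
  interpret f: poly_hom V A f by (rule f)
  interpret M: module class_ring A by (rule algebra.axioms(1)[OF f.algebra])
  let ?G = "(\<lambda>v. f (Var v)) ` V"
  have G: "?G \<subseteq> carrier A" using f.closed[OF Var_in_carrier] by blast
  have ops: "(\<oplus>\<^bsub>B\<^esub>) = (\<oplus>\<^bsub>A\<^esub>)" "(\<otimes>\<^bsub>B\<^esub>) = (\<otimes>\<^bsub>A\<^esub>)" "\<one>\<^bsub>B\<^esub> = \<one>\<^bsub>A\<^esub>" "(\<odot>\<^bsub>B\<^esub>) = (\<odot>\<^bsub>A\<^esub>)"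
    by (simp_all add: B_def subalgebra_generated_def)
  show "\<zero>\<^bsub>B\<^esub> = \<zero>\<^bsub>A\<^esub>" by (simp add: B_def subalgebra_generated_def)
  have img: "subring (f ` polys V) A"
  proof (rule f.A.subringI)
    fix x assume "x \<in> f ` polys V"
    then obtain p where p: "p \<in> polys V" "x = f p" by blast
    have "\<ominus>\<^bsub>A\<^esub> x = f (- p)"
      using p f.add[of "- p" p] by (intro f.A.minus_equality) (simp_all add: f.zero f.closed uminus_in_polys)
    then show "\<ominus>\<^bsub>A\<^esub> x \<in> f ` polys V" using p uminus_in_polys by blast
  next
    show "f ` polys V \<subseteq> carrier A" using f.closed by blast
    show "\<one>\<^bsub>A\<^esub> \<in> f ` polys V" using f.one by (intro image_eqI[of _ _ 1]) (simp_all add: one_in_carrier)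
  next
    fix x y assume "x \<in> f ` polys V" "y \<in> f ` polys V"
    then obtain p q where "p \<in> polys V" "q \<in> polys V" "x = f p" "y = f q" by blast
    then show "x \<otimes>\<^bsub>A\<^esub> y \<in> f ` polys V" "x \<oplus>\<^bsub>A\<^esub> y \<in> f ` polys V"
      by (simp_all add: f.mult[symmetric] f.add[symmetric] mult_in_carrier add_in_carrier)
  qed
  have "c \<odot>\<^bsub>A\<^esub> x \<in> f ` polys V" if "x \<in> f ` polys V" for c x
    using that by (auto simp: f.scale[symmetric] mult_in_carrier)
  moreover have "?G \<subseteq> f ` polys V" using Var_in_carrier by (auto intro!: imageI)
  ultimately have "f ` polys V \<in> {C. ?G \<subseteq> C \<and> subring C A \<and> (\<forall>c. \<forall>x\<in>C. c \<odot>\<^bsub>A\<^esub> x \<in> C)}"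
    using img by blast
  then have "carrier B \<subseteq> f ` polys V"
    unfolding B_def subalgebra_generated_def by (simp add: Inter_lower)
  moreover have "f p \<in> C" if p: "p \<in> polys V" and C: "?G \<subseteq> C" "subring C A"
    "\<forall>c. \<forall>x\<in>C. c \<odot>\<^bsub>A\<^esub> x \<in> C" for p C
    using p
  proof (induction rule: polys_induct)
    case (Const c)
    show ?case using C subringE(3)[OF C(2)] by (simp add: f.const)
  qed (use C subringE(6,7)[OF C(2)] in \<open>auto simp: f.add f.mult\<close>)
  then have "f ` polys V \<subseteq> carrier B"
    unfolding B_def subalgebra_generated_def by auto
  ultimately show img: "f ` polys V = carrier B" by blast
  have "algebra class_ring B"
    unfolding B_def by (rule algebra_subalgebra_generated[OF f.algebra G])
  then show "poly_hom V B f"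
    by (rule poly_hom.intro) (simp_all add: ops f.add f.mult f.one f.scale[symmetric] flip: img)
qed


section \<open>Exponentials and logarithms of nilpotent elements\<close>

text \<open>
  The bound \<open>N\<close> on the order of nilpotency modulo \<open>I\<close> is uniform on pairs of elements of \<open>Z\<close>, so
  that power series truncated at degree \<open>N\<close> can be multiplied and composed.
\<close>

locale nilpotent_ideal = poly_ideal V I
  for V :: "'v set" and I :: "('v, 'k::field_char_0) mpoly set" +
  fixes Z :: "('v, 'k) mpoly set" and N :: nat
  assumes ideal_Z: "ideal Z (poly_algebra V)"
    and nilpotent: "a \<in> Z \<Longrightarrow> b \<in> Z \<Longrightarrow> N \<le> i + j \<Longrightarrow> a ^ i * b ^ j \<in> I"
    and N: "2 \<le> N"

definition fps_eval :: "nat \<Rightarrow> 'k fps \<Rightarrow> ('v, 'k::field) mpoly \<Rightarrow> ('v, 'k) mpoly" where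
  "fps_eval N f u = (\<Sum>k<N. Const (fps_nth f k) * u ^ k)"

lemma fps_eval_in_polys: "u \<in> polys V \<Longrightarrow> fps_eval N f u \<in> polys V"
  unfolding fps_eval_def by (intro polys_closed) auto

lemma fps_eval_subst: "subst g (fps_eval N f u) = fps_eval N f (subst g u)"
  by (simp add: fps_eval_def subst_sum)

lemma fps_eval_one: "0 < N \<Longrightarrow> fps_eval N 1 u = 1"
proof -
  have "fps_eval N 1 u = (\<Sum>k<N. if k = 0 then 1 else 0)"
    unfolding fps_eval_def by (intro sum.cong) auto
  then show "0 < N \<Longrightarrow> fps_eval N 1 u = 1" by simp
qed

lemma fps_eval_X: "2 \<le> N \<Longrightarrow> fps_eval N fps_X u = u"
proof -
  have "fps_eval N fps_X u = (\<Sum>k<N. if k = 1 then u else 0)"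
    unfolding fps_eval_def by (intro sum.cong) auto
  then show "2 \<le> N \<Longrightarrow> fps_eval N fps_X u = u" by simp
qed

lemma fps_eval_diff: "fps_eval N (f - g) u = fps_eval N f u - fps_eval N g u"
  by (simp add: fps_eval_def sum_subtractf left_diff_distrib)

lemma fps_eval_factor:
  assumes "u \<in> polys V" "fps_nth f 0 = 0"
  shows "\<exists>w\<in>polys V. fps_eval N f u = u * w"
proof
  let ?w = "\<Sum>k<N. if k = 0 then 0 else Const (fps_nth f k) * u ^ (k - 1)"
  show "?w \<in> polys V" using assms(1) by (auto intro!: sum_in_carrier mult_in_carrier power_in_carrier)
  show "fps_eval N f u = u * ?w"
    unfolding fps_eval_def sum_distrib_left using assms(2)
    by (intro sum.cong) (auto simp: mult_ac gr0_conv_Suc)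
qed

text \<open>The series of log (1 + x), given as the compositional inverse of exp x - 1, so that both
  composition identities are immediate.\<close>

definition fps_log :: "'k::field_char_0 fps" where
  "fps_log = fps_inv (fps_exp 1 - 1)"

lemma fps_log_0 [simp]: "fps_nth fps_log 0 = 0"
  by (simp add: fps_log_def fps_inv_def)

lemma fps_log_compose_exp: "fps_log oo (fps_exp 1 - 1) = (fps_X :: 'k::field_char_0 fps)"
  unfolding fps_log_def by (rule fps_inv_fps_exp_compose) simp

lemma fps_exp_compose_log: "(fps_exp 1 - 1) oo fps_log = (fps_X :: 'k::field_char_0 fps)"
  unfolding fps_log_def by (rule fps_inv_fps_exp_compose) simp

context nilpotent_ideal
begin

interpretation Z: poly_ideal V Z
  by (rule poly_ideal.intro[OF ideal_Z])

lemma Z_carr: "z \<in> Z \<Longrightarrow> z \<in> polys V"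
  by (rule Z.carr)

lemma Z_sum: "(\<And>x. x \<in> S \<Longrightarrow> a x \<in> Z) \<Longrightarrow> sum a S \<in> Z"
  by (rule Z.sum)

lemma Z_uminus: "z \<in> Z \<Longrightarrow> - z \<in> Z"
  by (rule Z.uminus)

lemma power_in_ideal: "u \<in> Z \<Longrightarrow> N \<le> k \<Longrightarrow> u ^ k \<in> I"
  using nilpotent[of u u k 0] by simp

lemma fps_eval_in_Z:
  assumes "u \<in> Z" "fps_nth f 0 = 0"
  shows "fps_eval N f u \<in> Z"
  using fps_eval_factor[OF Z.carr[OF assms(1)] assms(2), of N] Z.mult_right[OF assms(1)] by auto

text \<open>Truncation by total degree and truncation in each degree separately differ by terms with
  i + j at least N, all of which lie in \<open>I\<close>.\<close>

lemma triangle_eqv: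
  assumes "\<And>i j. t i j \<in> polys V" "\<And>i j. N \<le> i + j \<Longrightarrow> t i j \<in> I"
  shows "(\<Sum>k<N. \<Sum>i\<le>k. t i (k - i)) \<approx> (\<Sum>i<N. \<Sum>j<N. t i j)"
proof -
  let ?Q = "{..<N} \<times> {..<N}" and ?T = "{(i, j). i + j < N}"
  have sub: "?T \<subseteq> ?Q" by auto
  have "(\<Sum>i<N. \<Sum>j<N. t i j) = (\<Sum>(i, j)\<in>?Q. t i j)"
    by (simp add: sum.cartesian_product)
  also have "\<dots> = (\<Sum>(i, j)\<in>?Q - ?T. t i j) + (\<Sum>(i, j)\<in>?T. t i j)"
    by (rule sum.subset_diff[OF sub]) simp
  also have "(\<Sum>(i, j)\<in>?T. t i j) = (\<Sum>k<N. \<Sum>i\<le>k. t i (k - i))"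
    by (rule sum.triangle_reindex)
  finally have "(\<Sum>k<N. \<Sum>i\<le>k. t i (k - i)) - (\<Sum>i<N. \<Sum>j<N. t i j) = - (\<Sum>(i, j)\<in>?Q - ?T. t i j)"
    by simp
  moreover have "(\<Sum>(i, j)\<in>?Q - ?T. t i j) \<in> I"
    by (rule sum) (auto intro: assms(2))
  ultimately show ?thesis
    unfolding eqv_def using assms(1) uminus by (auto intro!: sum_in_carrier)
qed

lemma fps_eval_mult:
  assumes u: "u \<in> Z"
  shows "fps_eval N (f * g) u \<approx> fps_eval N f u * fps_eval N g u"
proof -
  let ?t = "\<lambda>i j. Const (fps_nth f i * fps_nth g j) * u ^ (i + j)"
  have Const_sum: "Const (sum h S) = (\<Sum>x\<in>S. Const (h x))" for h :: "nat \<Rightarrow> 'k" and S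
    by (induction S rule: infinite_finite_induct) simp_all
  have "fps_eval N (f * g) u = (\<Sum>k<N. \<Sum>i\<le>k. ?t i (k - i))"
    unfolding fps_eval_def fps_mult_nth Const_sum atLeast0AtMost sum_distrib_right
    by (intro sum.cong) auto
  also have "\<dots> \<approx> (\<Sum>i<N. \<Sum>j<N. ?t i j)"
    using Z.carr[OF u] power_in_ideal[OF u]
    by (intro triangle_eqv) (auto intro: mult_left mult_in_carrier power_in_carrier Const_in_polys
        simp del: Const_simps)
  also have "(\<Sum>i<N. \<Sum>j<N. ?t i j) = fps_eval N f u * fps_eval N g u"
    by (simp add: fps_eval_def sum_product power_add mult_ac)
  finally show ?thesis .
qed

lemma fps_eval_power:
  assumes u: "u \<in> Z"
  shows "fps_eval N (f ^ i) u \<approx> fps_eval N f u ^ i"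
proof (induction i)
  case 0
  show ?case using N by (simp add: fps_eval_one eqv_refl one_in_carrier)
next
  case (Suc i)
  have "fps_eval N (f ^ Suc i) u \<approx> fps_eval N f u * fps_eval N (f ^ i) u"
    using fps_eval_mult[OF u, of f "f ^ i"] by simp
  also have "\<dots> \<approx> fps_eval N f u * fps_eval N f u ^ i"
    by (intro eqv_mult Suc eqv_refl fps_eval_in_polys Z.carr u)
  finally show ?case by simp
qed

lemma fps_eval_compose:
  assumes u: "u \<in> Z" and g: "fps_nth g 0 = 0"
  shows "fps_eval N (f oo g) u \<approx> fps_eval N f (fps_eval N g u)"
proof -
  have Const_sum: "Const (sum h S) = (\<Sum>x\<in>S. Const (h x))" for h :: "nat \<Rightarrow> 'k" and S
    by (induction S rule: infinite_finite_induct) simp_all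
  \<comment> \<open>As g has no constant term, \<open>g ^ i\<close> has no coefficient at k for i >
    k, so the sum up to k may be extended to all i < N.\<close>
  have coeff: "fps_nth (f oo g) k = (\<Sum>i<N. fps_nth f i * fps_nth (g ^ i) k)" if "k < N" for k
    unfolding fps_compose_nth using that g startsby_zero_power_prefix[OF g]
    by (intro sum.mono_neutral_left) auto
  have "fps_eval N (f oo g) u = (\<Sum>k<N. \<Sum>i<N. Const (fps_nth f i) * (Const (fps_nth (g ^ i) k) * u ^ k))"
    unfolding fps_eval_def by (intro sum.cong) (simp_all add: coeff Const_sum sum_distrib_right mult.assoc)
  also have "\<dots> = (\<Sum>i<N. Const (fps_nth f i) * fps_eval N (g ^ i) u)"
    unfolding fps_eval_def sum_distrib_left by (rule sum.swap)
  also have "\<dots> \<approx> (\<Sum>i<N. Const (fps_nth f i) * fps_eval N g u ^ i)"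
    by (intro eqv_sum eqv_mult eqv_refl fps_eval_power u Const_in_polys)
  finally show ?thesis by (simp add: fps_eval_def)
qed

lemma fps_eval_eqv:
  "u \<approx> u' \<Longrightarrow> fps_eval N f u \<approx> fps_eval N f u'"
  unfolding fps_eval_def by (intro eqv_sum eqv_mult eqv_refl eqv_power Const_in_polys)

lemma exp_log:
  assumes "u \<in> Z"
  shows "fps_eval N (fps_exp 1) (fps_eval N fps_log u) \<approx> 1 + u"
proof -
  let ?l = "fps_eval N fps_log u"
  have "fps_eval N (fps_exp 1 - 1) ?l \<approx> fps_eval N ((fps_exp 1 - 1) oo fps_log) u"
    by (rule eqv_sym[OF fps_eval_compose[OF assms]]) simp
  also have "fps_eval N ((fps_exp 1 - 1) oo fps_log) u = u"
    using N by (simp only: fps_exp_compose_log fps_eval_X)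
  finally have "1 + fps_eval N (fps_exp 1 - 1) ?l \<approx> 1 + u"
    by (intro eqv_add eqv_refl one_in_carrier)
  then show ?thesis using N by (simp add: fps_eval_diff fps_eval_one)
qed

lemma log_exp:
  assumes "z \<in> Z"
  shows "fps_eval N fps_log (fps_eval N (fps_exp 1) z - 1) \<approx> z"
proof -
  have "fps_eval N fps_log (fps_eval N (fps_exp 1 - 1) z) \<approx> fps_eval N (fps_log oo (fps_exp 1 - 1)) z"
    by (rule eqv_sym[OF fps_eval_compose[OF assms]]) simp
  also have "fps_eval N (fps_log oo (fps_exp 1 - 1)) z = z"
    using N by (simp only: fps_log_compose_exp fps_eval_X)
  finally show ?thesis using N by (simp add: fps_eval_diff fps_eval_one)
qed

text \<open>By the binomial theorem the left side is the double series truncated by total degree,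
  while the product is truncated in each degree.\<close>

lemma exp_add:
  assumes a: "a \<in> Z" and b: "b \<in> Z"
  shows "fps_eval N (fps_exp 1) (a + b) \<approx> fps_eval N (fps_exp 1) a * fps_eval N (fps_exp 1) b"
proof -
  let ?t = "\<lambda>i j. Const (1 / fact i) * Const (1 / fact j) * (a ^ i * b ^ j)"
  have binom: "Const (1 / fact k) * (of_nat (k choose i) * a ^ i * b ^ (k - i)) = ?t i (k - i)"
    if "i \<le> k" for k i
  proof -
    have "(1 / fact k) * of_nat (k choose i) = (1 / fact i * (1 / fact (k - i)) :: 'k)"
      using that by (simp add: binomial_fact)
    then have "Const (1 / fact k) * of_nat (k choose i) =
        (Const (1 / fact i) * Const (1 / fact (k - i)) :: ('v, 'k) mpoly)"
      by (metis Const_of_nat Const_simps(4))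
    then show ?thesis by (simp only: mult.assoc[symmetric])
  qed
  have "fps_eval N (fps_exp 1) (a + b) = (\<Sum>k<N. \<Sum>i\<le>k. ?t i (k - i))"
    unfolding fps_eval_def fps_exp_nth binomial_ring sum_distrib_left power_one of_nat_fact
    by (intro sum.cong refl binom) simp
  also have "\<dots> \<approx> (\<Sum>i<N. \<Sum>j<N. ?t i j)"
    using Z.carr[OF a] Z.carr[OF b]
    by (intro triangle_eqv mult_left nilpotent[OF a b] mult_in_carrier power_in_carrier Const_in_polys)
  also have "(\<Sum>i<N. \<Sum>j<N. ?t i j) = fps_eval N (fps_exp 1) a * fps_eval N (fps_exp 1) b"
    by (simp add: fps_eval_def sum_product mult_ac)
  finally show ?thesis .
qed

lemma exp_0: "fps_eval N (fps_exp 1) 0 = (1 :: ('v, 'k) mpoly)"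
proof -
  have "fps_eval N (fps_exp 1) (0 :: ('v, 'k) mpoly) = (\<Sum>k<N. if k = 0 then 1 else 0)"
    unfolding fps_eval_def by (intro sum.cong) (auto simp: gr0_conv_Suc)
  then show ?thesis using N by simp
qed

lemma exp_sum:
  assumes "\<And>x. x \<in> S \<Longrightarrow> a x \<in> Z"
  shows "fps_eval N (fps_exp 1) (sum a S) \<approx> (\<Prod>x\<in>S. fps_eval N (fps_exp 1) (a x))"
  using assms
proof (induction S rule: infinite_finite_induct)
  case (insert x S)
  have "fps_eval N (fps_exp 1) (a x + sum a S) \<approx>
      fps_eval N (fps_exp 1) (a x) * fps_eval N (fps_exp 1) (sum a S)"
    using insert.prems by (intro exp_add Z.sum) auto
  also have "\<dots> \<approx> fps_eval N (fps_exp 1) (a x) * (\<Prod>x\<in>S. fps_eval N (fps_exp 1) (a x))"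
    using insert by (intro eqv_mult eqv_refl fps_eval_in_polys Z.carr insert.IH) auto
  finally show ?case using insert.hyps by simp
qed (simp_all add: exp_0 eqv_refl one_in_carrier)

lemma exp_square_zero:
  assumes u: "u \<in> polys V" "u ^ 2 \<in> I"
  shows "fps_eval N (fps_exp 1) u \<approx> 1 + u"
proof -
  have split: "{..<N} = insert 0 (insert 1 {2..<N})" using N by auto
  have "fps_eval N (fps_exp 1) u = 1 + u + (\<Sum>k\<in>{2..<N}. Const (1 / fact k) * u ^ k)"
    unfolding fps_eval_def split by (subst sum.insert; simp)+
  moreover have "(\<Sum>k\<in>{2..<N}. Const (1 / fact k) * u ^ k) \<in> I"
  proof (rule sum)
    fix k assume "k \<in> {2..<N}"
    then have "u ^ k = u ^ 2 * u ^ (k - 2)"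
      by (metis atLeastLessThan_iff le_add_diff_inverse power_add)
    then show "Const (1 / fact k) * u ^ k \<in> I"
      using u by (simp only:) (intro mult_left mult_right power_in_carrier Const_in_polys)
  qed
  ultimately show ?thesis
    unfolding eqv_def using u(1) by (simp add: polys_closed fps_eval_in_polys)
qed

text \<open>Each of \<open>exp z - 1\<close> and \<open>z\<close> divides the other modulo \<open>I\<close>.\<close>

lemma exp_minus_one_power:
  assumes z: "z \<in> Z" and p: "p \<approx> fps_eval N (fps_exp 1) z"
  shows "(p - 1) ^ d \<in> I \<longleftrightarrow> z ^ d \<in> I"
proof
  let ?e = "fps_eval N (fps_exp 1) z - 1"
  have pe: "p - 1 \<approx> ?e" by (intro eqv_diff p eqv_refl one_in_carrier)
  then have p1: "p - 1 \<in> polys V" by (simp add: eqv_def)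
  {
    assume "(p - 1) ^ d \<in> I"
    obtain w where w: "w \<in> polys V" "fps_eval N fps_log (p - 1) = (p - 1) * w"
      using fps_eval_factor[OF p1, of fps_log N] by auto
    have "z \<approx> (p - 1) * w"
      using eqv_trans[OF eqv_sym[OF log_exp[OF z]] fps_eval_eqv[OF eqv_sym[OF pe]]] by (simp add: w(2))
    from eqv_ideal[OF eqv_power[OF this]] show "z ^ d \<in> I"
      using \<open>(p - 1) ^ d \<in> I\<close> w(1) by (simp add: power_mult_distrib mult_right power_in_carrier)
  }
  {
    assume "z ^ d \<in> I"
    obtain w where w: "w \<in> polys V" "fps_eval N (fps_exp 1 - 1) z = z * w"
      using fps_eval_factor[OF Z.carr[OF z], of "fps_exp 1 - 1" N] by auto
    then have "p - 1 \<approx> z * w" using pe N by (simp add: fps_eval_diff fps_eval_one)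
    from eqv_ideal[OF eqv_power[OF this]] show "(p - 1) ^ d \<in> I"
      using \<open>z ^ d \<in> I\<close> w(1) by (simp add: power_mult_distrib mult_right power_in_carrier)
  }
qed

end

text \<open>The k-th power of the ideal generated by the \<open>u x\<close>: combinations of
  monomials in the \<open>u x\<close> of degree at least k.\<close>

inductive_set power_span :: "'v set \<Rightarrow> 'x set \<Rightarrow> ('x \<Rightarrow> ('v, 'k::field) mpoly) \<Rightarrow> nat \<Rightarrow> ('v, 'k) mpoly set"
  for V K u k where
  zero: "0 \<in> power_span V K u k"
| add: "p \<in> power_span V K u k \<Longrightarrow> c \<in> polys V \<Longrightarrow> k \<le> sum m K \<Longrightarrow>
    p + c * (\<Prod>x\<in>K. u x ^ m x) \<in> power_span V K u k"

lemma power_span_term: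
  "c \<in> polys V \<Longrightarrow> k \<le> sum m K \<Longrightarrow> c * (\<Prod>x\<in>K. u x ^ m x) \<in> power_span V K u k"
  by (drule (1) power_span.add[OF power_span.zero]) simp

lemma power_span_add:
  assumes "p \<in> power_span V K u k" "q \<in> power_span V K u k"
  shows "p + q \<in> power_span V K u k"
  using assms(2)
proof (induction rule: power_span.induct)
  case (add q c m)
  show ?case using power_span.add[OF add.IH add.hyps(2,3)] by (simp add: add.assoc)
qed (simp add: assms)

lemma power_span_mult:
  assumes p: "p \<in> power_span V K u i" and q: "q \<in> power_span V K u j"
  shows "p * q \<in> power_span V K u (i + j)"
  using p
proof (induction rule: power_span.induct)
  case zero
  then show ?case by (simp add: power_span.zero)
next
  case (add p c m)
  have "c * (\<Prod>x\<in>K. u x ^ m x) * q \<in> power_span V K u (i + j)"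
    using q
  proof (induction rule: power_span.induct)
    case (add q c' m')
    have "c * c' * (\<Prod>x\<in>K. u x ^ (m x + m' x)) \<in> power_span V K u (i + j)"
      using add.hyps \<open>c \<in> polys V\<close> \<open>i \<le> sum m K\<close>
      by (intro power_span_term mult_in_carrier) (auto simp: sum.distrib)
    from power_span_add[OF add.IH this] show ?case
      by (simp add: algebra_simps power_add prod.distrib)
  qed (simp add: power_span.zero)
  from power_span_add[OF add.IH this] show ?case
    by (simp add: distrib_right)
qed

lemma power_span_scale:
  "q \<in> power_span V K u k \<Longrightarrow> p \<in> polys V \<Longrightarrow> p * q \<in> power_span V K u k"
  using power_span_mult[of p V K u 0 q k] power_span_term[of p V 0 "\<lambda>_. 0" K u] by simp

text \<open>Pigeonhole: a monomial in the \<open>u x\<close> of degree greater than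
  \<open>card K * d\<close> contains a d-th power of some \<open>u x\<close>. Hence the N-th power
  of the ideal generated by the \<open>u x\<close> lies in I.\<close>

lemma nilpotent_idealI:
  fixes u :: "'x \<Rightarrow> ('v, 'k::field_char_0) mpoly"
  assumes I: "ideal I (poly_algebra V)" and K: "finite K"
    and u: "\<And>x. x \<in> K \<Longrightarrow> u x \<in> polys V" "\<And>x. x \<in> K \<Longrightarrow> u x ^ d \<in> I"
    and N: "card K * d < N" "2 \<le> N"
  shows "nilpotent_ideal V I (genideal (poly_algebra V) (u ` K)) N"
proof -
  interpret I: poly_ideal V I by (rule poly_ideal.intro[OF I])
  let ?W = "power_span V K u"
  let ?Z = "genideal (poly_algebra V) (u ` K)"
  have mon: "(\<Prod>x\<in>K. u x ^ m x) \<in> polys V" for m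
    using u by (auto intro!: prod_in_carrier power_in_carrier)
  have carr: "p \<in> polys V" if "p \<in> ?W k" for p k
    using that by (induction rule: power_span.induct) (auto intro: add_in_carrier mult_in_carrier mon)
  have W1: "ideal (?W 1) (poly_algebra V)"
    by (rule poly_idealI) (auto intro: carr power_span.zero power_span_add power_span_scale)
  have "u y \<in> ?W 1" if y: "y \<in> K" for y
  proof -
    let ?m = "\<lambda>x. if x = y then 1 else 0 :: nat"
    have "(\<Prod>x\<in>K. u x ^ ?m x) = (\<Prod>x\<in>K. if x = y then u x else 1)"
      by (intro prod.cong) auto
    also have "\<dots> = u y" using K y by simp
    finally show ?thesis
      using power_span_term[of 1 V 1 ?m K u, OF one_in_carrier] K y by simp
  qed
  then have Z: "?Z \<subseteq> ?W 1"
    by (intro genideal_least[OF W1]) auto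
  have pow: "a ^ i \<in> ?W i" if "a \<in> ?W 1" for a i
  proof (induction i)
    case 0
    show ?case using power_span_term[of 1 V 0 "\<lambda>_. 0" K u, OF one_in_carrier] by simp
  next
    case (Suc i)
    then show ?case using power_span_mult[OF that Suc] by simp
  qed
  have small: "p \<in> I" if "p \<in> ?W k" "N \<le> k" for p k
    using that
  proof (induction rule: power_span.induct)
    case (add p c m)
    have "\<exists>x\<in>K. d \<le> m x"
    proof (rule ccontr)
      assume "\<not> ?thesis"
      then have "sum m K \<le> card K * d" by (intro sum_bounded_above[where 'a = nat, simplified]) auto
      then show False using add N by linarith
    qed
    then obtain x where x: "x \<in> K" "d \<le> m x" by blast
    have "(\<Prod>x\<in>K. u x ^ m x) = u x ^ d * (u x ^ (m x - d) * (\<Prod>x\<in>K - {x}. u x ^ m x))"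
      using K x by (simp add: prod.remove mult.assoc[symmetric] flip: power_add)
    moreover have "(\<Prod>x\<in>K - {x}. u x ^ m x) \<in> polys V"
      using u by (auto intro!: prod_in_carrier power_in_carrier)
    ultimately have "(\<Prod>x\<in>K. u x ^ m x) \<in> I"
      using u x by (simp add: I.mult_right mult_in_carrier power_in_carrier)
    then show ?case using add by (intro I.add I.mult_left) auto
  qed (rule I.zero)
  show ?thesis
  proof (intro nilpotent_ideal.intro nilpotent_ideal_axioms.intro I.poly_ideal_axioms)
    show "ideal ?Z (poly_algebra V)"
      using u by (intro poly_ideal.ideal poly_ideal_genideal) auto
    show "a ^ i * b ^ j \<in> I" if "a \<in> ?Z" "b \<in> ?Z" "N \<le> i + j" for a b i j
      using that Z by (intro small[of _ "i + j"] power_span_mult pow) auto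
  qed (rule N(2))
qed


section \<open>The four algebras of a graph\<close>

lemma fold_pderivative_mult_Var:
  assumes "e \<notin> set es"
  shows "fold pderivative es (x * Var e) = fold pderivative es x * Var e"
  using assms by (induction es arbitrary: x) (auto simp: pderivative_mult pderivative_Var)

lemma fold_pderivative_add:
  "fold pderivative es (p + q) = fold pderivative es p + fold pderivative es q"
  by (induction es arbitrary: p q) (simp_all add: pderivative_add)

lemma fold_pderivative_0 [simp]: "fold pderivative es 0 = 0"
  by (induction es) simp_all

text \<open>Every term of the Leibniz expansion contains q differentiated by a sublist of
  \<open>es\<close>. The set \<open>H\<close> bounds the variables still available and loses e in
  the recursion.\<close>

lemma constant_term_fold_mult:
  assumes "distinct es" "set es \<subseteq> H"
    and "\<And>es. distinct es \<Longrightarrow> set es \<subseteq> H \<Longrightarrow> constant_term (fold pderivative es q) = 0"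
  shows "constant_term (fold pderivative es (p * q)) = 0"
  using assms
proof (induction es arbitrary: H p q)
  case Nil
  then show ?case using Nil.prems(3)[of "[]"] by simp
next
  case (Cons e es)
  have es: "distinct es" "set es \<subseteq> H - {e}" using Cons.prems(1,2) by auto
  have "constant_term (fold pderivative es (pderivative e p * q)) = 0"
    using Cons.prems by (intro Cons.IH[OF es]) auto
  moreover have "constant_term (fold pderivative es (p * pderivative e q)) = 0"
  proof (rule Cons.IH[OF es])
    fix es' assume "distinct es'" "set es' \<subseteq> H - {e}"
    then show "constant_term (fold pderivative es' (pderivative e q)) = 0"
      using Cons.prems(3)[of "e # es'"] Cons.prems(2) by auto
  qed
  ultimately show ?case by (simp add: pderivative_mult fold_pderivative_add)
qed

text \<open>A list of distinct variables contains e at most once, so at least one factor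
  \<open>Var e\<close> survives.\<close>

lemma fold_pderivative_square:
  fixes e :: 'v
  assumes "distinct es"
  shows "constant_term (fold pderivative es (Var e ^ 2 :: ('v, 'k::field) mpoly)) = 0"
proof (cases "e \<in> set es")
  case False
  then show ?thesis by (simp add: power2_eq_square fold_pderivative_mult_Var)
next
  case True
  let ?x = "Var e :: ('v, 'k) mpoly"
  obtain as bs where es: "es = as @ e # bs" using True by (meson split_list)
  with assms have notin: "e \<notin> set as" "e \<notin> set bs" by auto
  let ?q = "fold pderivative as (1 :: ('v, 'k) mpoly)"
  have "fold pderivative as (?x ^ 2) = ?q * ?x * ?x"
    using fold_pderivative_mult_Var[OF notin(1), of "?x"]
      fold_pderivative_mult_Var[OF notin(1), of "1 :: ('v, 'k) mpoly"] by (simp add: power2_eq_square)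
  then have "pderivative e (fold pderivative as (?x ^ 2)) = (pderivative e ?q * ?x + 2 * ?q) * ?x"
    by (simp add: pderivative_mult pderivative_Var algebra_simps)
  then show ?thesis
    by (simp only: es fold_append fold_Cons comp_apply fold_pderivative_mult_Var[OF notin(2)]) simp
qed

text \<open>The parameter \<open>ty\<close> fixes the ground field, which the graph does not
  mention.\<close>

locale graph_algebras =
  fixes n :: nat and E :: "nat set set" and ty :: "'k::field_char_0 itself"
  assumes graph: "simple_graph n E"
begin

definition B_relations :: "(nat, 'k) mpoly set" where
  "B_relations = {(\<Sum>i\<in>I. Var i) ^ boundary_card E I | I. I \<noteq> {} \<and> I \<subseteq> {1..n}}"

definition D_relations :: "(nat, 'k) mpoly set" where
  "D_relations = {((\<Prod>i\<in>I. Var i) - 1) ^ boundary_card E I | I. I \<noteq> {} \<and> I \<subset> {0..n}} \<union>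
      {(\<Prod>i\<in>{0..n}. Var i) - 1}"

lemma relations_in_polys:
  "B_relations \<subseteq> polys {1..n}" "D_relations \<subseteq> polys {0..n}"
  "(Phi_relations n E :: (nat set, 'k) mpoly set) \<subseteq> polys E"
  unfolding B_relations_def D_relations_def using Phi_relations_in_carrier
  by (auto intro!: in_carrier)

abbreviation "IB \<equiv> genideal (poly_algebra {1..n}) B_relations"
abbreviation "ID \<equiv> genideal (poly_algebra {0..n}) D_relations"
abbreviation "IPhi \<equiv> genideal (poly_algebra E) (Phi_relations n E :: (nat set, 'k) mpoly set)"

text \<open>Exceeds both bounds required by \<open>nilpotent_idealI\<close>: \<open>card E\<close>
  elements of square zero in \<Phi>, and n + 1 elements of exponent \<open>Suc (card E)\<close> in
  \<D>. Using one order for both lets truncated series pass from one algebra to the other under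
  substitution.\<close>

definition order :: nat where
  "order = 2 + card E * 2 + card {0..n} * Suc (card E)"

definition ZPhi :: "(nat set, 'k) mpoly set" where
  "ZPhi = genideal (poly_algebra E) (Var ` E)"

definition ZD :: "(nat, 'k) mpoly set" where
  "ZD = genideal (poly_algebra {0..n}) ((\<lambda>i. Var i - 1) ` {0..n})"

lemma finite_E: "finite E"
  by (rule simple_graph_finite[OF graph])

lemma boundary_card_le: "boundary_card E I \<le> card E"
  unfolding boundary_card_def by (rule card_mono[OF finite_E]) auto

sublocale IPhi: poly_ideal E IPhi
  by (rule poly_ideal_genideal[OF relations_in_polys(3)])

sublocale ID: poly_ideal "{0..n}" ID
  by (rule poly_ideal_genideal[OF relations_in_polys(2)])

sublocale IB: poly_ideal "{1..n}" IB
  by (rule poly_ideal_genideal[OF relations_in_polys(1)])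

text \<open>The relation of the cut {i} has exponent at most \<open>card E\<close>. For n = 0 this
  set is not proper and the product relation gives exponent one, whence the successor.\<close>

lemma Var_minus_one_nilpotent:
  assumes "i \<in> {0..n}"
  shows "(Var i - 1) ^ Suc (card E) \<in> ID"
proof -
  have i: "Var i - 1 \<in> polys {0..n}" using assms by (intro in_carrier)
  have "\<exists>d\<le>Suc (card E). (Var i - 1) ^ d \<in> ID"
  proof (cases "n = 0")
    case True
    then have "Var i - 1 \<in> D_relations" using assms unfolding D_relations_def by simp
    then show ?thesis using genideal_incl[OF relations_in_polys(2)] by (intro exI[of _ 1]) simp
  next
    case False
    then have "card {i} \<noteq> card {0..n}" by simp
    then have "{i} \<noteq> {0..n}" by metis
    then have "{i} \<subset> {0..n}" using assms by blast
    then have "((\<Prod>i\<in>{i}. Var i) - 1) ^ boundary_card E {i} \<in> D_relations"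
      unfolding D_relations_def by blast
    then show ?thesis
      using genideal_incl[OF relations_in_polys(2)] boundary_card_le[of "{i}"]
      by (intro exI[of _ "boundary_card E {i}"]) simp
  qed
  then obtain d where "d \<le> Suc (card E)" "(Var i - 1) ^ d \<in> ID" by blast
  then show ?thesis
    using ID.mult_right[OF _ power_in_carrier[OF i, of "Suc (card E) - d"]]
    by (metis le_add_diff_inverse power_add)
qed

sublocale NPhi: nilpotent_ideal E IPhi ZPhi order
  unfolding ZPhi_def
proof (rule nilpotent_idealI[OF IPhi.ideal finite_E])
  show "Var e ^ 2 \<in> IPhi" if "e \<in> E" for e
    using that genideal_incl[OF relations_in_polys(3)] by (auto simp: Phi_relations_def)
qed (auto simp: order_def Var_in_carrier)

sublocale ND: nilpotent_ideal "{0..n}" ID ZD order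
  unfolding ZD_def
  by (rule nilpotent_idealI[OF ID.ideal finite_atLeastAtMost _ Var_minus_one_nilpotent])
    (auto simp: order_def intro!: in_carrier)

notation IPhi.eqv (infix \<open>\<approx>\<^sub>\<Phi>\<close> 50) and ID.eqv (infix \<open>\<approx>\<^sub>D\<close> 50)

section \<open>The elements X, Y and log y and their relations\<close>

definition X :: "nat \<Rightarrow> (nat set, 'k) mpoly" where
  "X i = (\<Sum>e\<in>E. Const (edge_sign i e) * Var e)"

definition Y :: "nat \<Rightarrow> (nat set, 'k) mpoly" where
  "Y i = (\<Prod>e\<in>E. 1 + Const (edge_sign i e) * Var e)"

definition L :: "nat \<Rightarrow> (nat, 'k) mpoly" where
  "L i = fps_eval order fps_log (Var i - 1)"

abbreviation Exp :: "('v, 'k) mpoly \<Rightarrow> ('v, 'k) mpoly" where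
  "Exp \<equiv> fps_eval order (fps_exp 1)"

lemma Var_in_ZPhi: "e \<in> E \<Longrightarrow> Var e \<in> ZPhi"
  unfolding ZPhi_def by (rule genideal_incl) (auto simp: Var_in_carrier)

lemma Var_minus_one_in_ZD: "i \<in> {0..n} \<Longrightarrow> Var i - 1 \<in> ZD"
  unfolding ZD_def by (rule genideal_incl) (auto intro!: in_carrier)

lemma scaled_Var_in_ZPhi: "e \<in> E \<Longrightarrow> Const c * Var e \<in> ZPhi"
  using poly_ideal.mult_left[OF poly_ideal.intro[OF NPhi.ideal_Z] Const_in_polys Var_in_ZPhi] .

lemma X_in_ZPhi: "X i \<in> ZPhi"
  unfolding X_def by (intro NPhi.Z_sum scaled_Var_in_ZPhi)

lemma X_in_polys: "X i \<in> polys E"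
  by (rule NPhi.Z_carr[OF X_in_ZPhi])

lemma Y_in_polys: "Y i \<in> polys E"
  unfolding Y_def by (auto intro!: polys_closed)

lemma L_in_ZD: "i \<in> {0..n} \<Longrightarrow> L i \<in> ZD"
  unfolding L_def by (intro ND.fps_eval_in_Z Var_minus_one_in_ZD) simp_all

lemma L_in_polys: "i \<in> {0..n} \<Longrightarrow> L i \<in> polys {0..n}"
  by (rule ND.Z_carr[OF L_in_ZD])

lemma Exp_L: "i \<in> {0..n} \<Longrightarrow> Exp (L i) \<approx>\<^sub>D Var i"
  using ND.exp_log[OF Var_minus_one_in_ZD] by (simp add: L_def)

lemma Var_square_in_IPhi: "e \<in> E \<Longrightarrow> Var e ^ 2 \<in> IPhi"
  using genideal_incl[OF relations_in_polys(3)] by (auto simp: Phi_relations_def)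

lemma Exp_X: "Exp (X i) \<approx>\<^sub>\<Phi> Y i"
proof -
  have "Exp (X i) \<approx>\<^sub>\<Phi> (\<Prod>e\<in>E. Exp (Const (edge_sign i e) * Var e))"
    unfolding X_def by (intro NPhi.exp_sum scaled_Var_in_ZPhi)
  also have "\<dots> \<approx>\<^sub>\<Phi> Y i"
    unfolding Y_def
  proof (intro IPhi.eqv_prod NPhi.exp_square_zero)
    fix e assume e: "e \<in> E"
    show "Const (edge_sign i e) * Var e \<in> polys E"
      using e by (auto intro!: polys_closed)
    show "(Const (edge_sign i e) * Var e) ^ 2 \<in> IPhi"
      unfolding power_mult_distrib
      by (intro IPhi.mult_left Var_square_in_IPhi e power_in_carrier Const_in_polys)
  qed
  finally show ?thesis .
qed

lemma Log_Y: "fps_eval order fps_log (Y i - 1) \<approx>\<^sub>\<Phi> X i"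
proof -
  have "Y i - 1 \<approx>\<^sub>\<Phi> Exp (X i) - 1"
    by (intro IPhi.eqv_diff IPhi.eqv_sym[OF Exp_X] IPhi.eqv_refl one_in_carrier)
  from IPhi.eqv_trans[OF NPhi.fps_eval_eqv[OF this] NPhi.log_exp[OF X_in_ZPhi]] show ?thesis .
qed

lemma prod_Y: "(\<Prod>i\<in>I. Y i) \<approx>\<^sub>\<Phi> Exp (\<Sum>i\<in>I. X i)"
proof -
  have "Exp (\<Sum>i\<in>I. X i) \<approx>\<^sub>\<Phi> (\<Prod>i\<in>I. Exp (X i))" by (intro NPhi.exp_sum X_in_ZPhi)
  also have "\<dots> \<approx>\<^sub>\<Phi> (\<Prod>i\<in>I. Y i)" by (intro IPhi.eqv_prod Exp_X)
  finally show ?thesis by (rule IPhi.eqv_sym)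
qed

lemma sum_X: "(\<Sum>i\<in>I. X i) = (\<Sum>e\<in>E. Const (cut_sign I e) * Var e)"
proof -
  have "(Const (cut_sign I e) :: (nat set, 'k) mpoly) = (\<Sum>i\<in>I. Const (edge_sign i e))" for e
    unfolding cut_sign_def by (induction I rule: infinite_finite_induct) simp_all
  then show ?thesis
    unfolding X_def by (simp add: sum_distrib_right sum.swap[of _ I])
qed

lemma cut_sign_all: "e \<in> E \<Longrightarrow> cut_sign {0..n} e = (0 :: 'k)"
  by (elim simple_graph_edgeE[OF graph]) (simp add: cut_sign_pair)

lemma sum_X_all: "(\<Sum>i\<in>{0..n}. X i) = 0"
  by (simp add: sum_X cut_sign_all)

text \<open>Only crossing edges survive in the sum. It has as many square-zero terms as the exponent
  says, and the product of all of them vanishes because removing a whole cut disconnects the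
  graph.\<close>

lemma sum_X_power:
  assumes I: "I \<subseteq> {0..n}" "I \<noteq> {}" "I \<noteq> {0..n}"
  shows "(\<Sum>i\<in>I. X i) ^ boundary_card E I \<in> IPhi"
proof -
  let ?S = "{e \<in> E. card (e \<inter> I) = 1}"
  have fin: "finite I" using I(1) finite_subset by blast
  have "cut_sign I e = (0 :: 'k)" if "e \<in> E - ?S" for e
    using that simple_graph_edgeE[OF graph, of e] cut_sign_eq_0_iff[OF _ fin] by auto
  then have eq: "(\<Sum>i\<in>I. X i) = (\<Sum>e\<in>?S. Const (cut_sign I e) * Var e)"
    unfolding sum_X by (intro sum.mono_neutral_right finite_E) auto
  have "(\<Sum>e\<in>?S. Const (cut_sign I e) * Var e) ^ card ?S \<in> IPhi"
  proof (rule IPhi.sum_power_card_in)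
    fix e assume e: "e \<in> ?S"
    then show "Const (cut_sign I e) * Var e \<in> polys E" by (auto intro!: polys_closed)
    show "(Const (cut_sign I e) * Var e) ^ 2 \<in> IPhi"
      unfolding power_mult_distrib using e
      by (intro IPhi.mult_left Var_square_in_IPhi power_in_carrier Const_in_polys) auto
  next
    have "\<not> slim n E ?S"
      using cut_meets_connected[OF simple_graph_mono[OF graph] _ I, of "E - ?S"]
      by (auto simp: slim_def)
    then have "(\<Prod>e\<in>?S. Var e) \<in> (Phi_relations n E :: (nat set, 'k) mpoly set)"
      unfolding Phi_relations_def by blast
    then have "(\<Prod>e\<in>?S. Var e) \<in> IPhi" by (rule genideal_incl[OF relations_in_polys(3)])
    then show "(\<Prod>e\<in>?S. Const (cut_sign I e) * Var e) \<in> IPhi"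
      unfolding prod.distrib by (intro IPhi.mult_left prod_in_carrier Const_in_polys)
  qed (use finite_E in auto)
  then show ?thesis by (simp add: eq boundary_card_def)
qed

text \<open>The cut relations follow from \<open>sum_X_power\<close> through
  \<open>exp_minus_one_power\<close>, and the product relation from the vanishing of the sum of all
  \<open>X i\<close>.\<close>

lemma subst_Y_ID:
  assumes "p \<in> ID"
  shows "subst Y p \<in> IPhi"
proof -
  let ?J = "{p \<in> polys {0..n}. subst Y p \<in> IPhi}"
  have "D_relations \<subseteq> ?J"
  proof
    fix p assume p: "p \<in> D_relations"
    then have carr: "p \<in> polys {0..n}" using relations_in_polys(2) by blast
    from p consider I where "I \<noteq> {}" "I \<subset> {0..n}" "p = ((\<Prod>i\<in>I. Var i) - 1) ^ boundary_card E I"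
      | "p = (\<Prod>i\<in>{0..n}. Var i) - 1"
      by (auto simp: D_relations_def)
    then have "subst Y p \<in> IPhi"
    proof cases
      case 1
      then have "(\<Sum>i\<in>I. X i) ^ boundary_card E I \<in> IPhi" by (intro sum_X_power) auto
      then have "((\<Prod>i\<in>I. Y i) - 1) ^ boundary_card E I \<in> IPhi"
        using NPhi.exp_minus_one_power[OF _ prod_Y[of I]] by (simp add: NPhi.Z_sum X_in_ZPhi)
      then show ?thesis by (simp add: 1(3) subst_prod)
    next
      case 2
      have "(\<Prod>i\<in>{0..n}. Y i) \<approx>\<^sub>\<Phi> 1"
        using prod_Y[of "{0..n}"] by (simp only: sum_X_all NPhi.exp_0)
      then show ?thesis by (simp add: 2 subst_prod IPhi.eqv_def)
    qed
    with carr show "p \<in> ?J" by blast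
  qed
  then have "ID \<subseteq> ?J"
    by (intro genideal_least IPhi.ideal_vimage_subst Y_in_polys)
  with assms show ?thesis by blast
qed

text \<open>Here \<open>exp_minus_one_power\<close> is read in the other direction, from the
  relations of \<D> to powers of sums of logarithms.\<close>

lemma subst_L_IB:
  assumes "p \<in> IB"
  shows "subst L p \<in> ID"
proof -
  let ?J = "{p \<in> polys {1..n}. subst L p \<in> ID}"
  have "B_relations \<subseteq> ?J"
  proof
    fix p assume p: "p \<in> B_relations"
    then have carr: "p \<in> polys {1..n}" using relations_in_polys(1) by blast
    from p obtain I where I: "I \<noteq> {}" "I \<subseteq> {1..n}" "p = (\<Sum>i\<in>I. Var i) ^ boundary_card E I"
      by (auto simp: B_relations_def)
    have sub: "I \<subseteq> {0..n}" "I \<subset> {0..n}" using I(2) by (auto dest: subsetD)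
    have Z: "(\<Sum>i\<in>I. L i) \<in> ZD" using sub by (intro ND.Z_sum L_in_ZD) auto
    have "Exp (\<Sum>i\<in>I. L i) \<approx>\<^sub>D (\<Prod>i\<in>I. Exp (L i))"
      using sub by (intro ND.exp_sum L_in_ZD) auto
    also have "\<dots> \<approx>\<^sub>D (\<Prod>i\<in>I. Var i)"
      using sub by (intro ID.eqv_prod Exp_L) auto
    finally have "(\<Prod>i\<in>I. Var i) \<approx>\<^sub>D Exp (\<Sum>i\<in>I. L i)" by (rule ID.eqv_sym)
    moreover have "((\<Prod>i\<in>I. Var i) - 1) ^ boundary_card E I \<in> ID"
      using I(1) sub(2) by (intro genideal_incl[OF relations_in_polys(2)]) (auto simp: D_relations_def)
    ultimately have "(\<Sum>i\<in>I. L i) ^ boundary_card E I \<in> ID"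
      using ND.exp_minus_one_power[OF Z] by blast
    then show "p \<in> ?J" using carr by (simp add: I(3) subst_sum)
  qed
  then have "IB \<subseteq> ?J"
    by (intro genideal_least ID.ideal_vimage_subst L_in_polys) auto
  with assms show ?thesis by blast
qed

lemma subst_X_if_subst_L:
  assumes p: "p \<in> polys {1..n}" "subst L p \<in> ID"
  shows "subst X p \<in> IPhi"
proof -
  have "subst Y (L i) \<approx>\<^sub>\<Phi> X i" for i
    using Log_Y by (simp add: L_def fps_eval_subst)
  then have "subst (\<lambda>i. subst Y (L i)) p \<approx>\<^sub>\<Phi> subst X p"
    by (rule IPhi.eqv_subst[OF p(1)])
  moreover have "subst Y (subst L p) \<in> IPhi" by (rule subst_Y_ID[OF p(2)])
  ultimately show ?thesis using IPhi.eqv_ideal by (simp add: subst_subst)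
qed

text \<open>Polynomials with this property form an ideal because subsets of slim sets are slim. A
  non-slim product has a variable outside any given slim set, and this factor is never
  differentiated away.\<close>

lemma constant_term_slim_derivative:
  assumes "p \<in> IPhi" "distinct es" "set es \<subseteq> E" "slim n E (set es)"
  shows "constant_term (fold pderivative es p) = 0"
proof -
  let ?J = "{p \<in> polys E. \<forall>es. distinct es \<longrightarrow> set es \<subseteq> E \<longrightarrow> slim n E (set es) \<longrightarrow>
    constant_term (fold pderivative es p) = 0} :: (nat set, 'k) mpoly set"
  have "ideal ?J (poly_algebra E)"
  proof (rule poly_idealI)
    fix p q :: "(nat set, 'k) mpoly" assume p: "p \<in> polys E" and q: "q \<in> ?J"
    have "constant_term (fold pderivative es (p * q)) = 0"
      if es: "distinct es" "set es \<subseteq> E" "slim n E (set es)" for es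
    proof (rule constant_term_fold_mult[OF es(1) order_refl])
      fix es' assume es': "distinct es'" "set es' \<subseteq> set es"
      then have "slim n E (set es')"
        using es(3) unfolding slim_def by (elim connected_graph_mono) auto
      then show "constant_term (fold pderivative es' q) = 0"
        using q es es' by auto
    qed
    then show "p * q \<in> ?J" using p q by (auto intro: mult_in_carrier)
  qed (auto simp: fold_pderivative_add intro: add_in_carrier)
  moreover have "Phi_relations n E \<subseteq> ?J"
  proof
    fix p :: "(nat set, 'k) mpoly" assume p: "p \<in> Phi_relations n E"
    have "constant_term (fold pderivative es p) = 0"
      if es: "distinct es" "set es \<subseteq> E" "slim n E (set es)" for es
      using p unfolding Phi_relations_def
    proof (elim UnE CollectE exE conjE)
      fix e assume "p = Var e ^ 2"
      then show ?thesis using fold_pderivative_square[OF es(1)] by simp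
    next
      fix H assume H: "p = (\<Prod>e\<in>H. Var e)" "H \<subseteq> E" "\<not> slim n E H"
      have "\<not> H \<subseteq> set es"
        using H(3) es(3) unfolding slim_def by (metis Diff_mono connected_graph_mono subset_refl)
      then obtain e where e: "e \<in> H" "e \<notin> set es" by blast
      have "p = (\<Prod>e\<in>H - {e}. Var e) * Var e"
        using e(1) H finite_subset[OF H(2) finite_E] by (simp add: prod.remove mult.commute)
      then show ?thesis by (simp add: fold_pderivative_mult_Var[OF e(2)])
    qed
    then show "p \<in> ?J" using p relations_in_polys(3) by blast
  qed
  ultimately have "IPhi \<subseteq> ?J" by (rule genideal_least)
  then show ?thesis using assms by blast
qed

text \<open>The chain rule: \<open>X i\<close> is linear, and its coefficient at
  \<open>Var e\<close> is the value of \<open>edge_derivative n e\<close> on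
  \<open>Var i\<close>.\<close>

lemma pderivative_subst_X:
  assumes "p \<in> polys {1..n}" "e \<in> E"
  shows "pderivative e (subst X p) = subst X (edge_derivative n e p)"
  using assms(1)
proof (induction rule: polys_induct)
  case (Var i)
  have "pderivative e (X i) = (\<Sum>f\<in>E. if f = e then Const (edge_sign i e) else 0)"
    unfolding X_def derivation.sum[OF derivation_pderivative] derivation.Const_mult[OF derivation_pderivative]
    by (intro sum.cong) (auto simp: pderivative_Var)
  then show ?case using Var assms(2) finite_E by (simp add: edge_derivative_Var)
qed (simp_all add: pderivative_add pderivative_mult derivation.add[OF derivation_edge_derivative]
    derivation.mult[OF derivation_edge_derivative] derivation.Const[OF derivation_edge_derivative])

lemma null_poly_if_subst_X:
  assumes p: "p \<in> polys {1..n}" "subst X p \<in> IPhi"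
  shows "null_poly n E {} p"
  unfolding null_poly_def
proof (intro allI impI)
  fix es assume es: "distinct es" "set es \<subseteq> E" "connected_graph n (E \<union> {} - set es)"
  have "fold pderivative es (subst X q) = subst X (fold (edge_derivative n) es q)"
    if "q \<in> polys {1..n}" for q
    using that es(2)
    by (induction es arbitrary: q) (auto simp: pderivative_subst_X edge_derivative_in_polys simp del: One_nat_def)
  moreover have "constant_term (X i) = 0" for i
    by (simp add: X_def constant_term_sum)
  ultimately have "constant_term (fold (edge_derivative n) es p) =
      constant_term (fold pderivative es (subst X p))"
    using p(1) by (simp add: constant_term_subst)
  also have "\<dots> = 0"
    using constant_term_slim_derivative[OF p(2) es(1,2)] es(3) by (simp add: slim_def)
  finally show "constant_term (fold (edge_derivative n) es p) = 0" .
qed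

lemma cut_ideal_subset_IB:
  assumes "p \<in> cut_ideal n E {}"
  shows "p \<in> IB"
  using assms
proof (induction rule: cut_ideal.induct)
  case (add p s I)
  have "cut_form I ^ boundary_card E I \<in> B_relations"
    using add.hyps unfolding B_relations_def cut_form_def closed_cut_def by blast
  then have "cut_form I ^ boundary_card E I \<in> IB"
    by (rule genideal_incl[OF relations_in_polys(1)])
  with add show ?case by (intro IB.add IB.mult_left) (simp_all add: flat_polys_def)
qed (rule IB.zero)

lemma flat_polys_empty: "flat_polys n {} = polys {1..n}"
  by (simp add: flat_polys_def)

lemmas null_poly_basis_E = null_poly_basis[of E n "{}", where 'k = 'k]

lemma kernels:
  assumes p: "p \<in> polys {1..n}"
  shows "subst L p \<in> ID \<longleftrightarrow> p \<in> IB" "subst X p \<in> IPhi \<longleftrightarrow> p \<in> IB" "null_poly n E {} p \<longleftrightarrow> p \<in> IB"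
proof -
  have "p \<in> IB" if "null_poly n E {} p"
    using null_poly_basis_E finite_E graph that p cut_ideal_subset_IB
    by (simp add: flat_polys_empty forest_def)
  then show "subst L p \<in> ID \<longleftrightarrow> p \<in> IB" "subst X p \<in> IPhi \<longleftrightarrow> p \<in> IB" "null_poly n E {} p \<longleftrightarrow> p \<in> IB"
    using subst_L_IB subst_X_if_subst_L[OF p] null_poly_if_subst_X[OF p] by blast+
qed

end


section \<open>The four algebras as images of one polynomial ring\<close>

context graph_algebras
begin

definition fB :: "(nat, 'k) mpoly \<Rightarrow> (nat, 'k) mpoly set" where
  "fB = quot_map {1..n} B_relations"

definition fC :: "(nat, 'k) mpoly \<Rightarrow> (nat set, 'k) mpoly set" where
  "fC p = quot_map E (Phi_relations n E) (subst X p)"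

definition fD :: "(nat, 'k) mpoly \<Rightarrow> (nat, 'k) mpoly set" where
  "fD p = quot_map {0..n} D_relations (subst L p)"

lemma alg_B_eq: "alg_B n E = presented_algebra {1..n} B_relations"
  by (simp add: alg_B_def B_relations_def)

lemma alg_D_eq: "alg_D n E = presented_algebra {0..n} D_relations"
  unfolding alg_D_def D_relations_def ..

lemma fB: "poly_hom {1..n} (alg_B n E) fB" "fB ` polys {1..n} = carrier (alg_B n E)"
  "p \<in> polys {1..n} \<Longrightarrow> fB p = \<zero>\<^bsub>alg_B n E\<^esub> \<longleftrightarrow> p \<in> IB"
  unfolding fB_def alg_B_eq
  by (intro poly_hom_quot_map quot_map_image quot_map_eq_zero_iff relations_in_polys)+

lemma fD: "poly_hom {1..n} (alg_D n E) fD" "fD ` polys {1..n} = carrier (alg_D n E)"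
  "p \<in> polys {1..n} \<Longrightarrow> fD p = \<zero>\<^bsub>alg_D n E\<^esub> \<longleftrightarrow> p \<in> IB"
proof -
  interpret q: poly_hom "{0..n}" "alg_D n E" "quot_map {0..n} D_relations"
    unfolding alg_D_eq by (intro poly_hom_quot_map relations_in_polys)
  have L: "subst L p \<in> polys {0..n}" if "p \<in> polys {1..n}" for p
    using that by (rule subst_in_polys) (auto intro: L_in_polys)
  show hom: "poly_hom {1..n} (alg_D n E) fD"
    unfolding fD_def[abs_def]
    by (rule poly_hom_subst[OF q.poly_hom_axioms]) (auto intro: L_in_polys)
  have zero: "quot_map {0..n} D_relations p = \<zero>\<^bsub>alg_D n E\<^esub> \<longleftrightarrow> p \<in> ID" if "p \<in> polys {0..n}" for p
    unfolding alg_D_eq by (rule quot_map_eq_zero_iff[OF relations_in_polys(2) that])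
  show "fD p = \<zero>\<^bsub>alg_D n E\<^esub> \<longleftrightarrow> p \<in> IB" if "p \<in> polys {1..n}" for p
    using that by (simp only: fD_def zero L kernels(1))
  \<comment> \<open>Surjectivity: every generator of \<D> has to be reached from the variables 1 to
    n alone.\<close>
  have exp: "\<exists>r\<in>polys {1..n}. subst L r \<approx>\<^sub>D Var i" if i: "i \<in> {0..n}" for i
  proof (cases "i = 0")
    case False
    then have "i \<in> {1..n}" using i by simp
    then show ?thesis
      using Exp_L[OF i] by (intro bexI[of _ "Exp (Var i)"])
        (simp_all add: fps_eval_subst fps_eval_in_polys Var_in_carrier del: One_nat_def)
  next
    \<comment> \<open>The product relation makes \<open>Var 0\<close> inverse to the product of the
      other variables, hence congruent to the exponential of minus the sum of their
      logarithms.\<close>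
    case True
    let ?s = "\<Sum>i\<in>{1..n}. L i"
    let ?y = "\<Prod>i\<in>{1..n}. Var i :: (nat, 'k) mpoly"
    have s: "?s \<in> ZD" by (intro ND.Z_sum L_in_ZD) auto
    have V0: "(Var 0 :: (nat, 'k) mpoly) \<in> polys {0..n}" by (intro Var_in_carrier) simp
    have E: "Exp (- ?s) \<in> polys {0..n}"
      by (intro fps_eval_in_polys ND.Z_carr ND.Z_uminus s)
    have "Exp ?s \<approx>\<^sub>D (\<Prod>i\<in>{1..n}. Exp (L i))"
      by (intro ND.exp_sum L_in_ZD) auto
    also have "\<dots> \<approx>\<^sub>D ?y" by (intro ID.eqv_prod Exp_L) auto
    finally have "Exp ?s \<approx>\<^sub>D ?y" .
    have "{0..n} = insert 0 {1..n}" by auto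
    then have "(\<Prod>i\<in>{0..n}. Var i) = Var 0 * ?y" by simp
    then have "Var 0 * ?y - 1 \<in> ID"
      using genideal_incl[OF relations_in_polys(2)] by (auto simp: D_relations_def)
    then have y: "Var 0 * ?y \<approx>\<^sub>D 1"
      using V0 by (auto simp: ID.eqv_def intro!: polys_closed)
    have "Exp (- ?s) \<approx>\<^sub>D Exp (- ?s) * (Var 0 * ?y)"
      using ID.eqv_mult[OF ID.eqv_refl[OF E] ID.eqv_sym[OF y]] by simp
    also have "\<dots> \<approx>\<^sub>D Exp (- ?s) * (Var 0 * Exp ?s)"
      by (intro ID.eqv_mult ID.eqv_refl E V0 ID.eqv_sym[OF \<open>Exp ?s \<approx>\<^sub>D ?y\<close>])
    also have "\<dots> = Var 0 * (Exp (- ?s) * Exp ?s)" by (simp add: mult_ac)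
    also have "\<dots> \<approx>\<^sub>D Var 0 * Exp (- ?s + ?s)"
      by (intro ID.eqv_mult ID.eqv_refl V0 ID.eqv_sym[OF ND.exp_add] ND.Z_uminus s)
    also have "\<dots> = Var 0" by (simp add: ND.exp_0)
    finally have "Exp (- ?s) \<approx>\<^sub>D Var 0" .
    moreover have "subst L (Exp (- (\<Sum>i\<in>{1..n}. Var i))) = Exp (- ?s)"
      by (simp add: fps_eval_subst subst_sum)
    moreover have "Exp (- (\<Sum>i\<in>{1..n}. Var i)) \<in> polys {1..n}"
      by (auto intro!: fps_eval_in_polys polys_closed)
    ultimately show ?thesis using True by metis
  qed
  have "\<exists>r\<in>polys {1..n}. subst L r \<approx>\<^sub>D p" if "p \<in> polys {0..n}" for p
    using that
  proof (induction rule: polys_induct)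
    case (Const c)
    show ?case by (intro bexI[of _ "Const c"]) (simp_all add: ID.eqv_refl)
  next
    case (Var i)
    then show ?case by (rule exp)
  next
    case (add p q)
    then obtain r s where "r \<in> polys {1..n}" "s \<in> polys {1..n}" "subst L r \<approx>\<^sub>D p" "subst L s \<approx>\<^sub>D q"
      by blast
    then show ?case by (intro bexI[of _ "r + s"]) (simp_all add: ID.eqv_add add_in_carrier)
  next
    case (mult p q)
    then obtain r s where "r \<in> polys {1..n}" "s \<in> polys {1..n}" "subst L r \<approx>\<^sub>D p" "subst L s \<approx>\<^sub>D q"
      by blast
    then show ?case by (intro bexI[of _ "r * s"]) (simp_all add: ID.eqv_mult mult_in_carrier)
  qed
  then have "quot_map {0..n} D_relations p \<in> fD ` polys {1..n}" if p: "p \<in> polys {0..n}" for p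
  proof -
    obtain r where r: "r \<in> polys {1..n}" "subst L r \<approx>\<^sub>D p"
      using \<open>\<And>p. p \<in> polys {0..n} \<Longrightarrow> \<exists>r\<in>polys {1..n}. subst L r \<approx>\<^sub>D p\<close> p by blast
    then have "fD r = quot_map {0..n} D_relations p"
      unfolding fD_def using q.eq_iff[OF L[OF r(1)] p] zero[of "subst L r - p"]
      by (simp add: ID.eqv_def diff_in_polys)
    then show ?thesis using r(1) by blast
  qed
  moreover have "carrier (alg_D n E) = quot_map {0..n} D_relations ` polys {0..n}"
    unfolding alg_D_eq by (rule quot_map_image[symmetric])
  ultimately show "fD ` polys {1..n} = carrier (alg_D n E)"
    using poly_hom.closed[OF hom] by auto
qed

section \<open>The subalgebras \<C> and \<K> of \<Phi>\<close>

abbreviation "qPhi \<equiv> quot_map E (Phi_relations n E :: (nat set, 'k) mpoly set)"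

lemma qPhi: "poly_hom E (Phi n E) qPhi"
  unfolding Phi_def by (rule poly_hom_quot_map[OF relations_in_polys(3)])

lemma qPhi_eq_iff: "p \<in> polys E \<Longrightarrow> q \<in> polys E \<Longrightarrow> qPhi p = qPhi q \<longleftrightarrow> p \<approx>\<^sub>\<Phi> q"
proof -
  interpret q: poly_hom E "Phi n E" qPhi by (rule qPhi)
  show "p \<in> polys E \<Longrightarrow> q \<in> polys E \<Longrightarrow> ?thesis"
    using q.eq_iff quot_map_eq_zero_iff[OF relations_in_polys(3)]
    by (simp add: IPhi.eqv_def Phi_def diff_in_polys)
qed

lemma phi_eq: "phi n E e = qPhi (Var e)"
  by (simp add: phi_def quot_map_def)

lemma scaled_in_Phi:
  assumes "e \<in> E"
  shows "c \<odot>\<^bsub>Phi n E\<^esub> qPhi (Var e) \<in> carrier (Phi n E)"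
  using scaled_phi_in_carrier[OF assms, where n = n and c = c] unfolding phi_eq .

lemma X_gen_eq: "X_gen n E i = qPhi (X i)"
proof -
  interpret q: poly_hom E "Phi n E" qPhi by (rule qPhi)
  have "qPhi (X i) = (\<Oplus>\<^bsub>Phi n E\<^esub>e\<in>E. qPhi (Const (edge_sign i e) * Var e))"
    unfolding X_def by (intro q.sum finite_E) (auto intro!: polys_closed)
  also have "\<dots> = X_gen n E i"
    unfolding X_gen_def phi_eq
    by (intro q.A.finsum_cong') (auto simp: q.scale Var_in_carrier scaled_in_Phi)
  finally show ?thesis ..
qed

lemma Y_gen_eq: "Y_gen n E i = qPhi (Y i)"
proof -
  interpret q: poly_hom E "Phi n E" qPhi by (rule qPhi)
  have eq: "qPhi (1 + Const (edge_sign i e) * Var e) =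
      \<one>\<^bsub>Phi n E\<^esub> \<oplus>\<^bsub>Phi n E\<^esub> edge_sign i e \<odot>\<^bsub>Phi n E\<^esub> qPhi (Var e)" if "e \<in> E" for e
    using that by (simp add: q.add q.one q.scale Var_in_carrier mult_in_carrier one_in_carrier)
  have "qPhi (Y i) = (\<Otimes>\<^bsub>Phi n E\<^esub>e\<in>E. qPhi (1 + Const (edge_sign i e) * Var e))"
    unfolding Y_def by (intro q.prod finite_E) (auto intro!: polys_closed)
  also have "\<dots> = Y_gen n E i"
    unfolding Y_gen_def phi_eq
    by (intro q.A.finprod_cong') (auto simp: eq scaled_in_Phi)
  finally show ?thesis ..
qed

lemma fC: "poly_hom {1..n} (alg_C n E) fC" "fC ` polys {1..n} = carrier (alg_C n E)"
  "p \<in> polys {1..n} \<Longrightarrow> fC p = \<zero>\<^bsub>alg_C n E\<^esub> \<longleftrightarrow> p \<in> IB"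
proof -
  have hom: "poly_hom {1..n} (Phi n E) fC"
    unfolding fC_def[abs_def] by (intro poly_hom_subst[OF qPhi] X_in_polys)
  have "(\<lambda>i. fC (Var i)) ` {1..n} = X_gen n E ` {1..n}"
    by (simp add: fC_def X_gen_eq)
  then have eq: "alg_C n E = subalgebra_generated (Phi n E) ((\<lambda>i. fC (Var i)) ` {1..n})"
    by (simp add: alg_C_def)
  note sub = poly_hom_subalgebra[OF hom, folded eq]
  show "poly_hom {1..n} (alg_C n E) fC" "fC ` polys {1..n} = carrier (alg_C n E)" by (rule sub)+
  assume p: "p \<in> polys {1..n}"
  then have "subst X p \<in> polys E" by (rule subst_in_polys) (rule X_in_polys)
  then have "fC p = \<zero>\<^bsub>Phi n E\<^esub> \<longleftrightarrow> subst X p \<in> IPhi"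
    unfolding fC_def Phi_def by (intro quot_map_eq_zero_iff relations_in_polys)
  then show "fC p = \<zero>\<^bsub>alg_C n E\<^esub> \<longleftrightarrow> p \<in> IB"
    using kernels(2)[OF p] by (simp add: sub(3))
qed

text \<open>Truncated exp and log are polynomials, so a subalgebra contains the generators of \<K>
  iff it contains those of \<C>. Both algebras are then intersections of the same family, hence
  equal and not merely isomorphic.\<close>

lemma alg_K_eq_alg_C: "(alg_K n E :: ('k, _) module) = alg_C n E"
proof -
  interpret q: poly_hom E "Phi n E" qPhi by (rule qPhi)
  let ?closed = "\<lambda>B. subring B (Phi n E) \<and> (\<forall>c :: 'k. \<forall>x\<in>B. c \<odot>\<^bsub>Phi n E\<^esub> x \<in> B)"
  have B_one: "\<one>\<^bsub>Phi n E\<^esub> \<in> B" and B_zero: "\<zero>\<^bsub>Phi n E\<^esub> \<in> B"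
    and B_mult: "\<And>x y. x \<in> B \<Longrightarrow> y \<in> B \<Longrightarrow> x \<otimes>\<^bsub>Phi n E\<^esub> y \<in> B"
    and B_add: "\<And>x y. x \<in> B \<Longrightarrow> y \<in> B \<Longrightarrow> x \<oplus>\<^bsub>Phi n E\<^esub> y \<in> B"
    and B_scale: "\<And>c x. x \<in> B \<Longrightarrow> c \<odot>\<^bsub>Phi n E\<^esub> x \<in> B"
    if "?closed B" for B
    using that subringE(2,3,6,7)[of B "Phi n E"] by blast+
  have eval: "qPhi (fps_eval order f p) \<in> B"
    if B: "?closed B" and p: "p \<in> polys E" "qPhi p \<in> B" for B p f
  proof -
    have pow: "qPhi (p ^ k) \<in> B" for k
    proof (induction k)
      case (Suc k)
      then show ?case using p by (simp add: q.mult power_in_carrier B_mult[OF B])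
    qed (simp add: q.one B_one[OF B])
    have "qPhi (\<Sum>k\<in>S. Const (fps_nth f k) * p ^ k) \<in> B" for S
    proof (induction S rule: infinite_finite_induct)
      case (insert k S)
      then show ?case
        using p pow B_add[OF B] B_scale[OF B]
        by (simp add: q.add q.scale power_in_carrier mult_in_carrier sum_in_carrier)
    qed (simp_all add: q.zero B_zero[OF B])
    then show ?thesis by (simp add: fps_eval_def)
  qed
  have minus_one: "qPhi (p - 1) \<in> B" if B: "?closed B" and p: "p \<in> polys E" "qPhi p \<in> B" for B p
  proof -
    have "qPhi (Const (- 1)) \<in> B"
      by (simp only: q.const B_one[OF B] B_scale[OF B])
    then have "qPhi (p + Const (- 1)) \<in> B"
      using p by (simp only: q.add Const_in_polys B_add[OF B])
    then show ?thesis by simp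
  qed
  have Y_if_X: "Y_gen n E i \<in> B" if B: "?closed B" and X: "X_gen n E i \<in> B" for B i
  proof -
    have "qPhi (Exp (X i)) \<in> B" using eval[OF B X_in_polys] X by (simp add: X_gen_eq)
    moreover have "qPhi (Exp (X i)) = qPhi (Y i)"
      using Exp_X[of i] by (simp add: qPhi_eq_iff fps_eval_in_polys X_in_polys Y_in_polys)
    ultimately show ?thesis by (simp add: Y_gen_eq)
  qed
  have X_if_Y: "X_gen n E i \<in> B" if B: "?closed B" and Y: "Y_gen n E i \<in> B" for B i
  proof -
    have Y1: "Y i - 1 \<in> polys E" by (intro polys_closed Y_in_polys)
    have "qPhi (fps_eval order fps_log (Y i - 1)) \<in> B"
      using eval[OF B Y1 minus_one[OF B Y_in_polys]] Y by (simp add: Y_gen_eq)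
    moreover have "qPhi (fps_eval order fps_log (Y i - 1)) = qPhi (X i)"
      using Log_Y[of i] by (simp add: qPhi_eq_iff fps_eval_in_polys X_in_polys Y1)
    ultimately show ?thesis by (simp add: X_gen_eq)
  qed
  \<comment> \<open>\<K> has a generator at the vertex 0 but \<C> has none; \<open>X 0\<close> is
    recovered as minus the sum of the others.\<close>
  have X0: "X_gen n E 0 \<in> B" if B: "?closed B" and X: "X_gen n E ` {1..n} \<subseteq> B" for B
  proof -
    have "{0..n} = insert 0 {1..n}" by auto
    then have "X 0 = - (\<Sum>i\<in>{1..n}. X i)"
      using sum_X_all by (simp add: eq_neg_iff_add_eq_0)
    then have X0: "X 0 = Const (- 1) * (\<Sum>i\<in>{1..n}. X i)" by simp
    have "qPhi (\<Sum>i\<in>S. X i) \<in> B" if "S \<subseteq> {1..n}" for S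
      using that
    proof (induction S rule: infinite_finite_induct)
      case (insert i S)
      have "qPhi (X i) \<in> B" using X insert.prems by (auto simp: X_gen_eq)
      then show ?case
        using insert by (simp add: q.add X_in_polys sum_in_carrier B_add[OF B])
    qed (simp_all add: q.zero B_zero[OF B])
    then have "qPhi (\<Sum>i\<in>{1..n}. X i) \<in> B" by blast
    then have "qPhi (Const (- 1) * (\<Sum>i\<in>{1..n}. X i)) \<in> B"
      by (subst q.scale) (auto intro: sum_in_carrier X_in_polys B_scale[OF B])
    then show ?thesis by (simp only: X_gen_eq X0)
  qed
  have "X_gen n E ` {1..n} \<subseteq> B \<longleftrightarrow> {\<one>\<^bsub>Phi n E\<^esub>} \<union> Y_gen n E ` {0..n} \<subseteq> B" if B: "?closed B" for B
  proof
    assume X: "X_gen n E ` {1..n} \<subseteq> B"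
    have "X_gen n E i \<in> B" if "i \<in> {0..n}" for i
      using that X X0[OF B X] by (cases "i = 0") auto
    then show "{\<one>\<^bsub>Phi n E\<^esub>} \<union> Y_gen n E ` {0..n} \<subseteq> B"
      using Y_if_X[OF B] B_one[OF B] by auto
  next
    assume Y: "{\<one>\<^bsub>Phi n E\<^esub>} \<union> Y_gen n E ` {0..n} \<subseteq> B"
    show "X_gen n E ` {1..n} \<subseteq> B"
      using Y by (auto intro!: X_if_Y[OF B])
  qed
  note gens = this
  have "{B. {\<one>\<^bsub>Phi n E\<^esub>} \<union> Y_gen n E ` {0..n} \<subseteq> B \<and> ?closed B} = {B. X_gen n E ` {1..n} \<subseteq> B \<and> ?closed B}"
    by (rule Collect_cong) (metis (no_types, lifting) gens)
  then show ?thesis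
    unfolding alg_K_def alg_C_def subalgebra_generated_def by simp
qed

lemma dimension:
  assumes f: "poly_hom {1..n} A f" "f ` polys {1..n} = carrier A"
    and ker: "\<And>p. p \<in> polys {1..n} \<Longrightarrow> f p = \<zero>\<^bsub>A\<^esub> \<longleftrightarrow> p \<in> IB"
  shows "has_dimension A (card (spanning_trees n E))"
proof -
  have "\<exists>b. (\<forall>T\<in>spanning_trees n E. (b T :: (nat, 'k) mpoly) \<in> flat_polys n {}) \<and>
      (\<forall>p\<in>flat_polys n {}. \<exists>c. null_poly n E {} (p - (\<Sum>T\<in>spanning_trees n E. Const (c T) * b T))) \<and>
      (\<forall>c. null_poly n E {} (\<Sum>T\<in>spanning_trees n E. Const (c T) * b T) \<longrightarrow>
        (\<forall>T\<in>spanning_trees n E. c T = 0))"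
    unfolding spanning_trees_eq_completions[OF graph]
    by (rule conjunct2[OF null_poly_basis_E]) (simp_all add: finite_E graph forest_def)
  then obtain b :: "nat set set \<Rightarrow> (nat, 'k) mpoly" where
    "\<forall>T\<in>spanning_trees n E. b T \<in> flat_polys n {}"
    "\<forall>p\<in>flat_polys n {}. \<exists>c. null_poly n E {} (p - (\<Sum>T\<in>spanning_trees n E. Const (c T) * b T))"
    "\<forall>c. null_poly n E {} (\<Sum>T\<in>spanning_trees n E. Const (c T) * b T) \<longrightarrow>
        (\<forall>T\<in>spanning_trees n E. c T = 0)"
    by (elim exE conjE) (rule that, assumption+)
  note b = this(1)[unfolded flat_polys_empty, rule_format]
    and span = this(2)[unfolded flat_polys_empty, rule_format]
    and indep = this(3)[THEN spec, THEN mp]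
  have comb: "(\<Sum>T\<in>spanning_trees n E. Const (c T) * b T) \<in> polys {1..n}" for c
    by (intro sum_in_carrier mult_in_carrier Const_in_polys b)
  show ?thesis
  proof (rule has_dimension_if_basis[OF f _ b])
    show "finite (spanning_trees n E)"
      by (simp add: spanning_trees_eq_completions[OF graph] finite_completions finite_E)
    show "\<exists>c. f (p - (\<Sum>T\<in>spanning_trees n E. Const (c T) * b T)) = \<zero>\<^bsub>A\<^esub>" if "p \<in> polys {1..n}" for p
      using span[OF that] that comb by (simp only: ker kernels(3) diff_in_polys)
    show "\<forall>T\<in>spanning_trees n E. c T = 0"
      if c: "f (\<Sum>T\<in>spanning_trees n E. Const (c T) * b T) = \<zero>\<^bsub>A\<^esub>" for c
    proof (rule indep)
      show "null_poly n E {} (\<Sum>T\<in>spanning_trees n E. Const (c T) * b T)"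
        using c by (simp only: ker kernels(3) comb)
    qed
  qed
qed

end

theorem theorem8:
  fixes n :: nat and E :: "nat set set"
  assumes "simple_graph n E"
  shows "algebra_isomorphic (alg_B n E :: ('k::field_char_0, _) module) (alg_C n E) \<and>
     algebra_isomorphic (alg_B n E :: ('k::field_char_0, _) module) (alg_D n E) \<and>
     algebra_isomorphic (alg_B n E :: ('k::field_char_0, _) module) (alg_K n E) \<and>
     algebra_isomorphic (alg_C n E :: ('k::field_char_0, _) module) (alg_D n E) \<and>
     algebra_isomorphic (alg_C n E :: ('k::field_char_0, _) module) (alg_K n E) \<and>
     algebra_isomorphic (alg_D n E :: ('k::field_char_0, _) module) (alg_K n E) \<and>
     has_dimension (alg_B n E :: ('k::field_char_0, _) module) (card (spanning_trees n E)) \<and>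
     has_dimension (alg_C n E :: ('k::field_char_0, _) module) (card (spanning_trees n E)) \<and>
     has_dimension (alg_D n E :: ('k::field_char_0, _) module) (card (spanning_trees n E)) \<and>
     has_dimension (alg_K n E :: ('k::field_char_0, _) module) (card (spanning_trees n E))"
proof -
  interpret graph_algebras n E "TYPE('k)"
    by (rule graph_algebras.intro[OF assms])
  note B = fB(1,2) and C = fC(1,2) and D = fD(1,2)
  show ?thesis
    \<comment> \<open>With \<K> replaced by \<C>, every claim concerns images of the same polynomial
      ring under maps with kernel \<open>IB\<close>.\<close>
    unfolding alg_K_eq_alg_C
    by (intro conjI algebra_isomorphic_if_same_kernel[OF B C] algebra_isomorphic_if_same_kernel[OF B D]
        algebra_isomorphic_if_same_kernel[OF C D] algebra_isomorphic_if_same_kernel[OF C C]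
        algebra_isomorphic_if_same_kernel[OF D C] dimension[OF B] dimension[OF C] dimension[OF D])
      (simp_all only: fB(3) fC(3) fD(3))
qed

end
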